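(* Let $1<p\le2$ and $\mu_{11},\mu_{12},\mu_{22}>0$. Assume that $\lambda\ge2$, $\mu_{11}>4$ and $(\mu_{11}-4)(\mu_{22}-4)>\mu_{12}^2$. Then the system $$ \begin{cases} -\Delta u_1+\lambda u_1+(\mu_{11}\phi_{u_1}-\mu_{12}\phi_{u_2})u_1=\frac{1}{2\pi}\int_0^{2\pi} |u_1+e^{i\theta}u_2|^{p-1}(u_1+e^{i\theta}u_2)\,d\theta & \text{in }\mathbb{R}^3, \\ -\Delta u_2+\lambda u_2+(\mu_{22}\phi_{u_2}-\mu_{12}\phi_{u_1})u_2=\frac{1}{2\pi}\int_0^{2\pi} |u_2+e^{i\theta}u_1|^{p-1}(u_2+e^{i\theta}u_1)\, d\theta & \text{in }\mathbb{R}^3 \end{cases} $$ has only the trivial solution $(u_1,u_2)=(0,0)$ in $H^1(\mathbb{R}^3)\times H^1(\mathbb{R}^3)$.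
   Context: $H^1(\mathbb{R}^3)$ is the usual Sobolev space of real-valued functions. For a real function $u$, $\phi_u=(4\pi|\cdot|)^{-1}*|u|^2$, i.e. $\phi_u(x)=\int_{\mathbb{R}^3}\frac{u(y)^2}{4\pi|x-y|}\,dy$. Solutions are understood in the weak sense. *)

theory Defs
  imports "HOL-Analysis.Analysis"
begin

type_synonym R3 = "real ^ 3"

definition partial_deriv :: "3 \<Rightarrow> (R3 \<Rightarrow> real) \<Rightarrow> R3 \<Rightarrow> real" where
  "partial_deriv i f x = frechet_derivative f (at x) (axis i 1)"

definition grad :: "(R3 \<Rightarrow> real) \<Rightarrow> R3 \<Rightarrow> R3" where
  "grad f x = (\<chi> i. partial_deriv i f x)"

(* f is of class C^infinity iff every iterated partial derivative
   (foldr over a list of directions) is totally differentiable everywhere. *)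
definition smooth :: "(R3 \<Rightarrow> real) \<Rightarrow> bool" where
  "smooth f \<longleftrightarrow> (\<forall>is x. foldr partial_deriv is f differentiable (at x))"

definition test_functions :: "(R3 \<Rightarrow> real) set" where
  "test_functions = {v. smooth v \<and> compact (closure {x. v x \<noteq> 0})}"

definition square_integrable :: "(R3 \<Rightarrow> 'b::euclidean_space) \<Rightarrow> bool" where
  "square_integrable f \<longleftrightarrow>
     f \<in> borel_measurable lborel \<and> integrable lborel (\<lambda>x. (norm (f x))\<^sup>2)"

definition has_L2_weak_gradient :: "(R3 \<Rightarrow> real) \<Rightarrow> (R3 \<Rightarrow> R3) \<Rightarrow> bool" where
  "has_L2_weak_gradient u g \<longleftrightarrow> square_integrable g \<and>
     (\<forall>v\<in>test_functions. \<forall>i.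
        (LINT x|lborel. u x * partial_deriv i v x) = - (LINT x|lborel. g x $ i * v x))"

(* Elements of the Sobolev space are represented by Borel functions; functions that agree
   almost everywhere represent the same element. *)
definition H1 :: "(R3 \<Rightarrow> real) set" where
  "H1 = {u. square_integrable u \<and> (\<exists>g. has_L2_weak_gradient u g)}"

(* Determined up to a null set for u in H1, and meaningful only for such u. *)
definition weak_gradient :: "(R3 \<Rightarrow> real) \<Rightarrow> R3 \<Rightarrow> R3" where
  "weak_gradient u = (SOME g. has_L2_weak_gradient u g)"

definition newton_potential :: "(R3 \<Rightarrow> real) \<Rightarrow> R3 \<Rightarrow> real" where
  "newton_potential u x = (LINT y|lborel. (u y)\<^sup>2 / (4 * pi * norm (x - y)))"

definition averaged_nonlinearity :: "real \<Rightarrow> real \<Rightarrow> real \<Rightarrow> complex" where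
  "averaged_nonlinearity p s t = 1 / (2 * pi) *
     (LINT \<theta>:{0..2 * pi}|lborel.
        of_real (norm (of_real s + exp (\<i> * of_real \<theta>) * of_real t) powr (p - 1))
          * (of_real s + exp (\<i> * of_real \<theta>) * of_real t))"

(* Weak form, tested against smooth functions of compact support, of
     - Laplace u + lam u + (m phi_u - k phi_w) u = averaged_nonlinearity p u w.
   The right-hand side is a complex-valued integral, so the equation is one in the complex
   numbers. *)
definition weak_solution ::
  "real \<Rightarrow> real \<Rightarrow> real \<Rightarrow> real \<Rightarrow> (R3 \<Rightarrow> real) \<Rightarrow> (R3 \<Rightarrow> real) \<Rightarrow> bool" where
  "weak_solution p lam m k u w \<longleftrightarrow> (\<forall>v\<in>test_functions.
     complex_of_real (LINT x|lborel.
         weak_gradient u x \<bullet> grad v x + lam * u x * v x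
         + (m * newton_potential u x - k * newton_potential w x) * u x * v x)
     = (LINT x|lborel. averaged_nonlinearity p (u x) (w x) * of_real (v x)))"

end

theory Submission
  imports Defs
begin

text \<open>Testing the two equations with \<open>u1\<close> and \<open>u2\<close> and adding them, the right-hand side
  becomes the average of \<open>|u1 + exp (i t) u2| ^ (p + 1)\<close>, which is at most
  \<open>u1\<^sup>2 + u2\<^sup>2 + 4 * (|u1| ^ 3 + |u2| ^ 3)\<close>.  The Newton potential \<open>\<phi>\<close> of \<open>u\<^sup>2\<close> satisfies
  \<open>- \<Delta> \<phi> = u\<^sup>2\<close>, so the integral of \<open>4 * |u| ^ 3\<close> is that of \<open>4 * \<nabla>\<phi> \<bullet> \<nabla>|u|\<close>, which
  is at most \<open>\<parallel>\<nabla>u\<parallel>\<^sup>2 + 4 * \<parallel>\<nabla>\<phi>\<parallel>\<^sup>2\<close>.  What remains of the left-hand side is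
  \<open>(\<lambda> - 1) * (\<parallel>u1\<parallel>\<^sup>2 + \<parallel>u2\<parallel>\<^sup>2)\<close> plus a quadratic form in \<open>\<nabla>\<phi>\<close> that the hypotheses on the
  \<open>\<mu>\<close> make nonnegative.  To avoid singular kernels, \<open>1 / |x|\<close> is replaced by the smooth
  \<open>1 / sqrt (|x|\<^sup>2 + e\<^sup>2)\<close> and \<open>e\<close> tends to 0.  The same inequality bounds the integral of
  \<open>w\<^sup>2 * |v|\<close> by \<open>\<parallel>\<nabla>v\<parallel>\<close> for test functions \<open>v\<close>, so that both sides of the weak equation are
  continuous in \<open>v\<close> for the \<open>H\<^sup>1\<close> norm and \<open>u\<close> itself is an admissible test function.\<close>

text \<open>The constants come from elementary inequalities. For \<open>1 < p \<le> 2\<close> one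
  has \<open>r powr (p + 1) \<le> r\<^sup>2 + r ^ 3\<close>; the mixed term of
  \<open>r\<^sup>2\<close> is a multiple of the cosine and averages to 0, and
  \<open>(a + b) ^ 3 \<le> 4 * (a ^ 3 + b ^ 3)\<close> gives the factor 4. Young's inequality
  \<open>4 * a * b \<le> a\<^sup>2 + 4 * b\<^sup>2\<close> then consumes exactly the gradient norms,
  and its second term shifts the diagonal coefficients \<open>\<mu>11\<close> and
  \<open>\<mu>22\<close> by 4. No Sobolev embedding is used. The potential term is square-integrable
  because Hardy's inequality bounds \<open>\<phi>\<close> uniformly. The quadratic growth of the
  nonlinearity is beyond L2 bounds and is controlled by the Coulomb energy of
  \<open>u\<^sup>2\<close> instead. The gradient of the true potential never appears: its squared
  norm is represented by the Coulomb double integral, which is the limit of squared L2 norms of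
  regularised fields. Cauchy-Schwarz inequalities for these fields survive the limit, and this is
  all that is needed.\<close>

lemma partial_deriv_GDERIV:
  assumes "GDERIV f x :> D"
  shows "partial_deriv i f x = D $ i" "grad f x = D"
proof -
  have "frechet_derivative f (at x) = (\<lambda>h. h \<bullet> D)"
    using assms frechet_derivative_at unfolding gderiv_def by metis
  then have *: "partial_deriv j f x = D $ j" for j
    by (simp add: partial_deriv_def inner_axis inner_commute[of "axis j 1"])
  show "partial_deriv i f x = D $ i" "grad f x = D"
    by (simp_all add: * grad_def vec_eq_iff)
qed

lemma GDERIV_grad:
  assumes "f differentiable at x"
  shows "GDERIV f x :> grad f x"
proof -
  interpret linear "frechet_derivative f (at x)"
    using assms by (rule linear_frechet_derivative)
  have "frechet_derivative f (at x) h = h \<bullet> grad f x" for h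
  proof -
    have "frechet_derivative f (at x) h = frechet_derivative f (at x) (\<Sum>i\<in>UNIV. h $ i *\<^sub>R axis i 1)"
      by (simp add: basis_expansion flip: scalar_mult_eq_scaleR)
    also have "\<dots> = (\<Sum>i\<in>UNIV. h $ i * partial_deriv i f x)"
      by (simp add: sum scale partial_deriv_def)
    finally show ?thesis
      by (simp add: inner_vec_def grad_def)
  qed
  then have "frechet_derivative f (at x) = (\<lambda>h. h \<bullet> grad f x)"
    by auto
  then show ?thesis
    using assms unfolding gderiv_def by (metis frechet_derivative_works)
qed

section \<open>Smooth functions\<close>

text \<open>Iterated derivatives never leave a class closed under single partial derivatives. Each
  closure property of smooth functions below reduces to naming such a class, with no induction over
  lists of directions.\<close>

lemma smooth_coinduct:
  assumes "f \<in> S"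
    and "\<And>f x. f \<in> S \<Longrightarrow> f differentiable at x"
    and "\<And>f i. f \<in> S \<Longrightarrow> partial_deriv i f \<in> S"
  shows "smooth f"
proof -
  have "foldr partial_deriv is f \<in> S" for "is"
    by (induction "is") (auto simp: assms)
  then show ?thesis
    unfolding smooth_def using assms(2) by blast
qed

lemma smooth_partial_deriv: "smooth f \<Longrightarrow> smooth (partial_deriv i f)"
  unfolding smooth_def
proof (intro allI)
  fix "is" :: "3 list" and x assume "\<forall>is x. foldr partial_deriv is f differentiable at x"
  \<comment> \<open>\<open>foldr\<close> applies the last entry of the list first, so the derivative
    taken before those in \<open>is\<close> goes to the end.\<close>
  then have "foldr partial_deriv (is @ [i]) f differentiable at x"
    by blast
  then show "foldr partial_deriv is (partial_deriv i f) differentiable at x"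
    by simp
qed

lemma smooth_differentiable: "smooth f \<Longrightarrow> f differentiable at x"
  unfolding smooth_def by (metis foldr.simps(1) id_apply)

lemma smooth_GDERIV: "smooth f \<Longrightarrow> GDERIV f x :> grad f x"
  by (simp add: GDERIV_grad smooth_differentiable)

lemma smooth_continuous_on: "smooth f \<Longrightarrow> continuous_on A f"
  by (meson continuous_at_imp_continuous_on differentiable_imp_continuous_within smooth_differentiable)

lemma smooth_grad_continuous_on: "smooth f \<Longrightarrow> continuous_on A (grad f)"
  unfolding grad_def by (intro continuous_on_vec_lambda smooth_continuous_on smooth_partial_deriv)

lemma partial_deriv_add:
  assumes "f differentiable at x" "g differentiable at x"
  shows "partial_deriv i (\<lambda>x. f x + g x) x = partial_deriv i f x + partial_deriv i g x"
  using partial_deriv_GDERIV(1)[OF GDERIV_add[OF assms[THEN GDERIV_grad]], of i]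
  by (simp add: grad_def)

lemma grad_diff:
  assumes "f differentiable at x" "g differentiable at x"
  shows "grad (\<lambda>x. f x - g x) x = grad f x - grad g x"
  by (rule partial_deriv_GDERIV(2)[OF GDERIV_diff[OF assms[THEN GDERIV_grad]]])

lemma partial_deriv_mult:
  assumes "f differentiable at x" "g differentiable at x"
  shows "partial_deriv i (\<lambda>x. f x * g x) x = f x * partial_deriv i g x + partial_deriv i f x * g x"
  using partial_deriv_GDERIV(1)[OF GDERIV_mult[OF assms[THEN GDERIV_grad]], of i]
  by (simp add: grad_def mult.commute)

lemma grad_mult:
  assumes "f differentiable at x" "g differentiable at x"
  shows "grad (\<lambda>x. f x * g x) x = f x *\<^sub>R grad g x + g x *\<^sub>R grad f x"
  by (rule partial_deriv_GDERIV(2)[OF GDERIV_mult[OF assms[THEN GDERIV_grad]]])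

lemma smooth_add:
  assumes "smooth f" "smooth g"
  shows "smooth (\<lambda>x. f x + g x)"
proof (rule smooth_coinduct[where S = "{\<lambda>x. f x + g x | f g. smooth f \<and> smooth g}"])
  fix h i assume "h \<in> {\<lambda>x. f x + g x | f g. smooth f \<and> smooth g}"
  then obtain f g where h: "h = (\<lambda>x. f x + g x)" "smooth f" "smooth g" by blast
  then have "partial_deriv i h = (\<lambda>x. partial_deriv i f x + partial_deriv i g x)"
    by (auto simp: partial_deriv_add smooth_differentiable)
  then show "partial_deriv i h \<in> {\<lambda>x. f x + g x | f g. smooth f \<and> smooth g}"
    using h smooth_partial_deriv by blast
qed (use assms smooth_differentiable in \<open>auto intro!: differentiable_add\<close>)

lemma smooth_const: "smooth (\<lambda>x. c)"
proof (rule smooth_coinduct[where S = "{\<lambda>x. c | c. True}"])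
  fix h i assume "h \<in> {\<lambda>x::R3. c | c::real. True}"
  then have "partial_deriv i h = (\<lambda>x. 0)"
    by (auto simp: partial_deriv_def)
  then show "partial_deriv i h \<in> {\<lambda>x::R3. c | c. True}"
    by auto
qed auto

text \<open>The Leibniz rule turns one product into two, so single products are not closed under
  differentiation; their finite sums are, as \<open>smooth_coinduct\<close> requires.\<close>

inductive_set product_sums :: "(R3 \<Rightarrow> real) set" where
  mult: "smooth f \<Longrightarrow> smooth g \<Longrightarrow> (\<lambda>x. f x * g x) \<in> product_sums"
| add: "h \<in> product_sums \<Longrightarrow> k \<in> product_sums \<Longrightarrow> (\<lambda>x. h x + k x) \<in> product_sums"

lemma product_sums_differentiable: "f \<in> product_sums \<Longrightarrow> f differentiable at x"
  by (induction rule: product_sums.induct)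
    (auto intro: differentiable_add differentiable_mult smooth_differentiable)

lemma smooth_mult:
  assumes "smooth f" "smooth g"
  shows "smooth (\<lambda>x. f x * g x)"
proof (rule smooth_coinduct[where S = product_sums])
  fix h i assume "h \<in> product_sums"
  then show "partial_deriv i h \<in> product_sums"
  proof induction
    case (mult f g)
    then have "partial_deriv i (\<lambda>x. f x * g x) =
        (\<lambda>x. f x * partial_deriv i g x + partial_deriv i f x * g x)"
      by (auto simp: partial_deriv_mult smooth_differentiable)
    with mult show ?case
      by (auto intro!: product_sums.intros smooth_partial_deriv)
  next
    case (add h k)
    then have "partial_deriv i (\<lambda>x. h x + k x) = (\<lambda>x. partial_deriv i h x + partial_deriv i k x)"
      by (auto simp: partial_deriv_add product_sums_differentiable)
    with add show ?case
      by (auto intro!: product_sums.intros)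
  qed
qed (use assms in \<open>auto intro: product_sums.intros product_sums_differentiable\<close>)

lemma smooth_diff:
  assumes "smooth f" "smooth g"
  shows "smooth (\<lambda>x. f x - g x)"
  using smooth_add[OF assms(1) smooth_mult[OF smooth_const assms(2), of "-1"]] by simp

lemma grad_affine:
  assumes "f differentiable at (a *\<^sub>R x + b)"
  shows "(\<lambda>x. f (a *\<^sub>R x + b)) differentiable at x"
    and "grad (\<lambda>x. f (a *\<^sub>R x + b)) x = a *\<^sub>R grad f (a *\<^sub>R x + b)"
proof -
  have "((\<lambda>x. f (a *\<^sub>R x + b)) has_derivative (\<lambda>h. (a *\<^sub>R h) \<bullet> grad f (a *\<^sub>R x + b))) (at x)"
    by (rule has_derivative_compose[where f = "\<lambda>x. a *\<^sub>R x + b" and f' = "\<lambda>h. a *\<^sub>R h"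
          and g' = "\<lambda>h. h \<bullet> grad f (a *\<^sub>R x + b)"])
      (use GDERIV_grad[OF assms] in \<open>auto intro!: derivative_eq_intros simp: gderiv_def\<close>)
  then have *: "GDERIV (\<lambda>x. f (a *\<^sub>R x + b)) x :> a *\<^sub>R grad f (a *\<^sub>R x + b)"
    by (simp add: gderiv_def)
  show "grad (\<lambda>x. f (a *\<^sub>R x + b)) x = a *\<^sub>R grad f (a *\<^sub>R x + b)"
    by (rule partial_deriv_GDERIV(2)[OF *])
  show "(\<lambda>x. f (a *\<^sub>R x + b)) differentiable at x"
    using * by (auto simp: gderiv_def differentiable_def)
qed

lemma smooth_affine:
  assumes "smooth f"
  shows "smooth (\<lambda>x. f (a *\<^sub>R x + b))"
proof -
  \<comment> \<open>The factor \<open>c\<close> absorbs the powers of \<open>a\<close> that the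
    chain rule produces.\<close>
  let ?S = "{\<lambda>x. c * f (a *\<^sub>R x + b) | c f. smooth f}"
  show ?thesis
  proof (rule smooth_coinduct[where S = ?S])
    show "(\<lambda>x. f (a *\<^sub>R x + b)) \<in> ?S"
      using assms by (intro CollectI exI[of _ 1] exI[of _ f]) simp
  next
    fix h and x :: R3 assume "h \<in> ?S"
    then obtain c f where h: "h = (\<lambda>x. c * f (a *\<^sub>R x + b))" "smooth f" by blast
    then show "h differentiable at x"
      by (simp add: differentiable_mult grad_affine(1) smooth_differentiable)
  next
    fix h i assume "h \<in> ?S"
    then obtain c f where h: "h = (\<lambda>x. c * f (a *\<^sub>R x + b))" "smooth f" by blast
    have "partial_deriv i h x = c * a * partial_deriv i f (a *\<^sub>R x + b)" for x
    proof -
      have "partial_deriv i (\<lambda>x. f (a *\<^sub>R x + b)) x = a * partial_deriv i f (a *\<^sub>R x + b)"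
        using grad_affine(2)[of f a x b] h(2)
        by (simp add: smooth_differentiable grad_def vec_eq_iff)
      moreover have "partial_deriv i h x = c * partial_deriv i (\<lambda>x. f (a *\<^sub>R x + b)) x"
        unfolding h using h(2)
        by (subst partial_deriv_mult)
           (auto intro!: grad_affine(1) intro: smooth_differentiable simp: partial_deriv_def)
      ultimately show ?thesis by simp
    qed
    then have "partial_deriv i h = (\<lambda>x. (c * a) * partial_deriv i f (a *\<^sub>R x + b))"
      by auto
    then show "partial_deriv i h \<in> ?S"
      using smooth_partial_deriv[OF h(2), of i] by blast
  qed
qed

lemma smooth_nth: "smooth (\<lambda>x. x $ i)"
proof (rule smooth_coinduct[where S = "insert (\<lambda>x. x $ i) {\<lambda>x. c | c. True}"])
  have D: "GDERIV (\<lambda>x::R3. x $ i) x :> axis i 1" for x :: R3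
    by (auto simp: gderiv_def inner_axis intro!: bounded_linear_imp_has_derivative bounded_linear_vec_nth)
  fix h and x :: R3 assume h: "h \<in> insert (\<lambda>x::R3. x $ i) {\<lambda>x. c | c. True}"
  then show "h differentiable at x"
    using D[of x] by (auto simp: gderiv_def intro: differentiableI)
  fix j
  from D have "partial_deriv j (\<lambda>x::R3. x $ i) = (\<lambda>x. axis i 1 $ j)"
    by (auto simp: partial_deriv_GDERIV)
  moreover have "partial_deriv j (\<lambda>x::R3. c) = (\<lambda>x. 0)" for c
    by (auto simp: partial_deriv_def)
  ultimately show "partial_deriv j h \<in> insert (\<lambda>x::R3. x $ i) {\<lambda>x. c | c. True}"
    using h by auto
qed auto

section \<open>A smooth bump function\<close>

definition flat_exp :: "nat \<Rightarrow> real \<Rightarrow> real" where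
  "flat_exp k t = (if t > 0 then exp (- (1 / t)) / t ^ k else 0)"

text \<open>Differentiating the exponential raises the exponent in the denominator by 2,
  differentiating the power raises it by 1. Hence the whole family over \<open>k\<close> is needed
  to obtain a class closed under differentiation.\<close>

lemma flat_exp_deriv:
  "(flat_exp k has_real_derivative flat_exp (k + 2) t - k * flat_exp (k + 1) t) (at t)"
proof -
  consider "t > 0" | "t < 0" | "t = 0" by linarith
  then show ?thesis
  proof cases
    case 1
    have "((\<lambda>t. exp (- (1 / t)) / t ^ k) has_real_derivative
        flat_exp (k + 2) t - k * flat_exp (k + 1) t) (at t)"
      using 1 unfolding flat_exp_def
      by (auto intro!: derivative_eq_intros simp: power2_eq_square)
         (cases k; auto simp: field_simps)
    then show ?thesis
      by (rule DERIV_cong_ev[THEN iffD1, rotated 3])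
        (use 1 eventually_nhds_in_open[of "{0<..}" t] in \<open>auto elim!: eventually_mono simp: flat_exp_def\<close>)
  next
    case 2
    have "((\<lambda>t. 0) has_real_derivative flat_exp (k + 2) t - k * flat_exp (k + 1) t) (at t)"
      using 2 by (auto simp: flat_exp_def)
    then show ?thesis
      by (rule DERIV_cong_ev[THEN iffD1, rotated 3])
        (use 2 eventually_nhds_in_open[of "{..<0}" t] in \<open>auto elim!: eventually_mono simp: flat_exp_def\<close>)
  next
    case 3
    \<comment> \<open>The difference quotient from the right is
      \<open>exp (- (1 / s)) / s ^ (k + 1)\<close>; in the variable \<open>inverse s\<close> it is a
      power divided by an exponential.\<close>
    have "((\<lambda>s. (inverse s) ^ (k + 1) / exp (inverse s)) \<longlongrightarrow> 0) (at_right (0::real))"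
      by (rule filterlim_compose[OF tendsto_power_div_exp_0 filterlim_inverse_at_top_right])
    then have r: "((\<lambda>s. flat_exp k s / s) \<longlongrightarrow> 0) (at_right 0)"
      by (rule Lim_transform_eventually)
        (auto simp: eventually_at_right_field flat_exp_def field_simps exp_minus intro!: exI[of _ 1])
    have "((\<lambda>s. flat_exp k s / s) \<longlongrightarrow> 0) (at_left 0)"
      by (rule tendsto_eventually) (auto simp: eventually_at_left_field flat_exp_def intro!: exI[of _ "-1"])
    with r have "((\<lambda>s. flat_exp k s / s) \<longlongrightarrow> 0) (at 0)"
      by (simp add: filterlim_split_at)
    then show ?thesis
      using 3 by (simp add: has_field_derivative_iff flat_exp_def)
  qed
qed

text \<open>A derivative either hits the coefficient \<open>P\<close>, or multiplies it by a
  coordinate and raises \<open>k\<close> by 1 or 2. Arbitrary smooth coefficients, all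
  \<open>k\<close> and sums make the class closed.\<close>

inductive_set bump_sums :: "(R3 \<Rightarrow> real) set" where
  base: "smooth P \<Longrightarrow> (\<lambda>x. P x * flat_exp k (1 - x \<bullet> x)) \<in> bump_sums"
| add: "f \<in> bump_sums \<Longrightarrow> g \<in> bump_sums \<Longrightarrow> (\<lambda>x. f x + g x) \<in> bump_sums"

lemma flat_exp_GDERIV:
  "GDERIV (\<lambda>x::R3. flat_exp k (1 - x \<bullet> x)) x :>
     (flat_exp (k + 2) (1 - x \<bullet> x) - k * flat_exp (k + 1) (1 - x \<bullet> x)) *\<^sub>R (- 2 *\<^sub>R x)"
proof (rule GDERIV_DERIV_compose[OF _ flat_exp_deriv])
  show "GDERIV (\<lambda>x. 1 - x \<bullet> x) x :> - 2 *\<^sub>R x"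
    unfolding gderiv_def by (auto intro!: derivative_eq_intros simp: inner_commute)
qed

lemma bump_sums_differentiable: "f \<in> bump_sums \<Longrightarrow> f differentiable at x"
proof (induction rule: bump_sums.induct)
  case (base P k)
  moreover have "(\<lambda>x::R3. flat_exp k (1 - x \<bullet> x)) differentiable at x"
    using flat_exp_GDERIV[of k x] unfolding gderiv_def by (rule differentiableI)
  ultimately show ?case
    by (auto intro!: differentiable_mult intro: smooth_differentiable)
qed (auto intro: differentiable_add)

lemma bump_sums_smooth:
  assumes "f \<in> bump_sums" shows "smooth f"
proof (rule smooth_coinduct[OF assms])
  fix h i assume "h \<in> bump_sums"
  then show "partial_deriv i h \<in> bump_sums"
  proof induction
    case (base P k)
    have "partial_deriv i (\<lambda>x. P x * flat_exp k (1 - x \<bullet> x)) =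
      (\<lambda>x. (partial_deriv i P x * flat_exp k (1 - x \<bullet> x)
        + ((-2) * (P x * x $ i)) * flat_exp (k + 2) (1 - x \<bullet> x))
        + ((2 * k) * (P x * x $ i)) * flat_exp (k + 1) (1 - x \<bullet> x))" (is "_ = ?g")
    proof
      fix x
      show "partial_deriv i (\<lambda>x. P x * flat_exp k (1 - x \<bullet> x)) x = ?g x"
        using partial_deriv_GDERIV(1)[OF GDERIV_mult[OF smooth_GDERIV[OF base] flat_exp_GDERIV], of i k x]
        by (simp add: grad_def algebra_simps)
    qed
    moreover have "?g \<in> bump_sums"
      using base by (intro bump_sums.intros smooth_mult smooth_partial_deriv smooth_nth smooth_const)
    ultimately show ?case by simp
  next
    case (add h k)
    then have "partial_deriv i (\<lambda>x. h x + k x) = (\<lambda>x. partial_deriv i h x + partial_deriv i k x)"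
      by (auto simp: partial_deriv_add bump_sums_differentiable)
    with add show ?case
      by (auto intro!: bump_sums.intros)
  qed
qed (rule bump_sums_differentiable)

text \<open>The standard profile \<open>exp (- 1 / (1 - norm x ^ 2))\<close> on the unit ball,
  extended by 0.\<close>

definition bump :: "R3 \<Rightarrow> real" where
  "bump x = flat_exp 0 (1 - x \<bullet> x)"

lemma smooth_bump: "smooth bump"
  using bump_sums_smooth[OF bump_sums.base[OF smooth_const, of 1 0]]
  by (simp add: bump_def[abs_def])

lemma bump_nonneg: "0 \<le> bump x"
  by (simp add: bump_def flat_exp_def)

lemma bump_pos: "norm x < 1 \<Longrightarrow> 0 < bump x"
  by (simp add: bump_def flat_exp_def dot_square_norm power_less_one_iff abs_square_less_1)

lemma bump_outside: "1 \<le> norm x \<Longrightarrow> bump x = 0"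
  by (simp add: bump_def flat_exp_def dot_square_norm not_less)

section \<open>Closure properties of compactly supported test functions\<close>

lemma test_functionI:
  assumes "smooth v" "\<And>x. norm x > r \<Longrightarrow> v x = 0"
  shows "v \<in> test_functions"
proof -
  have "{x. v x \<noteq> 0} \<subseteq> cball 0 r"
    using assms(2) by (auto simp: not_less[symmetric])
  then have "closure {x. v x \<noteq> 0} \<subseteq> cball 0 r"
    by (simp add: closure_minimal)
  then have "compact (closure {x. v x \<noteq> 0})"
    by (meson bounded_cball bounded_subset closed_closure compact_eq_bounded_closed)
  with assms show ?thesis
    by (simp add: test_functions_def)
qed

lemma test_function_smooth: "v \<in> test_functions \<Longrightarrow> smooth v"
  by (simp add: test_functions_def)

lemma test_function_supp:
  assumes "v \<in> test_functions"
  obtains r where "r > 0" "\<And>x. norm x > r \<Longrightarrow> v x = 0" "\<And>x. norm x > r \<Longrightarrow> grad v x = 0"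
proof -
  have "bounded (closure {x. v x \<noteq> 0})"
    using assms by (auto simp: test_functions_def compact_imp_bounded)
  then obtain r where r: "r > 0" "\<And>x. x \<in> closure {x. v x \<noteq> 0} \<Longrightarrow> norm x \<le> r"
    by (metis bounded_pos)
  then have out: "v x = 0" if "norm x > r" for x
    using that closure_subset[of "{x. v x \<noteq> 0}"] by (metis (mono_tags) mem_Collect_eq not_less subset_iff)
  have "grad v x = 0" if "norm x > r" for x
  proof -
    \<comment> \<open>The complement of the ball is open, so \<open>v\<close> coincides with 0 near
      \<open>x\<close>, and uniqueness of derivatives makes the gradient vanish.\<close>
    have "open {x::R3. norm x > r}"
      by (intro open_Collect_less continuous_intros)
    then have "((\<lambda>x. 0) has_derivative (\<lambda>h. h \<bullet> grad v x)) (at x)"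
      using has_derivative_transform_within_open[OF
          smooth_GDERIV[OF test_function_smooth[OF assms], of x, unfolded gderiv_def]] that out
      by (metis (mono_tags, lifting) mem_Collect_eq)
    then have "GDERIV (\<lambda>x. 0) x :> grad v x"
      by (simp add: gderiv_def)
    then have "grad v x = grad (\<lambda>x. 0) x"
      using partial_deriv_GDERIV(2) by metis
    also have "\<dots> = 0"
      by (simp add: grad_def partial_deriv_def vec_eq_iff)
    finally show ?thesis .
  qed
  with r out show ?thesis
    by (intro that)
qed

lemma test_function_partial_deriv:
  assumes "v \<in> test_functions" shows "partial_deriv i v \<in> test_functions"
proof -
  obtain r where r: "r > 0" "\<And>x. norm x > r \<Longrightarrow> v x = 0" "\<And>x. norm x > r \<Longrightarrow> grad v x = 0"
    by (rule test_function_supp[OF assms]) blast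
  from r(3) show ?thesis
    using assms
    by (intro test_functionI[of _ r] smooth_partial_deriv[OF test_function_smooth[OF assms]])
      (auto simp: grad_def vec_eq_iff)
qed

lemma test_function_diff:
  assumes "v \<in> test_functions" "w \<in> test_functions"
  shows "(\<lambda>x. v x - w x) \<in> test_functions"
proof -
  obtain r where r: "r > 0" "\<And>x. norm x > r \<Longrightarrow> v x = 0" "\<And>x. norm x > r \<Longrightarrow> grad v x = 0"
    by (rule test_function_supp[OF assms(1)]) blast
  obtain s where s: "s > 0" "\<And>x. norm x > s \<Longrightarrow> w x = 0" "\<And>x. norm x > s \<Longrightarrow> grad w x = 0"
    by (rule test_function_supp[OF assms(2)]) blast
  from r(2) s(2) show ?thesis
    using assms by (intro test_functionI[of _
        "max r s"] smooth_diff[OF test_function_smooth[OF assms(1)] test_function_smooth[OF assms(2)]])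
      auto
qed

lemma test_function_mult:
  assumes "v \<in> test_functions" "smooth w"
  shows "(\<lambda>x. v x * w x) \<in> test_functions"
proof -
  obtain r where r: "r > 0" "\<And>x. norm x > r \<Longrightarrow> v x = 0" "\<And>x. norm x > r \<Longrightarrow> grad v x = 0"
    by (rule test_function_supp[OF assms(1)]) blast
  from r(2) show ?thesis
    using assms by (intro test_functionI[of _ "r"] smooth_mult[OF test_function_smooth[OF assms(1)] assms(2)])
      auto
qed

lemma test_function_affine:
  assumes "v \<in> test_functions" "a \<noteq> 0"
  shows "(\<lambda>x. v (a *\<^sub>R x + b)) \<in> test_functions"
proof -
  obtain r where r: "r > 0" "\<And>x. norm x > r \<Longrightarrow> v x = 0" "\<And>x. norm x > r \<Longrightarrow> grad v x = 0"
    by (rule test_function_supp[OF assms(1)]) blast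
  show ?thesis
  proof (intro test_functionI[of _ "(r + norm b) / \<bar>a\<bar>"] smooth_affine[OF test_function_smooth[OF assms(1)]] r(2))
    fix x :: R3 assume "(r + norm b) / \<bar>a\<bar> < norm x"
    then have "r + norm b < norm (a *\<^sub>R x)"
      using assms(2) by (simp add: field_simps)
    also have "\<dots> \<le> norm (a *\<^sub>R x + b) + norm b"
      by (metis add_diff_cancel norm_triangle_ineq4)
    finally show "r < norm (a *\<^sub>R x + b)" by simp
  qed
qed

lemma bump_test: "bump \<in> test_functions"
  by (rule test_functionI[OF smooth_bump, of 1]) (auto simp: bump_outside)

section \<open>Affine changes of variables\<close>

lemma nn_integral_affine:
  fixes t :: "'a::euclidean_space"
  assumes [measurable]: "f \<in> borel_measurable borel" and c: "c \<noteq> 0"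
  shows "(\<integral>\<^sup>+x. f x \<partial>lborel) = ennreal (\<bar>c\<bar> ^ DIM('a)) * (\<integral>\<^sup>+x. f (t + c *\<^sub>R x) \<partial>lborel)"
  by (subst lborel_affine[OF c, of t])
    (simp add: nn_integral_density nn_integral_distr nn_integral_cmult ennreal_power)

lemma integrable_affine:
  fixes f :: "'a::euclidean_space \<Rightarrow> 'b :: {banach, second_countable_topology}"
  assumes f: "integrable lborel f" and c: "c \<noteq> 0"
  shows "integrable lborel (\<lambda>x. f (t + c *\<^sub>R x))"
proof -
  have [measurable]: "f \<in> borel_measurable borel"
    using f by auto
  have "(\<integral>\<^sup>+x. norm (f x) \<partial>lborel) < \<infinity>"
    using f by (auto simp: integrable_iff_bounded)
  then show ?thesis
    using c by (subst (asm) nn_integral_affine[OF _ c, where t = t])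
      (auto simp: integrable_iff_bounded ennreal_mult_less_top)
qed

lemma integrable_affine_iff:
  fixes f :: "'a::euclidean_space \<Rightarrow> 'b :: {banach, second_countable_topology}"
  assumes c: "c \<noteq> 0"
  shows "integrable lborel (\<lambda>x. f (t + c *\<^sub>R x)) \<longleftrightarrow> integrable lborel f"
  using integrable_affine[of f c t] integrable_affine[of "\<lambda>x. f (t + c *\<^sub>R x)" "1 / c" "- (1 / c) *\<^sub>R t"] c
  by (auto simp: scaleR_add_right scaleR_diff_right)

lemma integral_affine:
  fixes f :: "'a::euclidean_space \<Rightarrow> 'b :: {banach, second_countable_topology}"
  assumes c: "c \<noteq> 0"
  shows "integral\<^sup>L lborel f = \<bar>c\<bar> ^ DIM('a) *\<^sub>R (\<integral>x. f (t + c *\<^sub>R x) \<partial>lborel)"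
proof cases
  assume f[measurable]: "integrable lborel f" then show ?thesis
    using c f f[THEN borel_measurable_integrable] f[THEN integrable_affine, of c t]
    by (subst lborel_affine[OF c, of t])
       (simp add: integral_density integral_distr)
next
  \<comment> \<open>Both integrals take the default value 0 here, since integrability is invariant
    under the map. This keeps later translations and scalings free of side conditions.\<close>
  assume "\<not> integrable lborel f" with c show ?thesis
    by (simp add: integrable_affine_iff not_integrable_integral_eq)
qed

lemma integral_translate:
  fixes f :: "'a::euclidean_space \<Rightarrow> 'b :: {banach, second_countable_topology}"
  shows "(\<integral>x. f (x + c) \<partial>lborel) = integral\<^sup>L lborel f"
    and "(\<integral>x. f (x - c) \<partial>lborel) = integral\<^sup>L lborel f"
    and "(\<integral>x. f (c - x) \<partial>lborel) = integral\<^sup>L lborel f"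
  using integral_affine[of 1 f c] integral_affine[of 1 f "-c"] integral_affine[of "-1" f c]
  by (simp_all add: add.commute)

lemma integrable_translate:
  fixes f :: "'a::euclidean_space \<Rightarrow> 'b :: {banach, second_countable_topology}"
  shows "integrable lborel (\<lambda>x. f (x + c)) \<longleftrightarrow> integrable lborel f"
    and "integrable lborel (\<lambda>x. f (x - c)) \<longleftrightarrow> integrable lborel f"
    and "integrable lborel (\<lambda>x. f (c - x)) \<longleftrightarrow> integrable lborel f"
  using integrable_affine_iff[of 1 f c] integrable_affine_iff[of 1 f "-c"] integrable_affine_iff[of "-1" f c]
  by (simp_all add: add.commute)

section \<open>Square-integrable functions\<close>

text \<open>The Bochner integral is 0 for a function that is not square-integrable, so this behaves
  like a norm only under \<open>square_integrable\<close>; the inequalities below carry that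
  hypothesis.\<close>

definition L2norm :: "(R3 \<Rightarrow> 'b::euclidean_space) \<Rightarrow> real" where
  "L2norm f = sqrt (LINT x|lborel. (norm (f x))\<^sup>2)"

lemma L2norm_nonneg: "0 \<le> L2norm f"
  by (simp add: L2norm_def)

lemma L2norm_square: "(L2norm f)\<^sup>2 = (LINT x|lborel. (norm (f x))\<^sup>2)"
  by (simp add: L2norm_def)

lemma square_integrable_measurable[measurable_dest]:
  "square_integrable f \<Longrightarrow> f \<in> borel_measurable borel"
  by (simp add: square_integrable_def)

lemma square_integrableD: "square_integrable f \<Longrightarrow> integrable lborel (\<lambda>x. (norm (f x))\<^sup>2)"
  by (simp add: square_integrable_def)

lemma square_integrable_bound:
  assumes "square_integrable f" "g \<in> borel_measurable borel" "\<And>x. norm (g x) \<le> norm (f x)"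
  shows "square_integrable g"
  unfolding square_integrable_def
proof
  show "integrable lborel (\<lambda>x. (norm (g x))\<^sup>2)"
    using square_integrableD[OF assms(1)]
    by (rule Bochner_Integration.integrable_bound) (use assms(2,3) in \<open>auto intro!: power_mono\<close>)
qed (use assms in auto)

lemma borel_measurable_vec_nth[measurable (raw)]:
  fixes f :: "'a \<Rightarrow> real ^ 'n"
  assumes [measurable]: "f \<in> borel_measurable M"
  shows "(\<lambda>x. f x $ i) \<in> borel_measurable M"
  unfolding cart_eq_inner_axis by measurable

lemma square_integrable_nth:
  fixes f :: "R3 \<Rightarrow> R3"
  shows "square_integrable f \<Longrightarrow> square_integrable (\<lambda>x. f x $ i)"
  by (rule square_integrable_bound)
    (auto simp: component_le_norm_cart)

lemma square_integrable_mult_integrable: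
  fixes f :: "R3 \<Rightarrow> 'b::euclidean_space" and g :: "R3 \<Rightarrow> 'c::euclidean_space"
  assumes "square_integrable f" "square_integrable g"
  shows "integrable lborel (\<lambda>x. norm (f x) * norm (g x))"
proof (rule Bochner_Integration.integrable_bound[OF Bochner_Integration.integrable_add[OF assms[THEN square_integrableD]]])
  have "a * b \<le> a\<^sup>2 + b\<^sup>2" if "0 \<le> a" "0 \<le> b" for a b :: real
    using sum_squares_bound[of a b] mult_nonneg_nonneg[OF that] by linarith
  then show "AE x in lborel. norm (norm (f x) * norm (g x)) \<le> norm ((norm (f x))\<^sup>2 + (norm (g x))\<^sup>2)"
    by auto
qed (use assms in measurable)

lemma square_integrable_inner_integrable:
  assumes "square_integrable f" "square_integrable g"
  shows "integrable lborel (\<lambda>x. f x \<bullet> g x)"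
  by (rule Bochner_Integration.integrable_bound[OF square_integrable_mult_integrable[OF assms]])
    (use assms in \<open>auto simp: Cauchy_Schwarz_ineq2\<close>)

lemma square_integrable_add:
  fixes f g :: "R3 \<Rightarrow> 'b::euclidean_space"
  assumes "square_integrable f" "square_integrable g"
  shows "square_integrable (\<lambda>x. f x + g x)"
proof -
  have "integrable lborel (\<lambda>x. (norm (f x))\<^sup>2 + (norm (g x))\<^sup>2 + 2 * (f x \<bullet> g x))"
    using assms by (intro Bochner_Integration.integrable_add integrable_mult_right
        square_integrableD square_integrable_inner_integrable)
  moreover have "(norm (f x))\<^sup>2 + (norm (g x))\<^sup>2 + 2 * (f x \<bullet> g x) = (norm (f x + g x))\<^sup>2" for x
    by (simp add: power2_norm_eq_inner inner_add inner_commute)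
  ultimately show ?thesis
    using assms[THEN square_integrable_measurable] by (simp add: square_integrable_def)
qed

lemma square_integrable_cmult:
  "square_integrable f \<Longrightarrow> square_integrable (\<lambda>x. c *\<^sub>R f x)"
  by (auto simp: square_integrable_def power_mult_distrib)

lemma square_integrable_diff:
  fixes f g :: "R3 \<Rightarrow> 'b::euclidean_space"
  assumes "square_integrable f" "square_integrable g"
  shows "square_integrable (\<lambda>x. f x - g x)"
  using square_integrable_add[OF assms(1) square_integrable_cmult[OF assms(2), of "-1"]] by simp

lemma L2norm_cmult: "L2norm (\<lambda>x. c *\<^sub>R f x) = \<bar>c\<bar> * L2norm f"
  by (simp add: L2norm_def power_mult_distrib real_sqrt_mult)

lemma L2norm_minus_commute: "L2norm (\<lambda>x. f x - g x) = L2norm (\<lambda>x. g x - f x)"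
  by (simp add: L2norm_def norm_minus_commute)

lemma L2norm_mono:
  assumes "square_integrable g" "f \<in> borel_measurable borel" "AE x in lborel. norm (f x) \<le> norm (g x)"
  shows "L2norm f \<le> L2norm g"
  unfolding L2norm_def
proof (intro real_sqrt_le_mono integral_mono_AE)
  show *: "AE x in lborel. (norm (f x))\<^sup>2 \<le> (norm (g x))\<^sup>2"
    using assms(3) by (auto elim!: eventually_mono intro: power_mono)
  from * show "integrable lborel (\<lambda>x. (norm (f x))\<^sup>2)"
    by (intro Bochner_Integration.integrable_bound[OF square_integrableD[OF assms(1)]]) (use assms in auto)
qed (rule square_integrableD[OF assms(1)])

text \<open>The discriminant argument: the integral of
  \<open>(t * norm (f x) - norm (g x))\<^sup>2\<close> is a nonnegative quadratic polynomial in
  \<open>t\<close>.\<close>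

lemma Cauchy_Schwarz_L2norm:
  fixes f :: "R3 \<Rightarrow> 'b::euclidean_space" and g :: "R3 \<Rightarrow> 'c::euclidean_space"
  assumes f: "square_integrable f" and g: "square_integrable g"
  shows "(LINT x|lborel. norm (f x) * norm (g x)) \<le> L2norm f * L2norm g"
proof -
  define c where "c = (LINT x|lborel. norm (f x) * norm (g x))"
  have c: "c \<ge> 0" by (simp add: c_def)
  have *: "0 \<le> t\<^sup>2 * (L2norm f)\<^sup>2 - 2 * t * c + (L2norm g)\<^sup>2" for t
  proof -
    have "0 \<le> (LINT x|lborel. (t * norm (f x) - norm (g x))\<^sup>2)"
      by simp
    also have "\<dots> = (LINT x|lborel. t\<^sup>2 * (norm (f x))\<^sup>2 - 2 * t * (norm (f x) * norm (g x)) + (norm (g x))\<^sup>2)"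
      by (simp add: power2_eq_square algebra_simps)
    also have "\<dots> = t\<^sup>2 * (L2norm f)\<^sup>2 - 2 * t * c + (L2norm g)\<^sup>2"
      unfolding L2norm_square c_def using f g
      by (simp add: square_integrableD square_integrable_mult_integrable)
    finally show ?thesis .
  qed
  show ?thesis
  proof (cases "L2norm f = 0")
    case True
    have "c = 0"
    proof (rule ccontr)
      assume "c \<noteq> 0"
      then show False
        \<comment> \<open>Without its leading term the polynomial is affine in \<open>t\<close> and
          takes the value \<open>- (L2norm g)\<^sup>2 - 2\<close> at this point.\<close>
        using *[of "((L2norm g)\<^sup>2 + 1) / c"] True zero_le_power2[of "L2norm g"]
        by (simp add: algebra_simps add_divide_distrib)
    qed
    then show ?thesis
      using True by (simp add: c_def)
  next
    case False
    then have "c\<^sup>2 \<le> (L2norm f)\<^sup>2 * (L2norm g)\<^sup>2"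
      \<comment> \<open>The minimiser of the quadratic polynomial.\<close>
      using *[of "c / (L2norm f)\<^sup>2"]
      by (auto simp: field_simps power2_eq_square zero_le_divide_iff mult_le_0_iff dest: antisym)
    then have "c \<le> L2norm f * L2norm g"
      by (metis L2norm_nonneg mult_nonneg_nonneg power2_le_imp_le power_mult_distrib)
    then show ?thesis by (simp add: c_def)
  qed
qed

lemma Cauchy_Schwarz_L2norm_inner:
  assumes f: "square_integrable f" and g: "square_integrable g"
  shows "\<bar>LINT x|lborel. f x \<bullet> g x\<bar> \<le> L2norm f * L2norm g"
proof -
  have "\<bar>LINT x|lborel. f x \<bullet> g x\<bar> \<le> (LINT x|lborel. \<bar>f x \<bullet> g x\<bar>)"
    by (rule integral_abs_bound)
  also have "\<dots> \<le> (LINT x|lborel. norm (f x) * norm (g x))"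
    using assms by (intro integral_mono integrable_abs square_integrable_inner_integrable
        square_integrable_mult_integrable Cauchy_Schwarz_ineq2)
  also note Cauchy_Schwarz_L2norm[OF assms]
  finally show ?thesis .
qed

lemma L2norm_triangle:
  fixes f g :: "R3 \<Rightarrow> 'b::euclidean_space"
  assumes f: "square_integrable f" and g: "square_integrable g"
  shows "L2norm (\<lambda>x. f x + g x) \<le> L2norm f + L2norm g"
proof (rule power2_le_imp_le)
  have "(L2norm (\<lambda>x. f x + g x))\<^sup>2 = (LINT x|lborel. (norm (f x))\<^sup>2 + 2 * (f x \<bullet> g x) + (norm (g x))\<^sup>2)"
    unfolding L2norm_square
    by (rule Bochner_Integration.integral_cong) (auto simp: power2_norm_eq_inner inner_add inner_commute)
  also have "\<dots> = (L2norm f)\<^sup>2 + 2 * (LINT x|lborel. f x \<bullet> g x) + (L2norm g)\<^sup>2"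
    unfolding L2norm_square using f g
    by (simp add: square_integrableD square_integrable_inner_integrable)
  also have "\<dots> \<le> (L2norm f + L2norm g)\<^sup>2"
    using Cauchy_Schwarz_L2norm_inner[OF assms] by (simp add: power2_sum)
  finally show "(L2norm (\<lambda>x. f x + g x))\<^sup>2 \<le> (L2norm f + L2norm g)\<^sup>2" .
qed (simp add: L2norm_nonneg)

lemma L2norm_triangle_diff:
  fixes f g h :: "R3 \<Rightarrow> 'b::euclidean_space"
  assumes "square_integrable f" "square_integrable g" "square_integrable h"
  shows "L2norm (\<lambda>x. f x - h x) \<le> L2norm (\<lambda>x. f x - g x) + L2norm (\<lambda>x. g x - h x)"
  using L2norm_triangle[OF square_integrable_diff[OF assms(1,2)] square_integrable_diff[OF assms(2,3)]]
  by simp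

lemma square_integrable_affine:
  assumes "square_integrable f" "c \<noteq> 0"
  shows "square_integrable (\<lambda>x. f (t + c *\<^sub>R x))"
  using square_integrable_measurable[OF assms(1)]
    integrable_affine[OF square_integrableD[OF assms(1)] assms(2), of t]
  unfolding square_integrable_def by simp

lemma L2norm_translate: "L2norm (\<lambda>x. f (x + h)) = L2norm f"
  using integral_translate(1)[of "\<lambda>x. (norm (f x))\<^sup>2" h] by (simp add: L2norm_def)

lemma integrable_continuous_compact_support:
  fixes f :: "'a::euclidean_space \<Rightarrow> 'b::{banach, second_countable_topology}"
  assumes "continuous_on UNIV f" "\<And>x. norm x > r \<Longrightarrow> f x = 0"
  shows "integrable lborel f"
proof -
  have "integrable lborel (\<lambda>x. indicator (cball 0 r) x *\<^sub>R f x)"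
    by (intro borel_integrable_compact) (auto intro: continuous_on_subset assms(1))
  moreover have "(\<lambda>x. indicator (cball 0 r) x *\<^sub>R f x) = f"
    using assms(2) by (auto simp: indicator_def)
  ultimately show ?thesis by simp
qed

lemma bounded_continuous_compact_support:
  fixes f :: "'a::euclidean_space \<Rightarrow> 'b::real_normed_vector"
  assumes "continuous_on UNIV f" "\<And>x. norm x > r \<Longrightarrow> f x = 0"
  obtains B where "B \<ge> 0" "\<And>x. norm (f x) \<le> B"
proof -
  have "compact (f ` cball 0 r)"
    by (intro compact_continuous_image) (auto intro: continuous_on_subset assms(1))
  then obtain B where B: "\<And>x. x \<in> cball 0 r \<Longrightarrow> norm (f x) \<le> B"
    by (metis bounded_iff compact_imp_bounded imageI)
  have "norm (f x) \<le> max B 0" for x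
    using B[of x] assms(2)[of x] by (cases "norm x > r") auto
  then show ?thesis
    by (intro that[of "max B 0"]) auto
qed

lemma square_integrable_continuous_compact_support:
  fixes f :: "R3 \<Rightarrow> 'b::euclidean_space"
  assumes "continuous_on UNIV f" "\<And>x. norm x > r \<Longrightarrow> f x = 0"
  shows "square_integrable f"
  unfolding square_integrable_def
  using assms by (auto intro!: integrable_continuous_compact_support[of _ r] continuous_intros
      borel_measurable_continuous_onI)

lemma test_function_square_integrable:
  assumes "v \<in> test_functions"
  shows "square_integrable v" "square_integrable (grad v)"
proof -
  obtain r where r: "r > 0" "\<And>x. norm x > r \<Longrightarrow> v x = 0" "\<And>x. norm x > r \<Longrightarrow> grad v x = 0"
    by (rule test_function_supp[OF assms]) blast
  then show "square_integrable v" "square_integrable (grad v)"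
    using assms by (auto intro!: square_integrable_continuous_compact_support[of _ r]
        smooth_continuous_on smooth_grad_continuous_on test_function_smooth)
qed

lemma L2norm_tendsto_0_iff:
  "((\<lambda>n. L2norm (f n)) \<longlongrightarrow> 0) F \<longleftrightarrow> ((\<lambda>n. LINT x|lborel. (norm (f n x))\<^sup>2) \<longlongrightarrow> 0) F"
proof
  assume "((\<lambda>n. L2norm (f n)) \<longlongrightarrow> 0) F"
  from tendsto_power[OF this, of 2] show "((\<lambda>n. LINT x|lborel. (norm (f n x))\<^sup>2) \<longlongrightarrow> 0) F"
    by (simp add: L2norm_square)
next
  assume "((\<lambda>n. LINT x|lborel. (norm (f n x))\<^sup>2) \<longlongrightarrow> 0) F"
  from tendsto_real_sqrt[OF this] show "((\<lambda>n. L2norm (f n)) \<longlongrightarrow> 0) F"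
    by (simp add: L2norm_def)
qed

lemma L2norm_dominated_convergence:
  fixes f :: "nat \<Rightarrow> R3 \<Rightarrow> 'b::euclidean_space"
  assumes w: "square_integrable w" and [measurable]: "\<And>n. f n \<in> borel_measurable borel"
    and lim: "AE x in lborel. (\<lambda>n. f n x) \<longlonglongrightarrow> 0" and dom: "\<And>n x. norm (f n x) \<le> norm (w x)"
  shows "(\<lambda>n. L2norm (f n)) \<longlonglongrightarrow> 0"
  unfolding L2norm_tendsto_0_iff
proof -
  have "(\<lambda>n. LINT x|lborel. (norm (f n x))\<^sup>2) \<longlonglongrightarrow> (LINT x|(lborel :: R3 measure). 0)"
  proof (rule integral_dominated_convergence[OF _ _ square_integrableD[OF w]])
    show "AE x in lborel. (\<lambda>n. (norm (f n x))\<^sup>2) \<longlonglongrightarrow> 0"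
      using lim
    proof eventually_elim
      case (elim x)
      from tendsto_power[OF tendsto_norm[OF this], of 2] show ?case by simp
    qed
    show "AE x in lborel. norm ((norm (f n x))\<^sup>2) \<le> (norm (w x))\<^sup>2" for n
      using dom by (auto intro!: power_mono)
  qed auto
  then show "(\<lambda>n. LINT x|lborel. (norm (f n x))\<^sup>2) \<longlonglongrightarrow> 0"
    by simp
qed

section \<open>Density of compactly supported continuous functions\<close>

text \<open>Lebesgue measurable functions are limits of continuous ones off a negligible set, which
  is how \<open>measurable_on\<close> is defined; completion does not change the almost-everywhere
  statement.\<close>

lemma borel_AE_lim_continuous:
  fixes f :: "R3 \<Rightarrow> 'b::euclidean_space"
  assumes "f \<in> borel_measurable borel"
  obtains g where "\<And>n. continuous_on UNIV (g n)" "AE x in lborel. (\<lambda>n. g n x) \<longlonglongrightarrow> f x"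
proof -
  have "f \<in> borel_measurable lebesgue"
    using assms by (simp add: measurable_completion)
  then have "f measurable_on UNIV"
    by (rule lebesgue_measurable_imp_measurable_on) simp
  then obtain N g where N: "negligible N" and g: "\<And>n. continuous_on UNIV (g n)"
    "\<And>x. x \<notin> N \<Longrightarrow> (\<lambda>n. g n x) \<longlonglongrightarrow> f x"
    unfolding measurable_on_def by auto
  have "AE x in lebesgue. (\<lambda>n. g n x) \<longlonglongrightarrow> f x"
    by (rule AE_I'[of N]) (use N g in \<open>auto simp: negligible_iff_null_sets\<close>)
  then have "AE x in lborel. (\<lambda>n. g n x) \<longlonglongrightarrow> f x"
    by (simp add: AE_completion_iff)
  with g(1) show ?thesis by (rule that)
qed

definition tent :: "nat \<Rightarrow> R3 \<Rightarrow> real" where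
  "tent n x = max 0 (min 1 (real n + 1 - norm x))"

text \<open>The radial retraction onto the ball of radius \<open>n\<close>. Unlike truncation by an
  indicator it is continuous for \<open>n > 0\<close>, so it preserves continuity of the
  approximants.\<close>

definition clamp_norm :: "nat \<Rightarrow> 'b::euclidean_space \<Rightarrow> 'b" where
  "clamp_norm n y = (real n / max (real n) (norm y)) *\<^sub>R y"

lemma tent_bounds: "0 \<le> tent n x" "tent n x \<le> 1" "norm x > real n + 1 \<Longrightarrow> tent n x = 0"
  by (auto simp: tent_def)

lemma tent_tendsto: "(\<lambda>n. tent n x) \<longlonglongrightarrow> 1"
proof (rule tendsto_eventually)
  obtain N :: nat where "norm x \<le> N" using real_arch_simple by blast
  then show "\<forall>\<^sub>F n in sequentially. tent n x = 1"
    by (intro eventually_sequentiallyI[of N]) (auto simp: tent_def)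
qed

lemma clamp_norm_bounds: "norm (clamp_norm n y) \<le> real n" "norm (clamp_norm n y) \<le> norm y"
proof -
  have "n * norm y / max n (norm y) \<le> n"
    by (cases "n = 0") (auto simp: divide_le_eq mult_left_mono less_max_iff_disj)
  then show "norm (clamp_norm n y) \<le> n"
    by (simp add: clamp_norm_def)
  have "n * norm y / max n (norm y) \<le> norm y"
    by (cases "n = 0") (auto simp: divide_le_eq mult_left_mono less_max_iff_disj mult.commute[of "real n"])
  then show "norm (clamp_norm n y) \<le> norm y"
    by (simp add: clamp_norm_def)
qed

lemma clamp_norm_tendsto: "(\<lambda>n. clamp_norm n y) \<longlonglongrightarrow> y"
proof (rule tendsto_eventually)
  obtain N :: nat where "norm y < N" using reals_Archimedean2 by blast
  then show "\<forall>\<^sub>F n in sequentially. clamp_norm n y = y"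
    by (intro eventually_sequentiallyI[of N]) (auto simp: clamp_norm_def max_def)
qed

lemma continuous_tent[continuous_intros]: "continuous_on S (tent n)"
  unfolding tent_def by (intro continuous_intros)

lemma continuous_clamp_norm:
  assumes "continuous_on S f" "n > 0" shows "continuous_on S (\<lambda>x. clamp_norm n (f x))"
  unfolding clamp_norm_def using assms(2)
  by (intro continuous_intros assms(1)) (auto simp: max_def)

lemma tent_measurable[measurable]: "tent n \<in> borel_measurable borel"
  by (intro borel_measurable_continuous_onI continuous_intros)

text \<open>Pointwise limits of continuous functions say nothing about L2. Applying
  \<open>clamp_norm\<close> and multiplying by \<open>tent\<close> to both \<open>f\<close> and its
  approximants makes them uniformly bounded with a common compact support, where dominated
  convergence applies.\<close>

lemma square_integrable_approx_compact:
  fixes f :: "R3 \<Rightarrow> 'b::euclidean_space"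
  assumes f: "square_integrable f" and e: "e > 0"
  obtains g r where "continuous_on UNIV g" "\<And>x. norm x > r \<Longrightarrow> g x = 0" "L2norm (\<lambda>x. f x - g x) < e"
proof -
  have fm[measurable]: "f \<in> borel_measurable borel" using f by auto
  have cm[measurable]: "clamp_norm n \<in> borel_measurable borel" for n :: nat
    unfolding clamp_norm_def[abs_def] by measurable
  define f1 where "f1 n x = tent n x *\<^sub>R clamp_norm n (f x)" for n x
  have f1m[measurable]: "f1 n \<in> borel_measurable borel" for n
    unfolding f1_def by measurable
  have f1f: "norm (f1 n x) \<le> norm (f x)" for n x
    using mult_mono[OF tent_bounds(2)[of n x] clamp_norm_bounds(2)[of n "f x"]] tent_bounds(1)[of n x]
    by (simp add: f1_def)
  have "(\<lambda>n. L2norm (\<lambda>x. f x - f1 n x)) \<longlonglongrightarrow> 0"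
  proof (rule L2norm_dominated_convergence[of "\<lambda>x. 2 *\<^sub>R f x"])
    show "square_integrable (\<lambda>x. 2 *\<^sub>R f x)" by (rule square_integrable_cmult[OF f])
    show "AE x in lborel. (\<lambda>n. f x - f1 n x) \<longlonglongrightarrow> 0"
      using tendsto_diff[OF tendsto_const tendsto_scaleR[OF tent_tendsto clamp_norm_tendsto]]
      by (auto simp: f1_def intro!: tendsto_eq_intros tent_tendsto clamp_norm_tendsto)
    show "norm (f x - f1 n x) \<le> norm (2 *\<^sub>R f x)" for n x
      using norm_triangle_ineq4[of "f x" "f1 n x"] f1f[of n x] by simp
  qed measurable
  then have "\<forall>\<^sub>F n in sequentially. L2norm (\<lambda>x. f x - f1 n x) < e / 2"
    using e by (intro order_tendstoD(2)) auto
  \<comment> \<open>\<open>n > 0\<close> keeps the denominator of \<open>clamp_norm\<close> away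
    from 0, as its continuity requires.\<close>
  then have "\<forall>\<^sub>F n in sequentially. L2norm (\<lambda>x. f x - f1 n x) < e / 2 \<and> n > 0"
    by (intro eventually_conj eventually_gt_at_top)
  then obtain n where n: "L2norm (\<lambda>x. f x - f1 n x) < e / 2" "n > 0"
    by (auto simp: eventually_sequentially)
  obtain g where g: "\<And>k. continuous_on UNIV (g k)" "AE x in lborel. (\<lambda>k. g k x) \<longlonglongrightarrow> f x"
    using borel_AE_lim_continuous[OF fm] by blast
  define h where "h k x = tent n x *\<^sub>R clamp_norm n (g k x)" for k x
  have h: "continuous_on UNIV (h k)" "\<And>x. norm x > n + 1 \<Longrightarrow> h k x = 0" for k
    unfolding h_def using g(1) n(2) tent_bounds(3)[of n]
    by (auto intro!: continuous_intros continuous_clamp_norm)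
  have hm[measurable]: "h k \<in> borel_measurable borel" for k
    using h(1) by (rule borel_measurable_continuous_onI)
  define w :: "R3 \<Rightarrow> real" where "w x = 2 * n * tent n x" for x
  have w: "square_integrable w"
    by (rule square_integrable_continuous_compact_support[of _ "n + 1"])
      (auto simp: w_def tent_bounds intro!: continuous_intros)
  have "(\<lambda>k. L2norm (\<lambda>x. f1 n x - h k x)) \<longlonglongrightarrow> 0"
  proof (rule L2norm_dominated_convergence[OF w])
    show "AE x in lborel. (\<lambda>k. f1 n x - h k x) \<longlonglongrightarrow> 0"
      using g(2)
    proof eventually_elim
      case (elim x)
      have "continuous_on UNIV (clamp_norm n :: 'b \<Rightarrow> 'b)"
        using n(2) by (intro continuous_clamp_norm[of _ "\<lambda>x. x"] continuous_intros)
      then have "(\<lambda>k. clamp_norm n (g k x)) \<longlonglongrightarrow> clamp_norm n (f x)"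
        by (rule continuous_on_tendsto_compose) (use elim in auto)
      then show ?case
        unfolding f1_def h_def by (auto intro!: tendsto_eq_intros)
    qed
    show "norm (f1 n x - h k x) \<le> norm (w x)" for k x
    proof -
      have "norm (f1 n x - h k x) = tent n x * norm (clamp_norm n (f x) - clamp_norm n (g k x))"
        by (simp add: f1_def h_def tent_bounds flip: scaleR_diff_right)
      also have "\<dots> \<le> tent n x * (2 * n)"
        using norm_triangle_ineq4[of "clamp_norm n (f x)" "clamp_norm n (g k x)"]
          clamp_norm_bounds(1)[of n "f x"] clamp_norm_bounds(1)[of n "g k x"]
        by (intro mult_left_mono) (auto simp: tent_bounds)
      finally show ?thesis by (simp add: w_def tent_bounds mult.commute)
    qed
  qed measurable
  then have "\<forall>\<^sub>F k in sequentially. L2norm (\<lambda>x. f1 n x - h k x) < e / 2"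
    using e by (intro order_tendstoD(2)) auto
  then obtain k where k: "L2norm (\<lambda>x. f1 n x - h k x) < e / 2"
    by (auto simp: eventually_sequentially)
  have f1: "square_integrable (f1 n)" by (rule square_integrable_bound[OF f f1m f1f])
  have hk: "square_integrable (h k)" by (rule square_integrable_continuous_compact_support[OF h])
  have "L2norm (\<lambda>x. f x - h k x) < e"
    using L2norm_triangle_diff[OF f f1 hk] n k by simp
  with h show ?thesis by (intro that[of "h k" "real n + 1"]) auto
qed

lemma square_integrable_translate: "square_integrable f \<Longrightarrow> square_integrable (\<lambda>x. f (x + h))"
  using square_integrable_affine[of f 1 h] by (simp add: add.commute)

text \<open>Translations preserve the norm, so density reduces the claim to a continuous compactly
  supported \<open>g\<close>. The filter is \<open>nhds 0\<close> and not \<open>at 0\<close>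
  because the displacement \<open>e n *\<^sub>R z\<close> of a mollification vanishes at
  \<open>z = 0\<close>.\<close>

lemma L2norm_translation_continuous:
  fixes f :: "R3 \<Rightarrow> 'b::euclidean_space"
  assumes f: "square_integrable f"
  shows "((\<lambda>h. L2norm (\<lambda>x. f (x + h) - f x)) \<longlongrightarrow> 0) (nhds 0)"
proof (rule order_tendstoI)
  fix e :: real assume "e > 0"
  then obtain g r where g: "continuous_on UNIV g" "\<And>x. norm x > r \<Longrightarrow> g x = 0"
    "L2norm (\<lambda>x. f x - g x) < e / 3"
    using square_integrable_approx_compact[OF f, of "e / 3"] by (metis divide_pos_pos zero_less_numeral)
  have gs: "square_integrable g" by (rule square_integrable_continuous_compact_support[OF g(1,2)])
  obtain B where B: "B \<ge> 0" "\<And>x. norm (g x) \<le> B"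
    using bounded_continuous_compact_support[OF g(1,2)] by blast
  have gt: "((\<lambda>h. L2norm (\<lambda>x. g (x + h) - g x)) \<longlongrightarrow> 0) (at 0)"
    unfolding tendsto_at_iff_sequentially o_def
  proof (intro allI impI)
    fix X :: "nat \<Rightarrow> R3" assume X: "X \<longlonglongrightarrow> 0"
    then have "Bseq X" by (rule convergent_imp_Bseq[OF convergentI])
    then obtain K where K: "\<And>n. norm (X n) \<le> K" by (auto simp: Bseq_def)
    \<comment> \<open>This equals \<open>2 * B\<close> on the ball of radius \<open>r + K\<close>,
      outside of which \<open>g\<close> and all its translates by \<open>X n\<close> vanish.\<close>
    define w :: "R3 \<Rightarrow> real" where "w x = 2 * B * max 0 (min 1 (r + K + 1 - norm x))" for x
    have w: "square_integrable w"
      by (rule square_integrable_continuous_compact_support[of _ "r + K + 1"])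
        (auto simp: w_def intro!: continuous_intros)
    show "(\<lambda>n. L2norm (\<lambda>x. g (x + X n) - g x)) \<longlonglongrightarrow> 0"
    proof (rule L2norm_dominated_convergence[OF w])
      show "(\<lambda>x. g (x + X n) - g x) \<in> borel_measurable borel" for n
        by (intro borel_measurable_continuous_onI continuous_intros continuous_on_compose2[OF g(1)]) auto
      have "(\<lambda>n. g (x + X n)) \<longlonglongrightarrow> g (x + 0)" for x
        using X by (intro continuous_on_tendsto_compose[OF g(1)] tendsto_intros) auto
      then show "AE x in lborel. (\<lambda>n. g (x + X n) - g x) \<longlonglongrightarrow> 0"
        by (simp add: LIM_zero)
      show "norm (g (x + X n) - g x) \<le> norm (w x)" for n x
      proof (cases "norm x \<le> r + K")
        case True
        then have "w x = 2 * B" by (simp add: w_def)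
        then show ?thesis
          using norm_triangle_ineq4[of "g (x + X n)" "g x"] B(1) B(2)[of "x + X n"] B(2)[of x] by simp
      next
        case False
        have "norm x \<le> norm (x + X n) + norm (X n)"
          by (metis add_diff_cancel norm_triangle_ineq4)
        then have "norm (x + X n) > r" using K[of n] False by simp
        moreover have "norm x > r" using K[of n] False norm_ge_zero[of "X n"] by linarith
        ultimately show ?thesis using g(2) by simp
      qed
    qed
  qed
  \<comment> \<open>The function takes the value 0 at \<open>h = 0\<close>, so the punctured limit
    is a limit along full neighbourhoods.\<close>
  have "((\<lambda>h. L2norm (\<lambda>x. g (x + h) - g x)) \<longlongrightarrow> 0) (nhds 0)"
    using gt tendsto_at_iff_tendsto_nhds[of "\<lambda>h. L2norm (\<lambda>x. g (x + h) - g x)" 0]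
    by (simp add: L2norm_def)
  then have "\<forall>\<^sub>F h in nhds 0. L2norm (\<lambda>x. g (x + h) - g x) < e / 3"
    using \<open>e > 0\<close> by (intro order_tendstoD(2)) auto
  then show "\<forall>\<^sub>F h in nhds 0. L2norm (\<lambda>x. f (x + h) - f x) < e"
  proof eventually_elim
    case (elim h)
    note fh = square_integrable_translate[OF f, of h] and gh = square_integrable_translate[OF gs, of h]
    have "L2norm (\<lambda>x. f (x + h) - g (x + h)) = L2norm (\<lambda>x. f x - g x)"
      by (rule L2norm_translate)
    with elim g(3) L2norm_triangle_diff[OF fh gh f] L2norm_triangle_diff[OF gh gs f]
      L2norm_minus_commute[of f g]
    show ?case by linarith
  qed
qed (auto intro: eventuallyI less_le_trans L2norm_nonneg)

section \<open>Mollification\<close>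

definition conv :: "(R3 \<Rightarrow> real) \<Rightarrow> (R3 \<Rightarrow> real) \<Rightarrow> R3 \<Rightarrow> real" where
  "conv v u x = (LINT y|lborel. v (x - y) * u y)"

lemma test_function_reflect: "v \<in> test_functions \<Longrightarrow> (\<lambda>y. v (x - y)) \<in> test_functions"
  using test_function_affine[of v "-1" x] by simp

lemma conv_integrable:
  assumes "v \<in> test_functions" "square_integrable u"
  shows "integrable lborel (\<lambda>y. v (x - y) * u y)"
  using square_integrable_inner_integrable[OF test_function_square_integrable(1)[OF test_function_reflect[OF
      assms(1)]] assms(2)]
  by simp

lemma conv_partial_integrable:
  assumes "v \<in> test_functions" "square_integrable u"
  shows "integrable lborel (\<lambda>y. partial_deriv i v (x - y) * u y)"
  using conv_integrable[OF test_function_partial_deriv[OF assms(1)] assms(2)] .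

lemma test_function_Lipschitz:
  assumes "v \<in> test_functions"
  obtains L where "L \<ge> 0" "\<And>x. norm (grad v x) \<le> L" "\<And>x y. \<bar>v x - v y\<bar> \<le> L * norm (x - y)"
proof -
  obtain r where r: "r > 0" "\<And>x. norm x > r \<Longrightarrow> v x = 0" "\<And>x. norm x > r \<Longrightarrow> grad v x = 0"
    by (rule test_function_supp[OF assms]) blast
  obtain L where L: "L \<ge> 0" "\<And>x. norm (grad v x) \<le> L"
    by (rule bounded_continuous_compact_support[of "grad v" r])
      (use r(3) smooth_grad_continuous_on[OF test_function_smooth[OF assms]] in auto)
  have "norm (v x - v y) \<le> L * norm (x - y)" for x y
  proof (rule differentiable_bound[of UNIV _ "\<lambda>x h. h \<bullet> grad v x"])
    show "(v has_derivative (\<lambda>h. h \<bullet> grad v x)) (at x within UNIV)" for x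
      using smooth_GDERIV[OF test_function_smooth[OF assms], of x] by (simp add: gderiv_def)
    show "onorm (\<lambda>h. h \<bullet> grad v x) \<le> L" for x
    proof (rule onorm_bound[OF L(1)])
      fix h :: R3
      have "\<bar>h \<bullet> grad v x\<bar> \<le> norm h * norm (grad v x)" by (rule Cauchy_Schwarz_ineq2)
      also have "\<dots> \<le> norm h * L" using L by (intro mult_left_mono) auto
      finally show "norm (h \<bullet> grad v x) \<le> L * norm h" by (simp add: mult.commute)
    qed
  qed auto
  with L show ?thesis by (intro that) auto
qed

text \<open>Differentiation under the integral sign, with all derivatives falling on
  \<open>v\<close>. The remainder quotient of \<open>v\<close> is bounded and supported in a fixed
  ball along the whole sequence, so its product with the square-integrable \<open>u\<close> is
  dominated.\<close>

lemma conv_GDERIV: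
  assumes v: "v \<in> test_functions" and u: "square_integrable u"
  shows "GDERIV (conv v u) x :> (\<chi> i. conv (partial_deriv i v) u x)"
proof -
  obtain r where r: "r > 0" "\<And>x. norm x > r \<Longrightarrow> v x = 0" "\<And>x. norm x > r \<Longrightarrow> grad v x = 0"
    by (rule test_function_supp[OF v]) blast
  obtain L where L: "L \<ge> 0" "\<And>x. norm (grad v x) \<le> L" "\<And>x y. \<bar>v x - v y\<bar> \<le> L * norm (x - y)"
    by (rule test_function_Lipschitz[OF v]) blast
  have [measurable]: "u \<in> borel_measurable borel" using u by auto
  have vm[measurable]: "v \<in> borel_measurable borel"
    by (intro borel_measurable_continuous_onI smooth_continuous_on test_function_smooth v)
  have gm[measurable]: "grad v \<in> borel_measurable borel"
    by (intro borel_measurable_continuous_onI smooth_grad_continuous_on test_function_smooth v)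
  let ?D = "(\<chi> i. conv (partial_deriv i v) u x)"
  let ?q = "\<lambda>z y. (v (z - y) - v (x - y) - (z - x) \<bullet> grad v (x - y)) / norm (z - x) * u y"
  have D: "integrable lborel (\<lambda>y. ((z - x) \<bullet> grad v (x - y)) * u y)"
     "(z - x) \<bullet> ?D = (LINT y|lborel. ((z - x) \<bullet> grad v (x - y)) * u y)" for z
  proof -
    have eq: "((z - x) \<bullet> grad v (x - y)) * u y = (\<Sum>i\<in>UNIV. (z - x) $ i * (partial_deriv i v (x - y) * u y))" for y
      by (simp add: inner_vec_def grad_def sum_distrib_right mult.assoc)
    show "integrable lborel (\<lambda>y. ((z - x) \<bullet> grad v (x - y)) * u y)"
      unfolding eq by (intro Bochner_Integration.integrable_sum integrable_mult_right conv_partial_integrable v u)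
    show "(z - x) \<bullet> ?D = (LINT y|lborel. ((z - x) \<bullet> grad v (x - y)) * u y)"
      unfolding eq using conv_partial_integrable[OF v u]
      by (subst Bochner_Integration.integral_sum) (auto simp: inner_vec_def conv_def)
  qed
  have quot: "((conv v u z - conv v u x) - (z - x) \<bullet> ?D) /\<^sub>R norm (z - x) = (LINT y|lborel. ?q z y)" for z
  proof -
    have "(conv v u z - conv v u x) - (z - x) \<bullet> ?D
        = (LINT y|lborel. (v (z - y) * u y - v (x - y) * u y) - ((z - x) \<bullet> grad v (x - y)) * u y)"
      unfolding D(2) unfolding conv_def using D(1) conv_integrable[OF v u] by simp
    then have "((conv v u z - conv v u x) - (z - x) \<bullet> ?D) /\<^sub>R norm (z - x) =
        (LINT y|lborel. ((v (z - y) * u y - v (x - y) * u y) - ((z - x) \<bullet> grad v (x - y)) * u y) / norm (z - x))"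
      by (simp add: divide_inverse mult.commute[of "inverse _"])
    also have "\<dots> = (LINT y|lborel. ?q z y)"
      by (rule Bochner_Integration.integral_cong) (simp_all add: diff_divide_distrib algebra_simps)
    finally show ?thesis .
  qed
  have "((\<lambda>z. ((conv v u z - conv v u x) - (z - x) \<bullet> ?D) /\<^sub>R norm (z - x)) \<longlongrightarrow> 0) (at x)"
    unfolding quot tendsto_at_iff_sequentially o_def
  proof (intro allI impI)
    fix X :: "nat \<Rightarrow> R3" assume X: "\<forall>i. X i \<in> UNIV - {x}" "X \<longlonglongrightarrow> x"
    then have "(\<lambda>n. X n - x) \<longlonglongrightarrow> 0" by (simp add: LIM_zero)
    then have "Bseq (\<lambda>n. X n - x)" by (rule convergent_imp_Bseq[OF convergentI])
    then obtain K where K: "\<And>n. norm (X n - x) \<le> K" by (auto simp: Bseq_def)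
    \<comment> \<open>\<open>L\<close> bounds both the difference quotient and the gradient of
      \<open>v\<close>. When \<open>norm (x - y) > r + K\<close>, the points \<open>x - y\<close>
      and all \<open>X n - y\<close> have norm above \<open>r\<close>, where \<open>v\<close>
      vanishes.\<close>
    define w where "w y = 2 * L * (max 0 (min 1 (r + K + 1 - norm (x - y))))" for y
    have w: "square_integrable w"
    proof (rule square_integrable_continuous_compact_support[of _ "r + K + 1 + norm x"])
      show "w y = 0" if "norm y > r + K + 1 + norm x" for y
        using that norm_triangle_ineq2[of y x] by (simp add: w_def norm_minus_commute)
    qed (auto simp: w_def intro!: continuous_intros)
    have "(\<lambda>n. LINT y|lborel. ?q (X n) y) \<longlonglongrightarrow> (LINT y|(lborel :: R3 measure). 0)"
    proof (rule integral_dominated_convergence)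
      show "integrable lborel (\<lambda>y. norm (w y) * norm (u y))"
        by (rule square_integrable_mult_integrable[OF w u])
      show "AE y in lborel. (\<lambda>n. ?q (X n) y) \<longlonglongrightarrow> 0"
      proof (rule AE_I2)
        fix y
        have "(v has_derivative (\<lambda>h. h \<bullet> grad v (x - y))) (at (x - y))"
          using smooth_GDERIV[OF test_function_smooth[OF v], of "x - y"] by (simp add: gderiv_def)
        then have "((\<lambda>z. ((v z - v (x - y)) - (z - (x - y)) \<bullet> grad v (x - y)) /\<^sub>R norm (z - (x - y))) \<longlongrightarrow> 0) (at (x - y))"
          by (simp add: has_derivative_at_within)
        moreover have "\<forall>i. X i - y \<in> UNIV - {x - y}" "(\<lambda>n. X n - y) \<longlonglongrightarrow> x - y"
          using X by (auto intro!: tendsto_intros)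
        ultimately have "(\<lambda>n. ((v (X n - y) - v (x - y)) - (X n - y - (x - y)) \<bullet> grad v (x - y)) /\<^sub>R norm (X n - y -
            (x - y))) \<longlonglongrightarrow> 0"
          unfolding tendsto_at_iff_sequentially o_def by (elim allE[of _ "\<lambda>n. X n - y"]) auto
        then show "(\<lambda>n. ?q (X n) y) \<longlonglongrightarrow> 0"
          by (intro tendsto_mult_left_zero) (simp add: divide_inverse mult.commute)
      qed
      show "AE y in lborel. norm (?q (X n) y) \<le> norm (w y) * norm (u y)" for n
      proof (rule AE_I2)
        fix y
        have nz: "norm (X n - x) > 0" using X by auto
        have "\<bar>(v (X n - y) - v (x - y) - (X n - x) \<bullet> grad v (x - y)) / norm (X n - x)\<bar> \<le> norm (w y)"
        proof (cases "norm (x - y) \<le> r + K")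
          case True
          have "\<bar>v (X n - y) - v (x - y)\<bar> \<le> L * norm (X n - x)"
            using L(3)[of "X n - y" "x - y"] by simp
          moreover have "\<bar>(X n - x) \<bullet> grad v (x - y)\<bar> \<le> L * norm (X n - x)"
            using Cauchy_Schwarz_ineq2[of "X n - x" "grad v (x - y)"] mult_left_mono[OF L(2)[of "x - y"], of
                "norm (X n - x)"]
            by (simp add: mult.commute)
          ultimately have "\<bar>v (X n - y) - v (x - y) - (X n - x) \<bullet> grad v (x - y)\<bar> \<le> 2 * L * norm (X n - x)"
            by linarith
          moreover have "norm (w y) = 2 * L" using True L(1) by (simp add: w_def)
          ultimately show ?thesis using nz by (simp add: divide_le_eq)
        next
          case False
          have "norm (x - y) \<le> norm (X n - y) + norm (X n - x)"
            using norm_triangle_ineq4[of "X n - y" "X n - x"] by simp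
          then have "norm (X n - y) > r" using K[of n] False by simp
          moreover have "norm (x - y) > r" using K[of n] False norm_ge_zero[of "X n - x"] by linarith
          ultimately show ?thesis using r(2)[of "X n - y"] r(2)[of "x - y"] r(3)[of "x - y"] by simp
        qed
        then show "norm (?q (X n) y) \<le> norm (w y) * norm (u y)"
          by (simp only: abs_mult real_norm_def mult_right_mono abs_ge_zero)
      qed
    qed measurable
    then show "(\<lambda>n. LINT y|lborel. ?q (X n) y) \<longlonglongrightarrow> 0" by simp
  qed
  then show ?thesis
    unfolding gderiv_def has_derivative_at_within
    by (auto intro: bounded_linear_inner_left)
qed

text \<open>For fixed \<open>u\<close>, the convolutions with test functions form a class closed
  under partial derivatives, because test functions do.\<close>

lemma smooth_conv:
  assumes v: "v \<in> test_functions" and u: "square_integrable u"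
  shows "smooth (conv v u)"
proof (rule smooth_coinduct[where S = "{conv v u | v. v \<in> test_functions}"])
  fix f and x :: R3 assume "f \<in> {conv v u | v. v \<in> test_functions}"
  then show "f differentiable at x"
    using conv_GDERIV[OF _ u] unfolding gderiv_def differentiable_def by blast
next
  fix f i assume "f \<in> {conv v u | v. v \<in> test_functions}"
  then obtain v where v: "v \<in> test_functions" "f = conv v u" by blast
  then have "partial_deriv i f = conv (partial_deriv i v) u"
    by (auto simp: partial_deriv_GDERIV(1)[OF conv_GDERIV[OF v(1) u]])
  then show "partial_deriv i f \<in> {conv v u | v. v \<in> test_functions}"
    using test_function_partial_deriv[OF v(1)] by blast
qed (use v in blast)

text \<open>The weak gradient is tested with \<open>\<lambda>y. v (x - y)\<close>; the sign from the
  reflection cancels the sign in the definition of the weak gradient.\<close>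

lemma conv_partial_weak_gradient:
  assumes v: "v \<in> test_functions" and u: "square_integrable u" and g: "has_L2_weak_gradient u g"
  shows "conv (partial_deriv i v) u x = conv v (\<lambda>y. g y $ i) x"
proof -
  have "partial_deriv i (\<lambda>y. v (x - y)) y = - partial_deriv i v (x - y)" for y
    using grad_affine(2)[of v "-1" y x] smooth_differentiable[OF test_function_smooth[OF v]]
    by (simp add: grad_def vec_eq_iff)
  then have "(LINT y|lborel. u y * - partial_deriv i v (x - y)) = - (LINT y|lborel. g y $ i * v (x - y))"
    using g[unfolded has_L2_weak_gradient_def, THEN conjunct2, rule_format, OF test_function_reflect[OF v, of x], of i]
    by simp
  then show ?thesis
    by (simp add: conv_def mult.commute)
qed

section \<open>The normalised mollifier and convergence of mollifications in L2\<close>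

definition mollifier :: "R3 \<Rightarrow> real" where
  "mollifier z = bump z / (LINT z|lborel. bump z)"

lemma integral_bump_pos: "(LINT z|lborel. bump z) > 0"
proof -
  have int: "integrable lborel bump"
    by (rule integrable_continuous_compact_support[of _ 1])
      (auto simp: bump_outside smooth_bump intro!: smooth_continuous_on)
  have "\<not> (AE z in lborel. bump z = 0)"
  proof
    assume "AE z in lborel. bump z = 0"
    then have "AE z in lborel. z \<notin> ball (0::R3) 1"
      by (rule AE_mp) (use bump_pos in fastforce)
    then have "emeasure lborel (ball (0::R3) 1) = 0"
      by (subst (asm) AE_iff_measurable[where N = "ball 0 1"]) auto
    moreover have "measure lborel (ball (0::R3) 1) > 0"
      by (intro content_ball_pos) auto
    ultimately show False by (simp add: measure_def)
  qed
  then have "(LINT z|lborel. bump z) \<noteq> 0"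
    using integral_nonneg_eq_0_iff_AE[OF int] bump_nonneg by simp
  moreover have "(LINT z|lborel. bump z) \<ge> 0"
    by (simp add: bump_nonneg)
  ultimately show ?thesis by simp
qed

lemma mollifier_test: "mollifier \<in> test_functions"
  using test_function_mult[OF bump_test smooth_const[of "1 / (LINT z|lborel. bump z)"]]
  by (simp add: mollifier_def[abs_def])

lemma mollifier_nonneg: "0 \<le> mollifier z"
  using integral_bump_pos by (simp add: mollifier_def bump_nonneg)

lemma mollifier_integrable: "integrable lborel mollifier"
  by (rule integrable_continuous_compact_support[of _ 1])
    (auto simp: mollifier_def bump_outside intro!: smooth_continuous_on mollifier_test[THEN test_function_smooth,
        unfolded mollifier_def[abs_def]])

lemma mollifier_integral: "(LINT z|lborel. mollifier z) = 1"
  using integral_bump_pos by (simp add: mollifier_def)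

lemma mollifier_measurable[measurable]: "mollifier \<in> borel_measurable borel"
  using mollifier_integrable by auto

text \<open>The scale sits in the argument of \<open>f\<close>, which exhibits the value as an
  average against one fixed probability density, also for vector-valued \<open>f\<close>.
  Substitution turns it into a convolution with the scaled kernel (\<open>mollify_eq_conv\<close>),
  from which smoothness follows.\<close>

definition mollify :: "real \<Rightarrow> (R3 \<Rightarrow> 'b::euclidean_space) \<Rightarrow> R3 \<Rightarrow> 'b" where
  "mollify e f x = (LINT z|lborel. mollifier z *\<^sub>R f (x - e *\<^sub>R z))"

lemma mollify_integrable:
  fixes f :: "R3 \<Rightarrow> 'b::euclidean_space"
  assumes f: "square_integrable f" and "e \<noteq> 0"
  shows "integrable lborel (\<lambda>z. mollifier z *\<^sub>R f (x - e *\<^sub>R z))"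
proof -
  have "square_integrable (\<lambda>z. f (x - e *\<^sub>R z))"
    using square_integrable_affine[OF assms(1), of "-e" x] assms(2) by simp
  from square_integrable_mult_integrable[OF test_function_square_integrable(1)[OF mollifier_test] this]
  show ?thesis
    by (rule Bochner_Integration.integrable_bound) (use square_integrable_measurable[OF f] in auto)
qed

lemma mollify_eq_conv:
  assumes e: "e > 0"
  shows "mollify e f = conv (\<lambda>x. mollifier ((1 / e) *\<^sub>R x) / e ^ 3) f"
proof
  fix x
  have "conv (\<lambda>x. mollifier ((1 / e) *\<^sub>R x) / e ^ 3) f x =
      (LINT z|lborel. mollifier z * f (x - e *\<^sub>R z))"
    unfolding conv_def
    by (subst integral_affine[where c = "-e" and t = x]) (use e in auto)
  then show "mollify e f x = conv (\<lambda>x. mollifier ((1 / e) *\<^sub>R x) / e ^ 3) f x"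
    by (simp add: mollify_def)
qed

lemma mollifier_scaled_test: "e > 0 \<Longrightarrow> (\<lambda>x. mollifier ((1 / e) *\<^sub>R x) / e ^ 3) \<in> test_functions"
  using test_function_mult[OF test_function_affine[OF mollifier_test, of "1 / e" 0] smooth_const[of "1 / e ^ 3"]]
  by simp

lemma mollify_nth:
  fixes g :: "R3 \<Rightarrow> R3"
  assumes "square_integrable g" "e \<noteq> 0"
  shows "mollify e g x $ i = mollify e (\<lambda>y. g y $ i) x"
  using integral_inner_left[OF mollify_integrable[OF assms, of x], of "axis i 1"]
  by (simp add: mollify_def inner_axis)

lemma mollify_smooth:
  "square_integrable u \<Longrightarrow> e > 0 \<Longrightarrow> smooth (mollify e u)"
  by (simp add: mollify_eq_conv smooth_conv mollifier_scaled_test)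

lemma mollify_grad:
  assumes u: "square_integrable u" and g: "has_L2_weak_gradient u g" and e: "e > 0"
  shows "grad (mollify e u) x = mollify e g x"
proof -
  have gs: "square_integrable g" using g by (simp add: has_L2_weak_gradient_def)
  have "grad (mollify e u) x = (\<chi> i. mollify e (\<lambda>y. g y $ i) x)"
    unfolding mollify_eq_conv[OF e] partial_deriv_GDERIV(2)[OF conv_GDERIV[OF mollifier_scaled_test[OF e] u]]
    by (simp add: conv_partial_weak_gradient[OF mollifier_scaled_test[OF e] u g])
  then show ?thesis
    using e by (simp add: vec_eq_iff mollify_nth[OF gs])
qed

text \<open>The inequality is nonnegativity of the variance of \<open>a\<close> under the density
  \<open>mollifier\<close>; integrability follows from
  \<open>\<bar>t\<bar> \<le> 1 + t\<^sup>2\<close>.\<close>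

lemma mollifier_Jensen:
  assumes [measurable]: "a \<in> borel_measurable borel"
    and int: "integrable lborel (\<lambda>z. mollifier z * (a z)\<^sup>2)"
  shows "integrable lborel (\<lambda>z. mollifier z * a z)"
    and "(LINT z|lborel. mollifier z * a z)\<^sup>2 \<le> (LINT z|lborel. mollifier z * (a z)\<^sup>2)"
proof -
  have "\<bar>t\<bar> \<le> 1 + t\<^sup>2" for t :: real
    using sum_squares_bound[of 1 "\<bar>t\<bar>"] by (cases "t \<ge> 0") auto
  then have "mollifier z * \<bar>a z\<bar> \<le> mollifier z + mollifier z * (a z)\<^sup>2" for z
    using mult_left_mono[OF _ mollifier_nonneg[of z], of "\<bar>a z\<bar>" "1 + (a z)\<^sup>2"] by (simp add: algebra_simps)
  then show 1: "integrable lborel (\<lambda>z. mollifier z * a z)"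
    by (intro Bochner_Integration.integrable_bound[OF Bochner_Integration.integrable_add[OF mollifier_integrable int]])
      (auto simp: abs_mult mollifier_nonneg intro: order_trans[OF _ abs_ge_self])
  define m where "m = (LINT z|lborel. mollifier z * a z)"
  have "0 \<le> (LINT z|lborel. mollifier z * (a z - m)\<^sup>2)"
    by (simp add: mollifier_nonneg)
  also have "\<dots> = (LINT z|lborel. mollifier z * (a z)\<^sup>2 - 2 * m * (mollifier z * a z) + m\<^sup>2 * mollifier z)"
    by (simp add: power2_eq_square algebra_simps)
  also have "\<dots> = (LINT z|lborel. mollifier z * (a z)\<^sup>2) - m\<^sup>2"
    using 1 int mollifier_integrable
    by (simp add: mollifier_integral m_def[symmetric]) (simp add: power2_eq_square)
  finally show "(LINT z|lborel. mollifier z * a z)\<^sup>2 \<le> (LINT z|lborel. mollifier z * (a z)\<^sup>2)"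
    by (simp add: m_def)
qed

text \<open>Jensen's inequality at almost every \<open>x\<close>, followed by Fubini, bounds the
  squared mollification error by the average of the squared translation errors.\<close>

lemma mollify_diff:
  fixes f :: "R3 \<Rightarrow> 'b::euclidean_space"
  assumes f: "square_integrable f" and e: "e \<noteq> 0"
  defines "w \<equiv> \<lambda>z. mollifier z * (L2norm (\<lambda>x. f (x - e *\<^sub>R z) - f x))\<^sup>2"
  shows "square_integrable (\<lambda>x. mollify e f x - f x)" (is ?A)
    and "integrable lborel w" (is ?B)
    and "(L2norm (\<lambda>x. mollify e f x - f x))\<^sup>2 \<le> (LINT z|lborel. w z)" (is ?C)
proof -
  have [measurable]: "f \<in> borel_measurable borel" using f by auto
  define P where "P z x = mollifier z * (norm (f (x - e *\<^sub>R z) - f x))\<^sup>2" for z x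
  have [measurable]: "case_prod P \<in> borel_measurable (lborel \<Otimes>\<^sub>M lborel)"
    unfolding P_def by measurable
  have ft: "square_integrable (\<lambda>x. f (x - e *\<^sub>R z) - f x)" for z
    using square_integrable_diff[OF square_integrable_translate[OF f, of "- e *\<^sub>R z"] f] by simp
  have Pw: "(LINT x|lborel. P z x) = w z" for z
    unfolding P_def w_def L2norm_square using square_integrableD[OF ft[of z]] by simp
  have wb: "norm (w z) \<le> norm (mollifier z * (2 * L2norm f)\<^sup>2)" for z
  proof -
    have "L2norm (\<lambda>x. f (x - e *\<^sub>R z) - f x) \<le> L2norm f + L2norm f"
      using L2norm_triangle[OF square_integrable_translate[OF f, of "- e *\<^sub>R z"] square_integrable_cmult[OF f, of "-1"]]
      by (simp add: L2norm_translate[of f "- (e *\<^sub>R z)", simplified] L2norm_def)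
    then have "(L2norm (\<lambda>x. f (x - e *\<^sub>R z) - f x))\<^sup>2 \<le> (2 * L2norm f)\<^sup>2"
      by (intro power_mono L2norm_nonneg) simp
    then show ?thesis
      unfolding w_def by (simp add: abs_mult mollifier_nonneg mult_left_mono)
  qed
  \<comment> \<open>Measurability is read off from the representation of \<open>w\<close> as an
    inner integral of the jointly measurable \<open>P\<close>.\<close>
  have wm: "w \<in> borel_measurable lborel"
    unfolding Pw[symmetric, abs_def] by measurable
  show ?B
    by (rule Bochner_Integration.integrable_bound[OF integrable_mult_left[OF mollifier_integrable]]) (use wm wb in auto)
  have Pint: "integrable (lborel \<Otimes>\<^sub>M lborel) (case_prod P)"
  proof (rule lborel_pair.Fubini_integrable)
    show "integrable lborel (\<lambda>z. LINT x|lborel. norm (case_prod P (z, x)))"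
      using \<open>?B\<close> by (simp add: P_def mollifier_nonneg w_def L2norm_square)
    show "AE z in lborel. integrable lborel (\<lambda>x. case_prod P (z, x))"
      using square_integrableD[OF ft] by (simp add: P_def)
  qed measurable
  have bnd: "AE x in lborel. (norm (mollify e f x - f x))\<^sup>2 \<le> (LINT z|lborel. P z x)"
    using lborel_pair.AE_integrable_snd[OF Pint]
  proof eventually_elim
    case (elim x)
    let ?a = "\<lambda>z. norm (f (x - e *\<^sub>R z) - f x)"
    have J: "integrable lborel (\<lambda>z. mollifier z * ?a z)"
      "(LINT z|lborel. mollifier z * ?a z)\<^sup>2 \<le> (LINT z|lborel. P z x)"
      unfolding P_def using elim by (auto intro!: mollifier_Jensen simp: P_def)
    have "mollify e f x - f x = (LINT z|lborel. mollifier z *\<^sub>R f (x - e *\<^sub>R z)) - (LINT z|lborel. mollifier z *\<^sub>R f x)"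
      by (simp add: mollify_def mollifier_integrable mollifier_integral)
    also have "\<dots> = (LINT z|lborel. mollifier z *\<^sub>R (f (x - e *\<^sub>R z) - f x))"
      using mollify_integrable[OF f e] mollifier_integrable
      by (simp add: scaleR_diff_right)
    finally have "norm (mollify e f x - f x) \<le> (LINT z|lborel. norm (mollifier z *\<^sub>R (f (x - e *\<^sub>R z) - f x)))"
      by (simp only: integral_norm_bound)
    also have "\<dots> = (LINT z|lborel. mollifier z * ?a z)"
      by (simp add: mollifier_nonneg)
    finally have "(norm (mollify e f x - f x))\<^sup>2 \<le> (LINT z|lborel. mollifier z * ?a z)\<^sup>2"
      by (intro power_mono) auto
    with J(2) show ?case by simp
  qed
  have mm: "mollify e f \<in> borel_measurable borel"
    unfolding mollify_def[abs_def] by measurable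
  have Pi: "integrable lborel (\<lambda>x. LINT z|lborel. P z x)"
    by (rule lborel_pair.integrable_snd[OF Pint])
  have di: "integrable lborel (\<lambda>x. (norm (mollify e f x - f x))\<^sup>2)"
    by (rule Bochner_Integration.integrable_bound[OF Pi])
      (use mm bnd in \<open>auto elim!: eventually_mono intro: order_trans[OF _ abs_ge_self]\<close>)
  with mm show ?A by (simp add: square_integrable_def)
  have "(LINT x|lborel. (norm (mollify e f x - f x))\<^sup>2) \<le> (LINT x|lborel. (LINT z|lborel. P z x))"
    by (rule integral_mono_AE[OF di Pi bnd])
  also have "\<dots> = (LINT z|lborel. w z)"
    by (simp add: lborel_pair.Fubini_integral[OF Pint] Pw)
  finally show ?C by (simp add: L2norm_square)
qed

text \<open>For each \<open>z\<close> the translation error tends to 0 and is at most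
  \<open>2 * L2norm f\<close>, so dominated convergence in \<open>z\<close> applies to the average
  in \<open>mollify_diff\<close>.\<close>

lemma mollify_tendsto:
  fixes f :: "R3 \<Rightarrow> 'b::euclidean_space"
  assumes f: "square_integrable f" and e: "\<And>n. e n \<noteq> 0" "e \<longlonglongrightarrow> 0"
  shows "(\<lambda>n. L2norm (\<lambda>x. mollify (e n) f x - f x)) \<longlonglongrightarrow> 0"
proof -
  define w where "w n z = mollifier z * (L2norm (\<lambda>x. f (x - e n *\<^sub>R z) - f x))\<^sup>2" for n z
  have wi: "integrable lborel (w n)" for n
    unfolding w_def[abs_def] by (rule mollify_diff(2)[OF f e(1)])
  have "(\<lambda>n. LINT z|lborel. w n z) \<longlonglongrightarrow> (LINT z|(lborel :: R3 measure). 0)"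
  proof (rule integral_dominated_convergence)
    show "integrable lborel (\<lambda>z. mollifier z * (2 * L2norm f)\<^sup>2)"
      by (intro integrable_mult_left mollifier_integrable)
    show "AE z in lborel. norm (w n z) \<le> mollifier z * (2 * L2norm f)\<^sup>2" for n
    proof (rule AE_I2)
      fix z
      have "L2norm (\<lambda>x. f (x - e n *\<^sub>R z) - f x) \<le> L2norm f + L2norm f"
        using L2norm_triangle[OF square_integrable_translate[OF f, of "- e n *\<^sub>R z"] square_integrable_cmult[OF f, of "-1"]]
        by (simp add: L2norm_translate[of f "- (e n *\<^sub>R z)", simplified] L2norm_def)
      then have "(L2norm (\<lambda>x. f (x - e n *\<^sub>R z) - f x))\<^sup>2 \<le> (2 * L2norm f)\<^sup>2"
        by (intro power_mono L2norm_nonneg) simp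
      then show "norm (w n z) \<le> mollifier z * (2 * L2norm f)\<^sup>2"
        unfolding w_def by (simp add: abs_mult mollifier_nonneg mult_left_mono)
    qed
    show "AE z in lborel. (\<lambda>n. w n z) \<longlonglongrightarrow> 0"
    proof (rule AE_I2)
      fix z :: R3
      have "(\<lambda>n. - (e n *\<^sub>R z)) \<longlonglongrightarrow> 0"
        by (auto intro!: tendsto_eq_intros e(2))
      then have "(\<lambda>n. L2norm (\<lambda>x. f (x + - (e n *\<^sub>R z)) - f x)) \<longlonglongrightarrow> 0"
        by (rule filterlim_compose[OF L2norm_translation_continuous[OF f]])
      then show "(\<lambda>n. w n z) \<longlonglongrightarrow> 0"
        unfolding w_def by (auto intro!: tendsto_eq_intros)
    qed
  qed (use wi in auto)
  then have lim: "(\<lambda>n. LINT z|lborel. w n z) \<longlonglongrightarrow> 0" by simp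
  show ?thesis
    unfolding L2norm_tendsto_0_iff L2norm_square[symmetric]
    by (rule tendsto_sandwich[OF _ _ tendsto_const lim])
      (use mollify_diff(3)[OF f e(1)] in \<open>auto simp: w_def[abs_def] intro!: always_eventually\<close>)
qed

section \<open>Cutoffs and density of test functions in \<open>H1\<close>\<close>

lemma square_integrable_bounded_mult:
  fixes f :: "R3 \<Rightarrow> 'b::euclidean_space"
  assumes f: "square_integrable f" and [measurable]: "c \<in> borel_measurable borel" and c: "\<And>x. \<bar>c x\<bar> \<le> B"
  shows "square_integrable (\<lambda>x. c x *\<^sub>R f x)" "L2norm (\<lambda>x. c x *\<^sub>R f x) \<le> B * L2norm f"
proof -
  have B: "B \<ge> 0" using c[of 0] by linarith
  have le: "norm (c x *\<^sub>R f x) \<le> norm (B *\<^sub>R f x)" for x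
    using B c[of x] by (simp add: mult_right_mono)
  have [measurable]: "f \<in> borel_measurable borel" using f by auto
  show "square_integrable (\<lambda>x. c x *\<^sub>R f x)"
    by (rule square_integrable_bound[OF square_integrable_cmult[OF f, of B]]) (use le in auto)
  have "L2norm (\<lambda>x. c x *\<^sub>R f x) \<le> L2norm (\<lambda>x. B *\<^sub>R f x)"
    by (rule L2norm_mono[OF square_integrable_cmult[OF f, of B]]) (use le in auto)
  then show "L2norm (\<lambda>x. c x *\<^sub>R f x) \<le> B * L2norm f"
    using B by (simp add: L2norm_cmult)
qed

lemma square_integrable_mult_vector:
  fixes c :: "R3 \<Rightarrow> 'b::euclidean_space"
  assumes f: "square_integrable f" and [measurable]: "c \<in> borel_measurable borel" and c: "\<And>x. norm (c x) \<le> B"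
  shows "square_integrable (\<lambda>x. f x *\<^sub>R c x)" "L2norm (\<lambda>x. f x *\<^sub>R c x) \<le> B * L2norm f"
proof -
  have B: "B \<ge> 0" using c[of 0] norm_ge_zero[of "c 0"] by linarith
  have le: "norm (f x *\<^sub>R c x) \<le> norm (B *\<^sub>R f x)" for x
    using B mult_left_mono[OF c[of x], of "\<bar>f x\<bar>"] by (simp add: abs_mult mult.commute)
  have [measurable]: "f \<in> borel_measurable borel" using f by auto
  show "square_integrable (\<lambda>x. f x *\<^sub>R c x)"
    by (rule square_integrable_bound[OF square_integrable_cmult[OF f, of B]]) (use le in auto)
  have "L2norm (\<lambda>x. f x *\<^sub>R c x) \<le> L2norm (\<lambda>x. B *\<^sub>R f x)"
    by (rule L2norm_mono[OF square_integrable_cmult[OF f, of B]]) (use le in auto)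
  then show "L2norm (\<lambda>x. f x *\<^sub>R c x) \<le> B * L2norm f"
    using B L2norm_cmult[of B f] by simp
qed

text \<open>Insert \<open>c (e n *\<^sub>R x) *\<^sub>R f x\<close>: one difference is controlled by
  \<open>fn n x - f x\<close> since \<open>c\<close> is bounded by 1, the other tends to 0 by
  dominated convergence since \<open>c\<close> is continuous with \<open>c 0 = 1\<close>.\<close>

lemma cutoff_tendsto:
  fixes f :: "R3 \<Rightarrow> 'b::euclidean_space"
  assumes f: "square_integrable f" and c: "continuous_on UNIV c" "c 0 = 1" "\<And>x. \<bar>c x\<bar> \<le> 1"
    and e: "e \<longlonglongrightarrow> (0::real)"
    and fn: "\<And>n. square_integrable (fn n)" "(\<lambda>n. L2norm (\<lambda>x. fn n x - f x)) \<longlonglongrightarrow> 0"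
  shows "(\<lambda>n. L2norm (\<lambda>x. c (e n *\<^sub>R x) *\<^sub>R fn n x - f x)) \<longlonglongrightarrow> 0"
    and "\<And>n. square_integrable (\<lambda>x. c (e n *\<^sub>R x) *\<^sub>R fn n x)"
proof -
  have [measurable]: "c \<in> borel_measurable borel" by (rule borel_measurable_continuous_onI[OF c(1)])
  have [measurable]: "f \<in> borel_measurable borel" using f by auto
  note sq = square_integrable_bounded_mult[where B = 1]
  show s: "square_integrable (\<lambda>x. c (e n *\<^sub>R x) *\<^sub>R fn n x)" for n
    by (rule sq) (use fn c in auto)
  have s': "square_integrable (\<lambda>x. c (e n *\<^sub>R x) *\<^sub>R f x)" for n
    by (rule sq) (use f c in auto)
  have 1: "(\<lambda>n. L2norm (\<lambda>x. c (e n *\<^sub>R x) *\<^sub>R f x - f x)) \<longlonglongrightarrow> 0"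
  proof (rule L2norm_dominated_convergence[OF square_integrable_cmult[OF f, of 2]])
    have "(\<lambda>n. c (e n *\<^sub>R x)) \<longlonglongrightarrow> c (0 *\<^sub>R x)" for x
      by (intro continuous_on_tendsto_compose[OF c(1)] tendsto_intros e) auto
    then have "(\<lambda>n. c (e n *\<^sub>R x) *\<^sub>R f x - f x) \<longlonglongrightarrow> c (0 *\<^sub>R x) *\<^sub>R f x - f x" for x
      by (intro tendsto_intros)
    then show "AE x in lborel. (\<lambda>n. c (e n *\<^sub>R x) *\<^sub>R f x - f x) \<longlonglongrightarrow> 0"
      using c(2) by simp
    fix n x
    have "norm (c (e n *\<^sub>R x) *\<^sub>R f x - f x) = \<bar>c (e n *\<^sub>R x) - 1\<bar> * norm (f x)"
      by (metis norm_scaleR scaleR_left_diff_distrib scaleR_one)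
    also have "\<dots> \<le> 2 * norm (f x)"
      using c(3)[of "e n *\<^sub>R x"] by (intro mult_right_mono) auto
    finally show "norm (c (e n *\<^sub>R x) *\<^sub>R f x - f x) \<le> norm (2 *\<^sub>R f x)" by simp
  qed measurable
  have "L2norm (\<lambda>x. c (e n *\<^sub>R x) *\<^sub>R fn n x - f x) \<le>
      L2norm (\<lambda>x. fn n x - f x) + L2norm (\<lambda>x. c (e n *\<^sub>R x) *\<^sub>R f x - f x)" for n
  proof -
    have "L2norm (\<lambda>x. c (e n *\<^sub>R x) *\<^sub>R (fn n x - f x)) \<le> 1 * L2norm (\<lambda>x. fn n x - f x)"
      by (rule sq(2)[OF square_integrable_diff[OF fn(1) f]]) (use c in auto)
    then show ?thesis
      using L2norm_triangle_diff[OF s s' f, of n n] by (simp add: scaleR_diff_right)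
  qed
  then show "(\<lambda>n. L2norm (\<lambda>x. c (e n *\<^sub>R x) *\<^sub>R fn n x - f x)) \<longlonglongrightarrow> 0"
    by (intro Lim_null_comparison[OF always_eventually tendsto_add_zero[OF fn(2) 1]])
      (auto simp: L2norm_nonneg)
qed

definition cutoff :: "R3 \<Rightarrow> real" where
  "cutoff x = bump x / bump 0"

lemma bump_le: "bump x \<le> bump 0"
proof (cases "norm x < 1")
  case True
  then have "x \<bullet> x < 1" by (simp add: dot_square_norm abs_square_less_1)
  then show ?thesis
    by (simp add: bump_def flat_exp_def field_simps)
qed (simp add: bump_outside bump_nonneg)

lemma cutoff_props:
  "cutoff \<in> test_functions" "cutoff 0 = 1" "\<bar>cutoff x\<bar> \<le> 1" "0 \<le> cutoff x"
  using test_function_mult[OF bump_test smooth_const[of "1 / bump 0"]] bump_pos[of 0] bump_le[of x] bump_nonneg[of x]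
  by (auto simp: cutoff_def[abs_def])

text \<open>One parameter serves for both mollification and cutoff. Mollification commutes with the
  weak gradient, and the derivative that falls on the cutoff carries a factor \<open>e n\<close>, so
  the additional gradient term vanishes in the limit.\<close>

lemma test_functions_dense:
  assumes u: "square_integrable u" and g: "has_L2_weak_gradient u g"
  obtains v where "\<And>n. v n \<in> test_functions" "(\<lambda>n. L2norm (\<lambda>x. v n x - u x)) \<longlonglongrightarrow> 0"
    "(\<lambda>n. L2norm (\<lambda>x. grad (v n) x - g x)) \<longlonglongrightarrow> 0"
proof -
  define e where "e n = 1 / real (Suc n)" for n
  have e: "e n > 0" "e n \<noteq> 0" for n by (auto simp: e_def)
  have e0: "e \<longlonglongrightarrow> 0"
    unfolding e_def[abs_def] using LIMSEQ_inverse_real_of_nat by (simp add: inverse_eq_divide)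
  have gs: "square_integrable g" using g by (simp add: has_L2_weak_gradient_def)
  define v where "v n x = cutoff (e n *\<^sub>R x) * mollify (e n) u x" for n x
  have c: "smooth cutoff" "continuous_on UNIV cutoff"
    using cutoff_props(1) by (auto intro: test_function_smooth smooth_continuous_on)
  have vt: "v n \<in> test_functions" for n
    unfolding v_def[abs_def]
    using test_function_mult[OF test_function_affine[OF cutoff_props(1) e(2), of n 0] mollify_smooth[OF u e(1), of n]]
    by simp
  have mu: "square_integrable (mollify (e n) u)" "square_integrable (mollify (e n) g)" for n
    using square_integrable_add[OF mollify_diff(1)[OF u e(2)[of n]] u] square_integrable_add[OF mollify_diff(1)[OF gs
        e(2)[of n]] gs]
    by simp_all
  have mt: "(\<lambda>n. L2norm (\<lambda>x. mollify (e n) u x - u x)) \<longlonglongrightarrow> 0"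
     "(\<lambda>n. L2norm (\<lambda>x. mollify (e n) g x - g x)) \<longlonglongrightarrow> 0"
    by (rule mollify_tendsto[OF _ e(2) e0], rule u gs)+
  have l1: "(\<lambda>n. L2norm (\<lambda>x. v n x - u x)) \<longlonglongrightarrow> 0"
    using cutoff_tendsto(1)[OF u c(2) cutoff_props(2,3) e0 mu(1) mt(1)] by (simp add: v_def)
  have gv: "grad (v n) x = cutoff (e n *\<^sub>R x) *\<^sub>R mollify (e n) g x + e n *\<^sub>R (mollify (e n) u x *\<^sub>R grad cutoff (e n
      *\<^sub>R x))" for n x
  proof -
    have "grad (v n) x = cutoff (e n *\<^sub>R x) *\<^sub>R grad (mollify (e n) u) x + mollify (e n) u x *\<^sub>R grad (\<lambda>x. cutoff (e n
        *\<^sub>R x)) x"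
      unfolding v_def[abs_def]
      using grad_affine(1)[of cutoff "e n"
          x 0] smooth_differentiable[OF c(1)] smooth_differentiable[OF mollify_smooth[OF u e(1)]]
      by (intro grad_mult) auto
    also have "grad (\<lambda>x. cutoff (e n *\<^sub>R x)) x = e n *\<^sub>R grad cutoff (e n *\<^sub>R x)"
      using grad_affine(2)[of cutoff "e n" x 0] smooth_differentiable[OF c(1)] by simp
    finally show ?thesis
      by (simp add: mollify_grad[OF u g e(1)] mult.commute)
  qed
  obtain L where L: "L \<ge> 0" "\<And>x. norm (grad cutoff x) \<le> L" "\<And>x y. \<bar>cutoff x - cutoff y\<bar> \<le> L * norm (x - y)"
    by (rule test_function_Lipschitz[OF cutoff_props(1)]) blast
  have gm[measurable]: "grad cutoff \<in> borel_measurable borel"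
    by (intro borel_measurable_continuous_onI smooth_grad_continuous_on c)
  let ?a = "\<lambda>n x. cutoff (e n *\<^sub>R x) *\<^sub>R mollify (e n) g x"
  let ?b = "\<lambda>n x. e n *\<^sub>R (mollify (e n) u x *\<^sub>R grad cutoff (e n *\<^sub>R x))"
  have b: "square_integrable (?b n)" "L2norm (?b n) \<le> e n * (L * L2norm (mollify (e n) u))" for n
  proof -
    note * = square_integrable_mult_vector[OF mu(1), where B = L and c = "\<lambda>x. grad cutoff (e n *\<^sub>R x)" and n1 = n]
    show "square_integrable (?b n)"
      by (intro square_integrable_cmult *) (use L in auto)
    have "L2norm (\<lambda>x. mollify (e n) u x *\<^sub>R grad cutoff (e n *\<^sub>R x)) \<le> L * L2norm (mollify (e n) u)"
      by (intro *) (use L in auto)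
    then show "L2norm (?b n) \<le> e n * (L * L2norm (mollify (e n) u))"
      unfolding L2norm_cmult using e(1)[of n] by simp
  qed
  have a: "(\<lambda>n. L2norm (\<lambda>x. ?a n x - g x)) \<longlonglongrightarrow> 0" "\<And>n. square_integrable (?a n)"
    by (rule cutoff_tendsto[OF gs c(2) cutoff_props(2,3) e0 mu(2) mt(2)])+
  let ?h = "\<lambda>n. L2norm (\<lambda>x. ?a n x - g x) + e n * (L * (L2norm (\<lambda>x. mollify (e n) u x - u x) + L2norm u))"
  have le: "L2norm (\<lambda>x. grad (v n) x - g x) \<le> ?h n" for n
  proof -
    have "L2norm (\<lambda>x. grad (v n) x - g x) \<le> L2norm (\<lambda>x. ?a n x - g x) + L2norm (?b n)"
      using L2norm_triangle[OF square_integrable_diff[OF a(2) gs] b(1), of n n]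
      by (simp add: gv[abs_def] algebra_simps)
    also have "L2norm (mollify (e n) u) \<le> L2norm (\<lambda>x. mollify (e n) u x - u x) + L2norm u"
      using L2norm_triangle[OF square_integrable_diff[OF mu(1)[of n] u] u] by simp
    then have "L2norm (?b n) \<le> e n * (L * (L2norm (\<lambda>x. mollify (e n) u x - u x) + L2norm u))"
      using e(1)[of n] L(1) by (intro order_trans[OF b(2)] mult_left_mono) auto
    finally show ?thesis by simp
  qed
  have "?h \<longlonglongrightarrow> 0 + 0 * (L * (0 + L2norm u))"
    by (intro tendsto_intros a e0 mt)
  then have "?h \<longlonglongrightarrow> 0" by simp
  then have "(\<lambda>n. L2norm (\<lambda>x. grad (v n) x - g x)) \<longlonglongrightarrow> 0"
    by (rule Lim_null_comparison[rotated]) (use le in \<open>auto simp: L2norm_nonneg\<close>)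
  with vt l1 show ?thesis by (rule that)
qed

section \<open>Integration on \<open>\<real>\<^sup>3\<close>\<close>

text \<open>Layer cake: \<open>F r\<close> is the integral of \<open>k\<close> over \<open>{r..}\<close>, and the ball of radius \<open>s\<close> has volume
  \<open>4 * pi / 3 * s ^ 3\<close>.\<close>
lemma nn_integral_radial:
  fixes F k H :: "real \<Rightarrow> real"
  assumes F: "\<And>s. 0 \<le> s \<Longrightarrow> DERIV F s :> - k s" "(F \<longlongrightarrow> 0) at_top"
    and k: "\<And>s. 0 \<le> s \<Longrightarrow> 0 \<le> k s" and [measurable]: "k \<in> borel_measurable borel"
    and H: "\<And>s. 0 \<le> s \<Longrightarrow> DERIV H s :> k s * (4 * pi / 3 * s ^ 3)" "(H \<longlongrightarrow> T) at_top"
  shows "(\<integral>\<^sup>+x. ennreal (F (norm (x :: R3))) \<partial>lborel) = ennreal (T - H 0)"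
proof -
  have "(\<integral>\<^sup>+x. ennreal (F (norm (x :: R3))) \<partial>lborel) =
      (\<integral>\<^sup>+x. (\<integral>\<^sup>+s. ennreal (k s) * indicator {norm (x :: R3)..} s \<partial>lborel) \<partial>lborel)"
  proof (rule nn_integral_cong)
    fix x :: R3
    have "(\<integral>\<^sup>+s. ennreal (k s) * indicator {norm x..} s \<partial>lborel) = ennreal (0 - (- F (norm x)))"
    proof (rule nn_integral_FTC_atLeast[where F = "\<lambda>s. - F s"])
      fix s assume "norm x \<le> s"
      then have "0 \<le> s" using norm_ge_zero[of x] by linarith
      then show "DERIV (\<lambda>s. - F s) s :> k s" "0 \<le> k s"
        using DERIV_minus[OF F(1)] k by simp_all
    next
      show "((\<lambda>s. - F s) \<longlongrightarrow> 0) at_top"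
        using tendsto_minus[OF F(2)] by simp
    qed measurable
    then show "ennreal (F (norm x)) = (\<integral>\<^sup>+s. ennreal (k s) * indicator {norm x..} s \<partial>lborel)" by simp
  qed
  also have "\<dots> = (\<integral>\<^sup>+s. (\<integral>\<^sup>+x. ennreal (k s) * indicator {norm (x :: R3)..} s \<partial>lborel) \<partial>lborel)"
    by (rule lborel_pair.Fubini') (auto simp: split_beta' indicator_def atLeast_def)
  also have "\<dots> = (\<integral>\<^sup>+s. ennreal (k s * (4 * pi / 3 * s ^ 3)) * indicator {0..} s \<partial>lborel)"
  proof (rule nn_integral_cong)
    fix s :: real
    have "(\<integral>\<^sup>+x. ennreal (k s) * indicator {norm (x :: R3)..} s \<partial>lborel) =
        (\<integral>\<^sup>+x. ennreal (k s) * indicator (cball 0 s) (x :: R3) \<partial>lborel)"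
      by (rule nn_integral_cong) (auto simp: indicator_def)
    also have "\<dots> = ennreal (k s) * emeasure lborel (cball (0 :: R3) s)"
      by (simp add: nn_integral_cmult_indicator)
    also have "\<dots> = ennreal (k s * (4 * pi / 3 * s ^ 3)) * indicator {0..} s"
    proof (cases "s \<ge> 0")
      case True
      then show ?thesis
        using k[OF True] by (simp add: emeasure_cball eval_unit_ball_vol flip: ennreal_mult')
    qed simp
    finally show "(\<integral>\<^sup>+x. ennreal (k s) * indicator {norm (x :: R3)..} s \<partial>lborel) = \<dots>" .
  qed
  also have "\<dots> = ennreal (T - H 0)"
    by (rule nn_integral_FTC_atLeast) (use H k in auto)
  finally show ?thesis .
qed

text \<open>Layer cake with a closed primitive: \<open>s ^ 3 / (1 + s) ^ 5\<close> integrates to a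
  multiple of \<open>(s / (1 + s)) ^ 4\<close>, written below as a power of
  \<open>1 - inverse (1 + s)\<close> to make the limit visible. The order 4 is the total decay of
  the products met later: 1 + 3 for potential times Hessian, 2 + 2 for two fields.\<close>

lemma integrable_decay4: "integrable lborel (\<lambda>x::R3. 1 / (1 + norm x) ^ 4)"
proof -
  have i: "((\<lambda>s::real. inverse (1 + s)) \<longlongrightarrow> 0) at_top"
    by (rule tendsto_inverse_0_at_top filterlim_tendsto_add_at_top[OF tendsto_const filterlim_ident])+
  have "(\<integral>\<^sup>+x. ennreal (inverse (1 + norm (x :: R3)) ^ 4) \<partial>lborel)
      = ennreal (4 * pi / 3 - 4 * pi / 3 * (1 - inverse (1 + 0)) ^ 4)"
  proof (rule nn_integral_radial[where k = "\<lambda>s. 4 * inverse (1 + s) ^ 5"])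
    fix s :: real assume s: "0 \<le> s"
    then have s1: "1 - inverse (1 + s) = s * inverse (1 + s)" by (simp add: field_simps)
    show "DERIV (\<lambda>s. inverse (1 + s) ^ 4) s :> - (4 * inverse (1 + s) ^ 5)"
      using s by (auto intro!: derivative_eq_intros simp: eval_nat_numeral)
    have "DERIV (\<lambda>s. 4 * pi / 3 * (1 - inverse (1 + s)) ^ 4) s :> 4 * pi / 3 * (4 * (1 - inverse (1 + s)) ^ 3 *
        (inverse (1 + s))\<^sup>2)"
      using s by (auto intro!: derivative_eq_intros simp: eval_nat_numeral)
    then show "DERIV (\<lambda>s. 4 * pi / 3 * (1 - inverse (1 + s)) ^ 4) s :> 4 * inverse (1 + s) ^ 5 * (4 * pi / 3 * s ^ 3)"
      unfolding s1 by (rule DERIV_cong) (simp add: eval_nat_numeral)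
  next
    show "((\<lambda>s::real. inverse (1 + s) ^ 4) \<longlongrightarrow> 0) at_top"
      using tendsto_power[OF i, of 4] by simp
    show "((\<lambda>s::real. 4 * pi / 3 * (1 - inverse (1 + s)) ^ 4) \<longlongrightarrow> 4 * pi / 3) at_top"
      using tendsto_mult[OF tendsto_const tendsto_power[OF tendsto_diff[OF tendsto_const i]], of "4 * pi / 3" 1 4] by simp
  qed auto
  then show ?thesis
    by (intro integrableI_bounded) (auto simp: inverse_eq_divide power_one_over)
qed

lemma integrable_decay:
  fixes f :: "R3 \<Rightarrow> 'b::{banach, second_countable_topology}"
  assumes "f \<in> borel_measurable borel" "\<And>x. norm (f x) \<le> C / (1 + norm x) ^ 4"
  shows "integrable lborel f"
proof (rule Bochner_Integration.integrable_bound[OF integrable_mult_right[OF integrable_decay4, of C]])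
  show "AE x in lborel. norm (f x) \<le> norm (C * (1 / (1 + norm x) ^ 4))"
    using assms(2) by (auto intro!: always_eventually intro: order_trans[OF _ abs_ge_self] simp del: abs_divide)
qed (use assms in auto)

text \<open>By translation invariance, the integral over \<open>x\<close> of \<open>f (x + e) - f x\<close> vanishes; by Fubini it is
  the integral of the directional derivative of \<open>f\<close>.\<close>
lemma integral_gradient_eq_0_integrable:
  fixes f :: "'a::euclidean_space \<Rightarrow> real"
  assumes f: "\<And>x. GDERIV f x :> G x" and G: "continuous_on UNIV G"
    and fi: "integrable lborel f" and Gi: "integrable lborel (\<lambda>x. G x \<bullet> e)"
  shows "(LINT x|lborel. G x \<bullet> e) = 0"
proof -
  have [measurable]: "G \<in> borel_measurable borel" by (rule borel_measurable_continuous_onI[OF G])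
  define P where "P s x = indicator {0..1::real} s * (G (x + s *\<^sub>R e) \<bullet> e)" for s x
  have [measurable]: "case_prod P \<in> borel_measurable (lborel \<Otimes>\<^sub>M lborel)"
    unfolding P_def by measurable
  have xi: "integrable lborel (\<lambda>x. G (x + s *\<^sub>R e) \<bullet> e)" for s
    using Gi integrable_translate(1)[of "\<lambda>x. G x \<bullet> e" "s *\<^sub>R e"] by simp
  have absi: "(LINT x|lborel. \<bar>G (x + s *\<^sub>R e) \<bullet> e\<bar>) = (LINT x|lborel. \<bar>G x \<bullet> e\<bar>)" for s
    using integral_translate(1)[of "\<lambda>x. \<bar>G x \<bullet> e\<bar>" "s *\<^sub>R e"] by simp
  have Pint: "integrable (lborel \<Otimes>\<^sub>M lborel) (case_prod P)"
  proof (rule lborel_pair.Fubini_integrable)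
    show "integrable lborel (\<lambda>s. LINT x|lborel. norm (case_prod P (s, x)))"
      by (simp add: P_def abs_mult absi)
    show "AE s in lborel. integrable lborel (\<lambda>x. case_prod P (s, x))"
      using xi by (simp add: P_def)
  qed measurable
  have "(LINT s|lborel. P s x) = f (x + e) - f x" for x
  proof -
    have "(LINT s|lborel. (G (x + s *\<^sub>R e) \<bullet> e) * indicator {0..1} s) = f (x + 1 *\<^sub>R e) - f (x + 0 *\<^sub>R e)"
    proof (rule integral_FTC_Icc_real)
      fix s :: real
      have "((\<lambda>s. f (x + s *\<^sub>R e)) has_derivative (\<lambda>h. (h *\<^sub>R e) \<bullet> G (x + s *\<^sub>R e))) (at s)"
        by (rule has_derivative_compose[where f = "\<lambda>s. x + s *\<^sub>R e" and f' = "\<lambda>h. h *\<^sub>R e"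
            and g' = "\<lambda>h. h \<bullet> G (x + s *\<^sub>R e)"])
          (use f in \<open>auto intro!: derivative_eq_intros simp: gderiv_def\<close>)
      then show "DERIV (\<lambda>s. f (x + s *\<^sub>R e)) s :> G (x + s *\<^sub>R e) \<bullet> e"
        by (simp add: has_field_derivative_def inner_commute mult_commute_abs)
      show "isCont (\<lambda>s. G (x + s *\<^sub>R e) \<bullet> e) s"
        by (intro continuous_intros continuous_on_interior[of UNIV] isCont_o2[of _ _ G])
          (use G in \<open>auto simp: continuous_on_eq_continuous_at\<close>)
    qed simp
    then show ?thesis by (simp add: P_def mult.commute)
  qed
  then have "(LINT x|lborel. f (x + e) - f x) = (LINT x|lborel. LINT s|lborel. P s x)"
    by simp
  also have "\<dots> = (LINT s|lborel. LINT x|lborel. P s x)"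
    by (rule lborel_pair.Fubini_integral[OF Pint])
  also have "\<dots> = (LINT s|lborel. indicator {0..1::real} s * (LINT x|lborel. G x \<bullet> e))"
    using integral_translate(1)[of "\<lambda>x. G x \<bullet> e"] by (simp add: P_def)
  also have "\<dots> = (LINT x|lborel. G x \<bullet> e)"
    by simp
  also have "(LINT x|lborel. f (x + e) - f x) = 0"
    using fi integrable_translate(1)[of f e] integral_translate(1)[of f e] by simp
  finally show ?thesis by simp
qed

text \<open>Integrability of \<open>f\<close> itself would be too much to ask: a potential times a
  field decays only like \<open>norm x\<close> to the power -3, which is not integrable at infinity.
  The cutoffs \<open>1 / (1 + d n * (x \<bullet> x))\<close> have gradients bounded by a multiple of
  \<open>1 / (1 + norm x)\<close> uniformly in \<open>n\<close> and tending to 0 pointwise, so their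
  error term vanishes by dominated convergence.\<close>

lemma integral_gradient_eq_0:
  fixes f :: "'a::euclidean_space \<Rightarrow> real"
  assumes f: "\<And>x. GDERIV f x :> G x" and G: "continuous_on UNIV G"
    and fi: "integrable lborel (\<lambda>x. f x / (1 + norm x))" and Gi: "integrable lborel (\<lambda>x. G x \<bullet> e)"
  shows "(LINT x|lborel. G x \<bullet> e) = 0"
proof -
  define d where "d n = 1 / real (Suc n)" for n
  have d: "0 < d n" "d n \<le> 1" for n by (auto simp: d_def)
  have d0: "d \<longlonglongrightarrow> 0"
    unfolding d_def[abs_def] using LIMSEQ_inverse_real_of_nat by (simp add: inverse_eq_divide)
  have fc: "continuous_on UNIV f"
    using f by (auto simp: gderiv_def continuous_on_eq_continuous_at intro: has_derivative_continuous)
  have [measurable]: "f \<in> borel_measurable borel" "G \<in> borel_measurable borel"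
    by (rule borel_measurable_continuous_onI, fact)+
  define c where "c n x = 1 / (1 + d n * (x \<bullet> x))" for n and x :: 'a
  have pos: "1 + d n * (x \<bullet> x) \<ge> 1" for n x using d[of n] by simp
  have c1: "\<bar>c n x\<bar> \<le> 1" "0 \<le> c n x" for n x using pos[of n x] by (auto simp: c_def)
  have cd: "GDERIV (c n) x :> (- 2 * d n * (c n x)\<^sup>2) *\<^sub>R x" for n x
  proof -
    have "GDERIV (\<lambda>x. 1 + d n * (x \<bullet> x)) x :> (2 * d n) *\<^sub>R x"
      unfolding gderiv_def by (auto intro!: derivative_eq_intros simp: inner_commute)
    moreover have "DERIV (\<lambda>t. 1 / t) (1 + d n * (x \<bullet> x)) :> - (c n x)\<^sup>2"
      using pos[of n x] by (auto intro!: derivative_eq_intros simp: c_def power2_eq_square)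
    ultimately have "GDERIV (\<lambda>x. 1 / (1 + d n * (x \<bullet> x))) x :> (- (c n x)\<^sup>2) *\<^sub>R ((2 * d n) *\<^sub>R x)"
      by (rule GDERIV_DERIV_compose)
    then show ?thesis by (simp add: c_def[abs_def] mult.commute mult.left_commute)
  qed
  have [measurable]: "c n \<in> borel_measurable borel" for n
    unfolding c_def by measurable
  have cc: "continuous_on UNIV (c n)" for n
    using cd by (auto simp: gderiv_def continuous_on_eq_continuous_at intro: has_derivative_continuous)
  \<comment> \<open>The bound is uniform in \<open>n\<close> because \<open>d n \<le> 1\<close>
    gives \<open>d n * norm x \<le> 1 + d n * (norm x)\<^sup>2\<close>, so the denominator of
    \<open>c n\<close> absorbs \<open>d n * norm x * (1 + norm x)\<close>.\<close>
  have cb: "\<bar>2 * d n * (c n x)\<^sup>2 * (x \<bullet> e)\<bar> \<le> 4 * norm e / (1 + norm x)" for n x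
  proof -
    have dx: "d n * norm x \<le> 1 + d n * (norm x)\<^sup>2"
    proof -
      have "norm x \<le> 1 + (norm x)\<^sup>2"
        using sum_squares_bound[of 1 "norm x"] norm_ge_zero[of x] unfolding one_power2 by linarith
      then have "d n * norm x \<le> d n * (1 + (norm x)\<^sup>2)" using d[of n] by (intro mult_left_mono) auto
      then show ?thesis using d[of n] by (simp add: algebra_simps)
    qed
    have "2 * d n * norm x * (1 + norm x) \<le> 4 * (1 + d n * (x \<bullet> x))"
      using dx d[of n] by (simp add: dot_square_norm algebra_simps power2_eq_square)
    then have "2 * d n * norm x * (1 + norm x) / (1 + d n * (x \<bullet> x)) \<le> 4"
      using pos[of n x] by (subst pos_divide_le_eq) auto
    moreover have "2 * d n * c n x * norm x * (1 + norm x) = 2 * d n * norm x * (1 + norm x) / (1 + d n * (x \<bullet> x))"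
      by (simp add: c_def)
    moreover have "0 < 1 + norm x"
      using norm_ge_zero[of x] by linarith
    ultimately have "2 * d n * c n x * norm x \<le> 4 / (1 + norm x)"
      by (subst pos_le_divide_eq) auto
    moreover have "(c n x)\<^sup>2 \<le> c n x"
      using c1[of n x] by (simp add: power2_eq_square mult_left_le)
    then have "2 * d n * (c n x)\<^sup>2 * norm x \<le> 2 * d n * c n x * norm x"
      using d[of n] by (intro mult_right_mono mult_left_mono) auto
    ultimately have *: "2 * d n * (c n x)\<^sup>2 * norm x \<le> 4 / (1 + norm x)" by linarith
    have "\<bar>2 * d n * (c n x)\<^sup>2 * (x \<bullet> e)\<bar> \<le> 2 * d n * (c n x)\<^sup>2 * (norm x * norm e)"
      using d[of n] by (simp add: abs_mult mult_left_mono Cauchy_Schwarz_ineq2)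
    also have "\<dots> \<le> 4 / (1 + norm x) * norm e"
      using mult_right_mono[OF *, of "norm e"] by (simp add: mult.assoc)
    finally show ?thesis by simp
  qed
  let ?r = "\<lambda>n x. f x * (2 * d n * (c n x)\<^sup>2 * (x \<bullet> e))"
  have r: "\<bar>?r n x\<bar> \<le> norm (4 * norm e * (f x / (1 + norm x)))" for n x
    using mult_left_mono[OF cb[of n x], of "\<bar>f x\<bar>"] by (simp add: abs_mult mult.commute)
  have ri: "integrable lborel (?r n)" for n
    by (rule Bochner_Integration.integrable_bound[OF integrable_mult_right[OF fi, of "4 * norm e"]])
      (use r in auto)
  have ci: "integrable lborel (\<lambda>x. c n x * (G x \<bullet> e))" for n
    by (rule Bochner_Integration.integrable_bound[OF Gi])
      (auto simp: abs_mult intro!: mult_left_le_one_le c1)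
  have eq: "(LINT x|lborel. c n x * (G x \<bullet> e)) = (LINT x|lborel. ?r n x)" for n
  proof -
    have "(LINT x|lborel. (f x *\<^sub>R ((- 2 * d n * (c n x)\<^sup>2) *\<^sub>R x) + c n x *\<^sub>R G x) \<bullet> e) = 0"
    proof (rule integral_gradient_eq_0_integrable)
      show "GDERIV (\<lambda>x. f x * c n x) x :> f x *\<^sub>R ((- 2 * d n * (c n x)\<^sup>2) *\<^sub>R x) + c n x *\<^sub>R G x" for x
        by (rule GDERIV_mult[OF f cd])
      show "continuous_on UNIV (\<lambda>x. f x *\<^sub>R ((- 2 * d n * (c n x)\<^sup>2) *\<^sub>R x) + c n x *\<^sub>R G x)"
        by (intro continuous_intros fc cc G)
      have "\<bar>c n x\<bar> \<le> 2 / d n / (1 + norm x)" for x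
      proof -
        have "(1 + norm x) * d n \<le> 2 * (1 + d n * (x \<bullet> x))"
        proof -
          have "1 + norm x \<le> 2 + 2 * (norm x)\<^sup>2"
            using sum_squares_bound[of 1 "norm x"] zero_le_power2[of "norm x"] norm_ge_zero[of x]
            unfolding one_power2 by linarith
          then have "d n * (1 + norm x) \<le> d n * (2 + 2 * (norm x)\<^sup>2)" using d[of n] by (intro mult_left_mono) auto
          then show ?thesis using d[of n] by (simp add: algebra_simps dot_square_norm)
        qed
        then have "(1 + norm x) * d n / (1 + d n * (x \<bullet> x)) \<le> 2"
          using pos[of n x] by (subst pos_divide_le_eq) auto
        then have "c n x * (1 + norm x) * d n \<le> 2"
          by (simp add: c_def)
        moreover have "0 < 1 + norm x"
          using norm_ge_zero[of x] by linarith
        ultimately show ?thesis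
          using d[of n] c1(2)[of n x] by (simp add: pos_le_divide_eq mult_ac)
      qed
      then have "\<bar>f x * c n x\<bar> \<le> norm (2 / d n * (f x / (1 + norm x)))" for x
        using mult_left_mono[of "\<bar>c n x\<bar>" "2 / d n / (1 + norm x)" "\<bar>f x\<bar>"] d[of n]
        by (simp add: abs_mult mult.commute)
      then show "integrable lborel (\<lambda>x. f x * c n x)"
        by (intro Bochner_Integration.integrable_bound[OF integrable_mult_right[OF fi, of "2 / d n"]]) auto
      show "integrable lborel (\<lambda>x. (f x *\<^sub>R ((- 2 * d n * (c n x)\<^sup>2) *\<^sub>R x) + c n x *\<^sub>R G x) \<bullet> e)"
        using Bochner_Integration.integrable_diff[OF ci ri, of n n] by (simp add: inner_add_left algebra_simps)
    qed
    moreover have "(f x *\<^sub>R ((- 2 * d n * (c n x)\<^sup>2) *\<^sub>R x) + c n x *\<^sub>R G x) \<bullet> e = c n x * (G x \<bullet> e) - ?r n x" for x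
      by (simp add: inner_add_left algebra_simps)
    ultimately show ?thesis using ci ri by simp
  qed
  have ct: "(\<lambda>n. c n x) \<longlonglongrightarrow> 1" for x
  proof -
    have "(\<lambda>n. 1 / (1 + d n * (x \<bullet> x))) \<longlonglongrightarrow> 1 / (1 + 0 * (x \<bullet> x))"
      by (intro tendsto_intros d0) auto
    then show ?thesis by (simp add: c_def)
  qed
  have "(\<lambda>n. LINT x|lborel. c n x * (G x \<bullet> e)) \<longlonglongrightarrow> (LINT x|lborel. G x \<bullet> e)"
  proof (rule integral_dominated_convergence[OF _ _ integrable_norm[OF Gi]])
    show "AE x in lborel. (\<lambda>n. c n x * (G x \<bullet> e)) \<longlonglongrightarrow> G x \<bullet> e"
      using tendsto_mult[OF ct tendsto_const] by fastforce
  qed (auto simp: abs_mult intro!: mult_left_le_one_le c1)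
  moreover have "(\<lambda>n. LINT x|lborel. ?r n x) \<longlonglongrightarrow> (LINT x|(lborel :: 'a measure). 0)"
  proof (rule integral_dominated_convergence[OF _ _ integrable_norm[OF integrable_mult_right[OF fi, of "4 * norm e"]]])
    have "(\<lambda>n. ?r n x) \<longlonglongrightarrow> f x * (2 * 0 * 1\<^sup>2 * (x \<bullet> e))" for x
      by (intro tendsto_intros d0 ct)
    then show "AE x in lborel. (\<lambda>n. ?r n x) \<longlonglongrightarrow> 0" by simp
  qed (use r in auto)
  ultimately show ?thesis
    unfolding eq using LIMSEQ_unique by fastforce
qed

section \<open>The regularised Newton kernel\<close>

text \<open>The softened distance. Of the functions built on it, \<open>reg_kernel\<close> is the
  softened Newton kernel, \<open>reg_field\<close> its gradient, and \<open>reg_delta\<close> minus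
  its Laplacian: a probability density (Plummer's profile) that concentrates at the origin as
  \<open>e\<close> tends to 0.\<close>

definition reg_norm :: "real \<Rightarrow> R3 \<Rightarrow> real" where
  "reg_norm e x = sqrt (x \<bullet> x + e\<^sup>2)"

definition reg_kernel :: "real \<Rightarrow> R3 \<Rightarrow> real" where
  "reg_kernel e x = 1 / (4 * pi * reg_norm e x)"

definition reg_field :: "real \<Rightarrow> R3 \<Rightarrow> R3" where
  "reg_field e x = (- 1 / (4 * pi * reg_norm e x ^ 3)) *\<^sub>R x"

definition reg_delta :: "real \<Rightarrow> R3 \<Rightarrow> real" where
  "reg_delta e x = 3 * e\<^sup>2 / (4 * pi * reg_norm e x ^ 5)"

lemma reg_norm_square: "(reg_norm e x)\<^sup>2 = x \<bullet> x + e\<^sup>2"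
  by (simp add: reg_norm_def)

lemma reg_norm_ge: "norm x \<le> reg_norm e x" "\<bar>e\<bar> \<le> reg_norm e x"
  by (auto simp: reg_norm_def norm_eq_sqrt_inner intro: real_le_rsqrt)

lemma reg_norm_pos: "e > 0 \<Longrightarrow> reg_norm e x > 0"
  using reg_norm_ge(2)[of e x] by linarith

lemma reg_norm_GDERIV:
  assumes "e > 0" shows "GDERIV (reg_norm e) x :> (1 / reg_norm e x) *\<^sub>R x"
proof -
  have pos: "x \<bullet> x + e\<^sup>2 > 0"
    using assms by (simp add: add_nonneg_pos)
  have "GDERIV (\<lambda>x. x \<bullet> x + e\<^sup>2) x :> 2 *\<^sub>R x"
    unfolding gderiv_def by (auto intro!: derivative_eq_intros simp: inner_commute)
  from GDERIV_DERIV_compose[OF this DERIV_real_sqrt[OF pos]] show ?thesis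
    unfolding reg_norm_def[abs_def] by (rule GDERIV_subst) (simp add: inverse_eq_divide)
qed

lemma reg_norm_continuous: "e > 0 \<Longrightarrow> continuous_on UNIV (reg_norm e)"
  unfolding reg_norm_def by (intro continuous_intros)

lemma reg_norm_power_GDERIV:
  assumes "e > 0"
  shows "GDERIV (\<lambda>x. 1 / reg_norm e x ^ k) x :> (- (real k / reg_norm e x ^ (k + 2))) *\<^sub>R x"
proof -
  let ?r = "reg_norm e x"
  have r: "?r > 0" using assms by (rule reg_norm_pos)
  have "DERIV (\<lambda>t. inverse t ^ k) ?r :> of_nat k * (- (inverse ?r ^ Suc (Suc 0)) * inverse ?r ^ (k - Suc 0))"
    using r by (intro DERIV_power DERIV_inverse) auto
  also have "of_nat k * (- (inverse ?r ^ Suc (Suc 0)) * inverse ?r ^ (k - Suc 0)) = - (real k / ?r ^ (k + 1))"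
    by (cases k) (simp_all add: divide_inverse power_inverse)
  finally have "DERIV (\<lambda>t. 1 / t ^ k) ?r :> - (real k / ?r ^ (k + 1))"
    by (simp add: divide_inverse power_inverse)
  from GDERIV_DERIV_compose[OF reg_norm_GDERIV[OF assms] this] show ?thesis
    by (rule GDERIV_subst) simp
qed

lemma reg_kernel_GDERIV:
  assumes "e > 0" shows "GDERIV (reg_kernel e) x :> reg_field e x"
proof -
  have "GDERIV (\<lambda>x. 1 / (4 * pi) * (1 / reg_norm e x ^ 1)) x :> (1 / (4 * pi)) *\<^sub>R ((- (real 1 / reg_norm e x ^ (1 +
      2))) *\<^sub>R x) + (1 / reg_norm e x ^ 1) *\<^sub>R 0"
    by (rule GDERIV_mult[OF GDERIV_const reg_norm_power_GDERIV[OF assms]])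
  then show ?thesis
    by (simp add: reg_kernel_def[abs_def] reg_field_def eval_nat_numeral)
qed

lemma nth_GDERIV: "GDERIV (\<lambda>x::real^'n. x $ i) x :> axis i 1"
  by (auto simp: gderiv_def inner_axis intro!: bounded_linear_imp_has_derivative bounded_linear_vec_nth)

lemma reg_field_nth_GDERIV:
  assumes "e > 0"
  shows "GDERIV (\<lambda>x. reg_field e x $ i) x :>
    (1 / (4 * pi)) *\<^sub>R ((3 * x $ i / reg_norm e x ^ 5) *\<^sub>R x - (1 / reg_norm e x ^ 3) *\<^sub>R axis i 1)"
proof -
  have "GDERIV (\<lambda>x. (- 1 / (4 * pi)) * ((1 / reg_norm e x ^ 3) * x $ i)) x :>
     (- 1 / (4 * pi)) *\<^sub>R ((1 / reg_norm e x ^ 3) *\<^sub>R axis i 1 + x $ i *\<^sub>R ((- (real 3 / reg_norm e x ^ (3 + 2))) *\<^sub>R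
         x)) + ((1 / reg_norm e x ^ 3) * x $ i) *\<^sub>R 0"
    by (rule GDERIV_mult[OF GDERIV_const GDERIV_mult[OF reg_norm_power_GDERIV[OF assms] nth_GDERIV]])
  then show ?thesis
    unfolding reg_field_def by (simp add: algebra_simps)
qed

text \<open>The dimension enters here: the three axes contribute \<open>3 / reg_norm e x ^ 3\<close>
  in total, which cancels against \<open>3 * (x \<bullet> x) / reg_norm e x ^ 5\<close> up to the
  term with \<open>e\<^sup>2\<close>.\<close>

lemma reg_field_divergence:
  assumes "e > 0"
  shows "(\<Sum>i\<in>UNIV. ((1 / (4 * pi)) *\<^sub>R ((3 * x $ i / reg_norm e x ^ 5) *\<^sub>R x - (1 / reg_norm e x ^ 3) *\<^sub>R axis i 1)) $
      i) = - reg_delta e x"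
proof -
  let ?r = "reg_norm e x"
  have r: "?r > 0" using assms by (rule reg_norm_pos)
  have xx: "x $ 1 * x $ 1 + x $ 2 * x $ 2 + x $ 3 * x $ 3 = ?r\<^sup>2 - e\<^sup>2"
    by (simp add: reg_norm_square inner_vec_def sum_3)
  have "(\<Sum>i\<in>UNIV. ((1 / (4 * pi)) *\<^sub>R ((3 * x $ i / ?r ^ 5) *\<^sub>R x - (1 / ?r ^ 3) *\<^sub>R axis i 1)) $ i)
     = 1 / (4 * pi) * (3 / ?r ^ 5 * (x $ 1 * x $ 1 + x $ 2 * x $ 2 + x $ 3 * x $ 3) - 3 / ?r ^ 3)"
    by (simp add: sum_3 algebra_simps add_divide_distrib)
  also have "\<dots> = - reg_delta e x"
    unfolding xx using r by (simp add: reg_delta_def field_simps eval_nat_numeral)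
  finally show ?thesis .
qed

lemma reg_field_continuous: "e > 0 \<Longrightarrow> continuous_on UNIV (reg_field e)"
  unfolding reg_field_def using reg_norm_pos[of e]
  by (intro continuous_intros reg_norm_continuous) (auto simp: less_imp_neq[symmetric])

lemma reg_measurable[measurable]:
  "reg_norm e \<in> borel_measurable borel" "reg_kernel e \<in> borel_measurable borel"
  "reg_field e \<in> borel_measurable borel" "reg_delta e \<in> borel_measurable borel"
proof -
  show [measurable]: "reg_norm e \<in> borel_measurable borel"
    unfolding reg_norm_def[abs_def] by measurable
  show "reg_kernel e \<in> borel_measurable borel" "reg_field e \<in> borel_measurable borel" "reg_delta e \<in> borel_measurable borel"
    unfolding reg_kernel_def[abs_def] reg_field_def[abs_def] reg_delta_def[abs_def] by measurable
qed

lemma reg_norm_decay: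
  assumes e: "e > 0"
  shows "1 / reg_norm e x \<le> (1 / e + 1) / (1 + norm x)"
proof -
  have "1 + norm x \<le> (1 / e + 1) * reg_norm e x"
  proof -
    have "1 \<le> 1 / e * reg_norm e x" using e reg_norm_ge(2)[of e x] by (simp add: field_simps)
    then show ?thesis using reg_norm_ge(1)[of x e] by (simp add: algebra_simps)
  qed
  moreover have "0 < 1 + norm x" using norm_ge_zero[of x] by linarith
  ultimately show ?thesis
    using reg_norm_pos[OF e, of x] by (simp add: pos_divide_le_eq pos_le_divide_eq mult_ac)
qed

lemma reg_norm_decay_power:
  assumes e: "e > 0"
  shows "1 / reg_norm e x ^ k \<le> (1 / e + 1) ^ k / (1 + norm x) ^ k"
  using power_mono[OF reg_norm_decay[OF e, of x], of k] reg_norm_pos[OF e, of x]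
  by (simp add: power_one_over power_divide)

lemma reg_field_norm_le: "e > 0 \<Longrightarrow> norm (reg_field e x) \<le> 1 / reg_norm e x ^ 2"
proof -
  assume e: "e > 0"
  let ?r = "reg_norm e x"
  have r: "?r > 0" using e by (rule reg_norm_pos)
  have pi: "1 \<le> 4 * pi" using pi_gt3 by simp
  have "norm (reg_field e x) = norm x / (4 * pi * ?r ^ 3)"
    using r by (simp add: reg_field_def)
  also have "\<dots> \<le> ?r / (1 * ?r ^ 3)"
    using r pi reg_norm_ge(1)[of x e] by (intro frac_le mult_right_mono) auto
  also have "\<dots> = 1 / ?r ^ 2"
    using r by (simp add: eval_nat_numeral)
  finally show ?thesis .
qed

lemma reg_kernel_le: "e > 0 \<Longrightarrow> 0 \<le> reg_kernel e x \<and> reg_kernel e x \<le> 1 / reg_norm e x"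
proof -
  assume e: "e > 0"
  have "1 \<le> 4 * pi" using pi_gt3 by simp
  then show ?thesis
    using reg_norm_pos[OF e, of x] unfolding reg_kernel_def
    by (auto intro!: frac_le mult_right_mono[of 1, simplified])
qed

lemma reg_field_deriv_norm_le:
  assumes e: "e > 0"
  shows "norm ((1 / (4 * pi)) *\<^sub>R ((3 * x $ i / reg_norm e x ^ 5) *\<^sub>R x - (1 / reg_norm e x ^ 3) *\<^sub>R axis i 1))
      \<le> 4 / reg_norm e x ^ 3"
proof -
  let ?r = "reg_norm e x"
  have r: "?r > 0" using e by (rule reg_norm_pos)
  have pi: "1 / (4 * pi) \<le> 1" using pi_gt3 by simp
  have "norm ((3 * x $ i / ?r ^ 5) *\<^sub>R x) \<le> 3 / ?r ^ 3"
  proof -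
    have "\<bar>x $ i\<bar> * norm x \<le> ?r * ?r"
      using component_le_norm_cart[of x i] reg_norm_ge(1)[of x e] r by (intro mult_mono) auto
    then have "3 * (\<bar>x $ i\<bar> * norm x) / ?r ^ 5 \<le> 3 * (?r * ?r) / ?r ^ 5"
      using r by (intro divide_right_mono mult_left_mono) auto
    also have "\<dots> = 3 / ?r ^ 3" using r by (simp add: eval_nat_numeral)
    finally show ?thesis using r by (simp add: abs_mult)
  qed
  moreover have "norm ((1 / ?r ^ 3) *\<^sub>R (axis i 1 :: R3)) = 1 / ?r ^ 3"
    using r by simp
  ultimately have *: "norm ((3 * x $ i / ?r ^ 5) *\<^sub>R x - (1 / ?r ^ 3) *\<^sub>R axis i 1) \<le> 4 / ?r ^ 3"
    using norm_triangle_ineq4[of "(3 * x $ i / ?r ^ 5) *\<^sub>R x" "(1 / ?r ^ 3) *\<^sub>R axis i 1"] by linarith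
  have "norm ((1 / (4 * pi)) *\<^sub>R ((3 * x $ i / ?r ^ 5) *\<^sub>R x - (1 / ?r ^ 3) *\<^sub>R axis i 1)) \<le>
     1 * norm ((3 * x $ i / ?r ^ 5) *\<^sub>R x - (1 / ?r ^ 3) *\<^sub>R axis i 1)"
    unfolding norm_scaleR using pi by (intro mult_right_mono) auto
  with * show ?thesis by simp
qed

lemma reg_field_square_integrable:
  assumes e: "e > 0" shows "square_integrable (reg_field e)"
proof -
  have "integrable lborel (\<lambda>x. (norm (reg_field e x))\<^sup>2)"
  proof (rule integrable_decay)
    fix x
    have "(norm (reg_field e x))\<^sup>2 \<le> (1 / reg_norm e x ^ 2)\<^sup>2"
      by (intro power_mono reg_field_norm_le e) simp
    also have "\<dots> = 1 / reg_norm e x ^ 4" by (simp add: power_divide flip: power_mult)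
    also have "\<dots> \<le> (1 / e + 1) ^ 4 / (1 + norm x) ^ 4" by (rule reg_norm_decay_power[OF e])
    finally show "norm ((norm (reg_field e x))\<^sup>2) \<le> (1 / e + 1) ^ 4 / (1 + norm x) ^ 4" by simp
  qed measurable
  then show ?thesis by (simp add: square_integrable_def)
qed

lemma reg_delta_nonneg: "e > 0 \<Longrightarrow> 0 \<le> reg_delta e x"
  using reg_norm_pos[of e x] by (simp add: reg_delta_def)

text \<open>Substituting \<open>e *\<^sub>R x\<close> turns integrals against
  \<open>reg_delta e\<close> into integrals against the fixed density \<open>reg_delta 1\<close>, so
  that the limit in \<open>e\<close> becomes dominated convergence.\<close>

lemma reg_delta_scale:
  assumes e: "e > 0" shows "reg_delta e (e *\<^sub>R x) * e ^ 3 = reg_delta 1 x"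
proof -
  have "reg_norm e (e *\<^sub>R x) = sqrt (e\<^sup>2 * (x \<bullet> x + 1\<^sup>2))"
    by (simp add: reg_norm_def algebra_simps power2_eq_square)
  also have "\<dots> = e * reg_norm 1 x"
    using e by (simp add: reg_norm_def real_sqrt_mult)
  finally show ?thesis
    using e by (simp add: reg_delta_def power_mult_distrib eval_nat_numeral)
qed

text \<open>The weight \<open>1 + norm x\<close> is the loss in
  \<open>norm_mult_reg_kernel_le\<close>. The density decays with order 5, leaving the integrable
  order 4.\<close>

lemma reg_delta_weight_integrable: "integrable lborel (\<lambda>x. reg_delta 1 x * (1 + norm x))"
proof (rule integrable_decay)
  fix x :: R3
  have n: "0 < 1 + norm x" using norm_ge_zero[of x] by linarith
  have "3 / (4 * pi) \<le> 1" using pi_gt3 by simp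
  then have "reg_delta 1 x \<le> 1 * (1 / reg_norm 1 x ^ 5)"
    using mult_right_mono[of "3 / (4 * pi)" 1 "1 / reg_norm 1 x ^ 5"] reg_norm_pos[of 1 x]
    by (simp add: reg_delta_def)
  also have "\<dots> \<le> 2 ^ 5 / (1 + norm x) ^ 5"
    using reg_norm_decay_power[of 1 x 5] by simp
  finally have "reg_delta 1 x * (1 + norm x) \<le> 2 ^ 5 / (1 + norm x) ^ 5 * (1 + norm x)"
    using n by (intro mult_right_mono) auto
  also have "c / y ^ 5 * y = c / y ^ 4" if "y > 0" for c y :: real
    using that by (simp add: eval_nat_numeral)
  note this[OF n]
  finally show "norm (reg_delta 1 x * (1 + norm x)) \<le> 2 ^ 5 / (1 + norm x) ^ 4"
    using reg_delta_nonneg[of 1 x] n by simp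
qed measurable

lemma reg_delta_integrable: "integrable lborel (reg_delta 1)"
proof (rule Bochner_Integration.integrable_bound[OF reg_delta_weight_integrable])
  have "reg_delta 1 x * 1 \<le> reg_delta 1 x * (1 + norm x)" for x
    by (intro mult_left_mono) (auto simp: reg_delta_nonneg)
  then show "AE x in lborel. norm (reg_delta 1 x) \<le> norm (reg_delta 1 x * (1 + norm x))"
    by (auto simp: reg_delta_nonneg)
qed measurable

text \<open>Layer cake again, with \<open>q s = sqrt (1 + s\<^sup>2)\<close>: the derivative of
  \<open>s / q s\<close> is \<open>1 / q s ^ 3\<close>, hence \<open>(s / q s) ^ 5\<close> is, up to
  a factor, the primitive of \<open>s ^ 4 / q s ^ 7\<close>.\<close>

lemma reg_delta_integral: "(LINT x|lborel. reg_delta 1 x) = 1"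
proof -
  define q where "q s = sqrt (1 + s\<^sup>2)" for s :: real
  have qpos: "q s > 0" for s by (simp add: q_def add_pos_nonneg)
  have qd: "DERIV q s :> s / q s" for s
  proof -
    have "DERIV (\<lambda>s. 1 + s\<^sup>2) s :> 2 * s" by (auto intro!: derivative_eq_intros)
    from DERIV_chain2[OF DERIV_real_sqrt this] show ?thesis
      unfolding q_def[abs_def] by (rule DERIV_cong) (auto simp: inverse_eq_divide add_pos_nonneg)
  qed
  have q2: "(q s)\<^sup>2 = 1 + s\<^sup>2" for s by (simp add: q_def)
  have qlim: "filterlim q at_top at_top"
  proof (rule filterlim_at_top_mono[OF filterlim_ident])
    show "\<forall>\<^sub>F s in at_top. s \<le> q s"
      by (auto simp: q_def intro!: always_eventually real_le_rsqrt)
  qed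
  have ql: "((\<lambda>s. 1 / q s) \<longlongrightarrow> 0) at_top"
    using tendsto_inverse_0_at_top[OF qlim] by (simp add: inverse_eq_divide)
  have [measurable]: "q \<in> borel_measurable borel"
    unfolding q_def[abs_def] by measurable
  have "(\<integral>\<^sup>+x. ennreal (1 / q (norm (x::R3)) ^ 5) \<partial>lborel) = ennreal (4 * pi / 3 - 4 * pi / 3 * (0 / q 0) ^ 5)"
  proof (rule nn_integral_radial[where k = "\<lambda>s. 5 * s / q s ^ 7"])
    fix s :: real assume s: "0 \<le> s"
    have qs: "q s > 0" by (rule qpos)
    have "DERIV (\<lambda>s. 1 / q s ^ 5) s :> - (5 * q s ^ 4 * (s / q s)) / (q s ^ 5 * q s ^ 5)"
      using qs by (auto intro!: derivative_eq_intros qd)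
    then show "DERIV (\<lambda>s. 1 / q s ^ 5) s :> - (5 * s / q s ^ 7)"
      by (rule DERIV_cong) (use qs in \<open>simp add: field_simps eval_nat_numeral\<close>)
    show "0 \<le> 5 * s / q s ^ 7" using qs s by simp
    have "DERIV (\<lambda>s. s / q s) s :> (1 * q s - s * (s / q s)) / (q s * q s)"
      using qs by (intro DERIV_divide qd DERIV_ident) auto
    moreover have "(1 * q s - s * (s / q s)) / (q s * q s) = 1 / q s ^ 3"
    proof -
      have "1 * q s - s * (s / q s) = ((q s)\<^sup>2 - s\<^sup>2) / q s"
        using qs by (simp add: field_simps power2_eq_square)
      also have "\<dots> = 1 / q s" by (simp add: q2)
      finally show ?thesis by (simp add: eval_nat_numeral)
    qed
    ultimately have d: "DERIV (\<lambda>s. s / q s) s :> 1 / q s ^ 3" by simp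
    have "DERIV (\<lambda>s. 4 * pi / 3 * (s / q s) ^ 5) s :> 4 * pi / 3 * (5 * (s / q s) ^ 4 * (1 / q s ^ 3))"
      by (rule DERIV_cmult) (rule DERIV_cong[OF DERIV_power[OF d]], simp)
    then show "DERIV (\<lambda>s. 4 * pi / 3 * (s / q s) ^ 5) s :> 5 * s / q s ^ 7 * (4 * pi / 3 * s ^ 3)"
      by (rule DERIV_cong) (use qs in \<open>simp add: field_simps eval_nat_numeral\<close>)
  next
    show "((\<lambda>s. 1 / q s ^ 5) \<longlongrightarrow> 0) at_top"
      using tendsto_power[OF ql, of 5] by (simp add: power_one_over)
    \<comment> \<open>For \<open>s \<ge> 0\<close> this is another form of \<open>s / q s\<close>,
      with an evident limit.\<close>
    have "((\<lambda>s. sqrt (1 - (1 / q s)\<^sup>2)) \<longlongrightarrow> sqrt (1 - 0\<^sup>2)) at_top"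
      by (intro tendsto_intros ql)
    then have "((\<lambda>s. s / q s) \<longlongrightarrow> sqrt (1 - 0\<^sup>2)) at_top"
    proof (rule Lim_transform_eventually)
      show "\<forall>\<^sub>F s in at_top. sqrt (1 - (1 / q s)\<^sup>2) = s / q s"
        using eventually_ge_at_top[of 0]
      proof eventually_elim
        case (elim s)
        have "1 - (1 / q s)\<^sup>2 = ((q s)\<^sup>2 - 1) / (q s)\<^sup>2"
          using qpos[of s] by (simp add: field_simps power2_eq_square)
        also have "\<dots> = (s / q s)\<^sup>2" by (simp add: q2 power_divide)
        finally show ?case using elim qpos[of s] by simp
      qed
    qed
    from tendsto_mult[OF tendsto_const[of "4 * pi / 3"] tendsto_power[OF this, of 5]]
    show "((\<lambda>s. 4 * pi / 3 * (s / q s) ^ 5) \<longlongrightarrow> 4 * pi / 3) at_top" by simp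
  qed measurable
  then have nn: "(\<integral>\<^sup>+x. ennreal (1 / q (norm (x::R3)) ^ 5) \<partial>lborel) = ennreal (4 * pi / 3)"
    by simp
  have "(\<integral>x. 1 / q (norm (x::R3)) ^ 5 \<partial>lborel) = 4 * pi / 3"
    by (subst integral_eq_nn_integral) (use nn qpos in \<open>auto simp: less_imp_le\<close>)
  moreover have "reg_delta 1 = (\<lambda>x. 3 / (4 * pi) * (1 / q (norm x) ^ 5))"
    by (auto simp: reg_delta_def reg_norm_def q_def dot_square_norm add.commute)
  ultimately show ?thesis by (simp only: integral_mult_right_zero) simp
qed

section \<open>Integration by parts against the regularised field\<close>

lemma GDERIV_shift:
  assumes "GDERIV f (x - w) :> D" shows "GDERIV (\<lambda>x. f (x - w)) x :> D"
proof -
  have "((\<lambda>x. x - w) has_derivative (\<lambda>h. h - 0)) (at x)"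
    by (rule has_derivative_diff[OF has_derivative_ident has_derivative_const])
  with assms has_derivative_compose[of "\<lambda>x. x - w" "\<lambda>h. h" x UNIV f "\<lambda>h. h \<bullet> D"] show ?thesis
    unfolding gderiv_def by simp
qed

text \<open>A row of the Hessian of \<open>reg_kernel e\<close>: the gradient found in
  \<open>reg_field_nth_GDERIV\<close>.\<close>

definition reg_hess :: "real \<Rightarrow> 3 \<Rightarrow> R3 \<Rightarrow> R3" where
  "reg_hess e i x = (1 / (4 * pi)) *\<^sub>R ((3 * x $ i / reg_norm e x ^ 5) *\<^sub>R x - (1 / reg_norm e x ^ 3) *\<^sub>R axis i 1)"

lemma reg_hess_continuous: "e > 0 \<Longrightarrow> continuous_on UNIV (reg_hess e i)"
  unfolding reg_hess_def using reg_norm_pos[of e]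
  by (intro continuous_intros reg_norm_continuous) (auto simp: less_imp_neq[symmetric])

lemma integrable_decay_mult:
  fixes f g :: "R3 \<Rightarrow> real"
  assumes [measurable]: "f \<in> borel_measurable borel" "g \<in> borel_measurable borel"
    and "\<And>x. \<bar>f x\<bar> \<le> C / (1 + norm x) ^ j" "\<And>x. \<bar>g x\<bar> \<le> D / (1 + norm x) ^ k" "j + k = 4"
  shows "integrable lborel (\<lambda>x. f x * g x)"
proof (rule integrable_decay)
  fix x
  have "\<bar>f x\<bar> * \<bar>g x\<bar> \<le> (C / (1 + norm x) ^ j) * (D / (1 + norm x) ^ k)"
    using assms(3,4)[of x] by (intro mult_mono) (auto intro: order_trans[OF abs_ge_zero])
  also have "\<dots> = C * D / (1 + norm x) ^ 4"
    using assms(5) by (simp flip: power_add)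
  finally show "norm (f x * g x) \<le> C * D / (1 + norm x) ^ 4" by (simp add: abs_mult)
qed measurable

text \<open>Integration by parts, one coordinate at a time, since \<open>reg_delta e\<close> is
  minus the divergence of \<open>reg_field e\<close>. The assumed decay is that of a translated
  kernel and its gradient, so that \<open>\<psi>\<close> may itself be a potential; the boundary
  term is then handled by \<open>integral_gradient_eq_0\<close>.\<close>

lemma integral_inner_reg_field:
  assumes e: "e > 0"
    and \<psi>: "\<And>x. GDERIV \<psi> x :> G x" "continuous_on UNIV G"
    and dec: "\<And>x. \<bar>\<psi> x\<bar> \<le> C / (1 + norm x)" "\<And>x. norm (G x) \<le> D / (1 + norm x)\<^sup>2"
  shows "(LINT x|lborel. G x \<bullet> reg_field e x) = (LINT x|lborel. \<psi> x * reg_delta e x)"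
proof -
  have \<psi>c: "continuous_on UNIV \<psi>"
    using \<psi>(1) by (auto simp: gderiv_def continuous_on_eq_continuous_at intro: has_derivative_continuous)
  have [measurable]: "\<psi> \<in> borel_measurable borel" "G \<in> borel_measurable borel" "reg_hess e i \<in> borel_measurable borel" for i
    by (rule borel_measurable_continuous_onI[OF \<psi>c], rule borel_measurable_continuous_onI[OF \<psi>(2)],
      rule borel_measurable_continuous_onI[OF reg_hess_continuous[OF e]])
  have fi: "\<bar>reg_field e x $ i\<bar> \<le> (1 / e + 1)\<^sup>2 / (1 + norm x)\<^sup>2" for x i
    using component_le_norm_cart[of "reg_field e x"
        i] reg_field_norm_le[OF e, of x] reg_norm_decay_power[OF e, of x 2] by linarith
  have hi: "\<bar>reg_hess e i x $ i\<bar> \<le> 4 * (1 / e + 1) ^ 3 / (1 + norm x) ^ 3" for x i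
    using component_le_norm_cart[of "reg_hess e i x"
        i] reg_field_deriv_norm_le[OF e, of x i, folded reg_hess_def] reg_norm_decay_power[OF e, of x 3]
    by linarith
  have gi: "\<bar>G x $ i\<bar> \<le> D / (1 + norm x)\<^sup>2" for x i
    using component_le_norm_cart[of "G x" i] dec(2)[of x] by linarith
  have i1: "integrable lborel (\<lambda>x. \<psi> x * reg_hess e i x $ i)" for i
    by (rule integrable_decay_mult[where j = 1 and k = 3]) (use dec hi in auto)
  have i2: "integrable lborel (\<lambda>x. G x $ i * reg_field e x $ i)" for i
    by (rule integrable_decay_mult[where j = 2 and k = 2]) (use gi fi in auto)
  have "(LINT x|lborel. (\<psi> x *\<^sub>R reg_hess e i x + reg_field e x $ i *\<^sub>R G x) \<bullet> axis i 1) = 0" for i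
  proof (rule integral_gradient_eq_0)
    show "GDERIV (\<lambda>x. \<psi> x * reg_field e x $ i) x :> \<psi> x *\<^sub>R reg_hess e i x + reg_field e x $ i *\<^sub>R G x" for x
      unfolding reg_hess_def by (rule GDERIV_mult[OF \<psi>(1) reg_field_nth_GDERIV[OF e]])
    show "continuous_on UNIV (\<lambda>x. \<psi> x *\<^sub>R reg_hess e i x + reg_field e x $ i *\<^sub>R G x)"
      by (intro continuous_intros \<psi>c \<psi>(2) reg_hess_continuous[OF e] reg_field_continuous[OF e])
    have "\<bar>\<psi> x / (1 + norm x)\<bar> \<le> C / (1 + norm x)\<^sup>2" for x
    proof -
      have n: "0 < 1 + norm x" using norm_ge_zero[of x] by linarith
      then show ?thesis
        using divide_right_mono[OF dec(1)[of x], of "1 + norm x"] by (simp add: power2_eq_square)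
    qed
    then have "integrable lborel (\<lambda>x. (\<psi> x / (1 + norm x)) * reg_field e x $ i)"
      by (intro integrable_decay_mult[where j = 2 and k = 2]) (use fi in auto)
    then show "integrable lborel (\<lambda>x. \<psi> x * reg_field e x $ i / (1 + norm x))"
      by simp
    show "integrable lborel (\<lambda>x. (\<psi> x *\<^sub>R reg_hess e i x + reg_field e x $ i *\<^sub>R G x) \<bullet> axis i 1)"
      using Bochner_Integration.integrable_add[OF i1 i2, of i i] by (simp add: inner_axis mult.commute)
  qed
  then have "(LINT x|lborel. \<psi> x * reg_hess e i x $ i) + (LINT x|lborel. G x $ i * reg_field e x $ i) = 0" for i
    using i1 i2 by (simp add: inner_axis mult.commute flip: integral_add)
  then have "(\<Sum>i\<in>UNIV. (LINT x|lborel. \<psi> x * reg_hess e i x $ i) + (LINT x|lborel. G x $ i * reg_field e x $ i)) = 0"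
    by simp
  then have "(LINT x|lborel. (\<Sum>i\<in>UNIV. \<psi> x * reg_hess e i x $ i)) + (LINT x|lborel. G x \<bullet> reg_field e x) = 0"
    using i1 i2 by (simp add: sum.distrib inner_vec_def)
  moreover have "(\<Sum>i\<in>UNIV. \<psi> x * reg_hess e i x $ i) = - (\<psi> x * reg_delta e x)" for x
    using reg_field_divergence[OF e, of x, folded reg_hess_def] by (simp flip: sum_distrib_left)
  ultimately show ?thesis by simp
qed

lemma one_plus_norm_shift: "1 / (1 + norm (x - w)) \<le> (1 + norm w) / (1 + norm (x :: R3))"
proof -
  have "norm x \<le> norm (x - w) + norm w" by (metis add_diff_cancel_right' diff_add_cancel norm_triangle_ineq)
  then have "1 + norm x \<le> (1 + norm w) * (1 + norm (x - w))"
    by (simp add: algebra_simps) (smt (verit) mult_nonneg_nonneg norm_ge_zero)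
  moreover have "0 < 1 + norm x" "0 < 1 + norm (x - w)" using norm_ge_zero[of x] norm_ge_zero[of "x - w"] by linarith+
  ultimately show ?thesis by (simp add: pos_divide_le_eq pos_le_divide_eq mult_ac)
qed

lemma reg_norm_decay_shift:
  assumes e: "e > 0"
  shows "1 / reg_norm e (x - w) ^ k \<le> ((1 / e + 1) * (1 + norm w)) ^ k / (1 + norm x) ^ k"
proof -
  have "1 / reg_norm e (x - w) \<le> (1 / e + 1) * (1 / (1 + norm (x - w)))"
    using reg_norm_decay[OF e, of "x - w"] by simp
  also have "\<dots> \<le> (1 / e + 1) * ((1 + norm w) / (1 + norm x))"
    using e by (intro mult_left_mono one_plus_norm_shift) auto
  finally have "(1 / reg_norm e (x - w)) ^ k \<le> ((1 / e + 1) * ((1 + norm w) / (1 + norm x))) ^ k"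
    using reg_norm_pos[OF e, of "x - w"] by (intro power_mono) auto
  then show ?thesis by (simp add: power_divide power_mult_distrib)
qed

text \<open>The interaction energy of two softened unit charges at displacement \<open>w\<close>:
  integrate by parts with the translated kernel as \<open>\<psi>\<close>, then rescale the
  density.\<close>

lemma integral_reg_field_reg_field:
  assumes e: "e > 0"
  shows "(LINT x|lborel. reg_field e (x - w) \<bullet> reg_field e x) = (LINT x|lborel. reg_delta 1 x * reg_kernel e (e *\<^sub>R x - w))"
proof -
  have "(LINT x|lborel. reg_field e (x - w) \<bullet> reg_field e x) = (LINT x|lborel. reg_kernel e (x - w) * reg_delta e x)"
  proof (rule integral_inner_reg_field[OF e])
    show "GDERIV (\<lambda>x. reg_kernel e (x - w)) x :> reg_field e (x - w)" for x
      by (rule GDERIV_shift[OF reg_kernel_GDERIV[OF e]])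
    show "continuous_on UNIV (\<lambda>x. reg_field e (x - w))"
      by (intro continuous_on_compose2[OF reg_field_continuous[OF e]] continuous_intros) auto
    show "\<bar>reg_kernel e (x - w)\<bar> \<le> ((1 / e + 1) * (1 + norm w)) / (1 + norm x)" for x
      using reg_kernel_le[OF e, of "x - w"] reg_norm_decay_shift[OF e, of x w 1] by simp
    show "norm (reg_field e (x - w)) \<le> ((1 / e + 1) * (1 + norm w))\<^sup>2 / (1 + norm x)\<^sup>2" for x
      using reg_field_norm_le[OF e, of "x - w"] reg_norm_decay_shift[OF e, of x w 2] by simp
  qed
  also have "\<dots> = (LINT x|lborel. reg_delta 1 x * reg_kernel e (e *\<^sub>R x - w))"
    using e reg_delta_scale[OF e]
    by (subst integral_affine[where c = e and t = 0])
      (auto simp flip: integral_mult_right_zero intro!: Bochner_Integration.integral_cong simp: mult_ac)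
  finally show ?thesis .
qed

text \<open>Pairing a gradient with the field of a unit charge at \<open>y\<close> recovers an
  average of \<open>\<psi>\<close> near \<open>y\<close>. Boundedness and compact support supply the
  required decay, with constants depending on \<open>R\<close>.\<close>

lemma integral_inner_reg_field_compact:
  assumes e: "e > 0" and \<psi>: "\<And>x. GDERIV \<psi> x :> G x" "continuous_on UNIV G"
    and supp: "\<And>x. norm x > r \<Longrightarrow> \<psi> x = 0" "\<And>x. norm x > r \<Longrightarrow> G x = 0"
  shows "(LINT x|lborel. G x \<bullet> reg_field e (x - y)) = (LINT x|lborel. reg_delta 1 x * \<psi> (e *\<^sub>R x + y))"
proof -
  have \<psi>c: "continuous_on UNIV \<psi>"
    using \<psi>(1) by (auto simp: gderiv_def continuous_on_eq_continuous_at intro: has_derivative_continuous)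
  obtain B where B: "B \<ge> 0" "\<And>x. norm (\<psi> x) \<le> B"
    by (rule bounded_continuous_compact_support[of \<psi> r]) (use \<psi>c supp in auto)
  obtain D where D: "D \<ge> 0" "\<And>x. norm (G x) \<le> D"
    by (rule bounded_continuous_compact_support[of G r]) (use \<psi>(2) supp in auto)
  define R where "R = 1 + \<bar>r\<bar> + norm y"
  have R: "norm (x + y) > r" if "1 + norm x > R" for x
    using that norm_triangle_ineq4[of "x + y" y] by (simp add: R_def)
  have R0: "R > 0" by (simp add: R_def add_pos_nonneg)
  have n: "0 < 1 + norm x" for x :: R3 using norm_ge_zero[of x] by linarith
  have "(LINT x|lborel. G x \<bullet> reg_field e (x - y)) = (LINT x|lborel. G (x + y) \<bullet> reg_field e x)"
    using integral_translate(1)[of "\<lambda>x. G x \<bullet> reg_field e (x - y)" y] by simp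
  also have "\<dots> = (LINT x|lborel. \<psi> (x + y) * reg_delta e x)"
  proof (rule integral_inner_reg_field[OF e])
    show "GDERIV (\<lambda>x. \<psi> (x + y)) x :> G (x + y)" for x
      using GDERIV_shift[of \<psi> x "- y"] \<psi>(1) by simp
    show "continuous_on UNIV (\<lambda>x. G (x + y))"
      by (intro continuous_on_compose2[OF \<psi>(2)] continuous_intros) auto
    show "\<bar>\<psi> (x + y)\<bar> \<le> B * R / (1 + norm x)" for x
    proof (cases "1 + norm x > R")
      case False
      then have "\<bar>\<psi> (x + y)\<bar> * (1 + norm x) \<le> B * R"
        using B(2)[of "x + y"] B(1) n[of x] by (intro mult_mono) auto
      then show ?thesis using n[of x] by (simp add: pos_le_divide_eq)
    qed (use supp(1) R[of x] B R0 n[of x] in auto)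
    show "norm (G (x + y)) \<le> D * R\<^sup>2 / (1 + norm x)\<^sup>2" for x
    proof (cases "1 + norm x > R")
      case False
      then have "norm (G (x + y)) * (1 + norm x)\<^sup>2 \<le> D * R\<^sup>2"
        using D(2)[of "x + y"] D(1) n[of x] by (intro mult_mono power_mono) auto
      then show ?thesis using n[of x] by (simp add: pos_le_divide_eq)
    qed (use supp(2) R[of x] D R0 n[of x] in auto)
  qed
  also have "\<dots> = (LINT x|lborel. reg_delta 1 x * \<psi> (e *\<^sub>R x + y))"
    using e reg_delta_scale[OF e]
    by (subst integral_affine[where c = e and t = 0])
      (auto simp flip: integral_mult_right_zero intro!: Bochner_Integration.integral_cong simp: mult_ac)
  finally show ?thesis .
qed

text \<open>Both \<open>norm (e *\<^sub>R x - w)\<close> and \<open>e\<close> are at most the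
  softened distance, so \<open>norm w\<close> is at most \<open>1 + norm x\<close> times it. The
  bound is uniform in \<open>e\<close>, which makes it usable for domination.\<close>

lemma norm_mult_reg_kernel_le:
  assumes e: "e > 0"
  shows "norm w * reg_kernel e (e *\<^sub>R x - w) \<le> (1 + norm x) / (4 * pi)"
proof -
  let ?r = "reg_norm e (e *\<^sub>R x - w)"
  have r: "?r > 0" by (rule reg_norm_pos[OF e])
  have "norm w \<le> norm (e *\<^sub>R x - w) + e * norm x"
    using norm_triangle_ineq4[of "e *\<^sub>R x" "e *\<^sub>R x - w"] e by simp
  also have "\<dots> \<le> ?r + ?r * norm x"
    using reg_norm_ge[where x = "e *\<^sub>R x - w" and e = e] e by (intro add_mono mult_right_mono) auto
  finally have "norm w \<le> ?r * (1 + norm x)" by (simp add: algebra_simps)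
  then have "norm w / (4 * pi * ?r) \<le> ?r * (1 + norm x) / (4 * pi * ?r)"
    using r by (intro divide_right_mono) auto
  then show ?thesis using r by (simp add: reg_kernel_def)
qed

lemma reg_kernel_tendsto:
  assumes e: "e \<longlonglongrightarrow> 0" "w \<noteq> 0"
  shows "(\<lambda>n. reg_kernel (e n) (e n *\<^sub>R x - w)) \<longlonglongrightarrow> 1 / (4 * pi * norm w)"
proof -
  have "(\<lambda>n. 1 / (4 * pi * sqrt ((e n *\<^sub>R x - w) \<bullet> (e n *\<^sub>R x - w) + (e n)\<^sup>2))) \<longlonglongrightarrow>
     1 / (4 * pi * sqrt ((0 *\<^sub>R x - w) \<bullet> (0 *\<^sub>R x - w) + 0\<^sup>2))"
    by (intro tendsto_intros e) (use e(2) in auto)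
  then show ?thesis
    by (simp add: reg_kernel_def reg_norm_def norm_eq_sqrt_inner)
qed

section \<open>Hardy's inequality and the Newton potential\<close>

text \<open>The field \<open>X x = x / reg_norm e x\<close> has norm at most 1 and divergence at
  least \<open>2 / reg_norm e x\<close>. Integrating the divergence of \<open>v\<^sup>2\<close>
  times \<open>X\<close> gives the estimate by Cauchy-Schwarz.\<close>

lemma Hardy_test_function:
  assumes e: "e > 0" and v: "v \<in> test_functions"
  shows "(LINT x|lborel. (v x)\<^sup>2 / reg_norm e x) \<le> L2norm v * L2norm (grad v)"
    and "integrable lborel (\<lambda>x. (v x)\<^sup>2 / reg_norm e x)"
proof -
  obtain r where r: "r > 0" "\<And>x. norm x > r \<Longrightarrow> v x = 0" "\<And>x. norm x > r \<Longrightarrow> grad v x = 0"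
    by (rule test_function_supp[OF v]) blast
  have vc: "continuous_on UNIV v" "continuous_on UNIV (grad v)"
    using v by (auto intro: smooth_continuous_on smooth_grad_continuous_on test_function_smooth)
  have nz: "reg_norm e x \<noteq> 0" for x using reg_norm_pos[OF e, of x] by simp
  note ci = continuous_intros reg_norm_continuous[OF e] vc
  define X where "X x = (1 / reg_norm e x) *\<^sub>R x" for x
  define W where "W i x = (1 / reg_norm e x ^ 1) *\<^sub>R axis i 1 + x $ i *\<^sub>R ((- (real 1 / reg_norm e x ^ (1 + 2))) *\<^sub>R
      x)" for i x
  have Xc: "continuous_on UNIV X" unfolding X_def by (intro ci) (use nz in auto)
  have Wc: "continuous_on UNIV (W i)" for i unfolding W_def by (intro ci) (use nz in auto)
  have XW: "GDERIV (\<lambda>x. X x $ i) x :> W i x" for i x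
    using GDERIV_mult[OF reg_norm_power_GDERIV[OF e, of 1 x] nth_GDERIV[of i x]] by (simp add: X_def W_def)
  define P where "P i x = (v x * v x) * W i x $ i + X x $ i * (2 * v x * grad v x $ i)" for i x
  have Pi: "integrable lborel (P i)" for i
    by (rule integrable_continuous_compact_support[of _ r])
      (use r in \<open>auto simp: P_def intro!: ci Xc Wc continuous_on_component\<close>)
  have "(LINT x|lborel. P i x) = 0" for i
  proof -
    let ?G = "\<lambda>x. (v x * v x) *\<^sub>R W i x + X x $ i *\<^sub>R (v x *\<^sub>R grad v x + v x *\<^sub>R grad v x)"
    have GP: "?G x \<bullet> axis i 1 = P i x" for x by (simp add: inner_axis P_def)
    have "(LINT x|lborel. ?G x \<bullet> axis i 1) = 0"
    proof (rule integral_gradient_eq_0_integrable)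
      show "GDERIV (\<lambda>x. v x * v x * X x $ i) x :> ?G x" for x
        by (intro GDERIV_mult XW smooth_GDERIV test_function_smooth v)
      show "continuous_on UNIV ?G"
        by (intro ci Xc Wc continuous_on_component)
      show "integrable lborel (\<lambda>x. v x * v x * X x $ i)"
        by (rule integrable_continuous_compact_support[of _ r])
          (use r in \<open>auto intro!: ci Xc continuous_on_component\<close>)
      show "integrable lborel (\<lambda>x. ?G x \<bullet> axis i 1)"
        unfolding GP by (rule Pi)
    qed
    then show ?thesis by (simp only: GP)
  qed
  then have "(LINT x|lborel. (\<Sum>i\<in>UNIV. P i x)) = 0"
    using Pi by simp
  moreover have "(\<Sum>i\<in>UNIV. P i x)
      = (v x)\<^sup>2 * (3 / reg_norm e x - (x \<bullet> x) / reg_norm e x ^ 3) + 2 * v x * (X x \<bullet> grad v x)" for x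
    by (simp add: P_def W_def sum_3 inner_vec_def power2_eq_square power3_eq_cube algebra_simps add_divide_distrib)
  ultimately have z: "(LINT x|lborel. (v x)\<^sup>2 * (3 / reg_norm e x - (x \<bullet> x) / reg_norm e x ^ 3) + 2 * v x * (X x \<bullet>
      grad v x)) = 0"
    by simp
  have i1: "integrable lborel (\<lambda>x. (v x)\<^sup>2 * (3 / reg_norm e x - (x \<bullet> x) / reg_norm e x ^ 3))"
    by (rule integrable_continuous_compact_support[of _ r])
      (use r nz in \<open>auto intro!: ci\<close>)
  have i2: "integrable lborel (\<lambda>x. 2 * v x * (X x \<bullet> grad v x))"
    by (rule integrable_continuous_compact_support[of _ r])
      (use r nz in \<open>auto intro!: ci Xc\<close>)
  show i3: "integrable lborel (\<lambda>x. (v x)\<^sup>2 / reg_norm e x)"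
    by (rule integrable_continuous_compact_support[of _ r])
      (use r nz in \<open>auto intro!: ci\<close>)
  note vs = test_function_square_integrable[OF v]
  \<comment> \<open>The right-hand side is the divergence of \<open>X\<close>; the inequality is
    \<open>x \<bullet> x \<le> (reg_norm e x)\<^sup>2\<close>.\<close>
  have le: "2 / reg_norm e x \<le> 3 / reg_norm e x - (x \<bullet> x) / reg_norm e x ^ 3" for x
  proof -
    have p: "reg_norm e x > 0" by (rule reg_norm_pos[OF e])
    have "(x \<bullet> x) / reg_norm e x ^ 3 \<le> (reg_norm e x)\<^sup>2 / reg_norm e x ^ 3"
      using p by (intro divide_right_mono) (auto simp: reg_norm_square)
    also have "\<dots> = 1 / reg_norm e x" using p by (simp add: eval_nat_numeral)
    finally have "(x \<bullet> x) / reg_norm e x ^ 3 \<le> 1 / reg_norm e x" .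
    moreover have "3 / reg_norm e x = 2 / reg_norm e x + 1 / reg_norm e x" by (simp add: add_divide_distrib[symmetric])
    ultimately show ?thesis by linarith
  qed
  have Xn: "norm (X x) \<le> 1" for x
    using reg_norm_ge(1)[of x e] reg_norm_pos[OF e, of x] by (simp add: X_def)
  have "2 * (LINT x|lborel. (v x)\<^sup>2 / reg_norm e x) = (LINT x|lborel. (v x)\<^sup>2 * (2 / reg_norm e x))"
    by (simp add: mult.commute flip: integral_mult_right_zero)
  also have "\<dots> \<le> (LINT x|lborel. (v x)\<^sup>2 * (3 / reg_norm e x - (x \<bullet> x) / reg_norm e x ^ 3))"
  proof (intro integral_mono i1 mult_left_mono le)
    show "integrable lborel (\<lambda>x. (v x)\<^sup>2 * (2 / reg_norm e x))"
      using integrable_mult_right[of 2 lborel "\<lambda>x. (v x)\<^sup>2 / reg_norm e x"] i3 by (simp add: mult.commute)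
  qed simp
  also have "\<dots> = (LINT x|lborel. - (2 * v x * (X x \<bullet> grad v x)))"
    using z i1 i2 by simp
  also have "\<dots> \<le> (LINT x|lborel. 2 * (norm (v x) * norm (grad v x)))"
  proof (intro integral_mono integrable_mult_right square_integrable_mult_integrable vs)
    show "integrable lborel (\<lambda>x. - (2 * v x * (X x \<bullet> grad v x)))" using i2 by simp
    fix x
    have "\<bar>X x \<bullet> grad v x\<bar> \<le> 1 * norm (grad v x)"
      by (rule order_trans[OF Cauchy_Schwarz_ineq2]) (intro mult_right_mono Xn, simp)
    then have "\<bar>v x\<bar> * \<bar>X x \<bullet> grad v x\<bar> \<le> \<bar>v x\<bar> * norm (grad v x)"
      by (intro mult_left_mono) auto
    then have "\<bar>v x * (X x \<bullet> grad v x)\<bar> \<le> norm (v x) * norm (grad v x)" by (simp add: abs_mult)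
    then show "- (2 * v x * (X x \<bullet> grad v x)) \<le> 2 * (norm (v x) * norm (grad v x))"
      by linarith
  qed
  also have "\<dots> = 2 * (LINT x|lborel. norm (v x) * norm (grad v x))" by simp
  also have "(LINT x|lborel. norm (v x) * norm (grad v x)) \<le> L2norm v * L2norm (grad v)"
    by (rule Cauchy_Schwarz_L2norm[OF vs])
  finally show "(LINT x|lborel. (v x)\<^sup>2 / reg_norm e x) \<le> L2norm v * L2norm (grad v)" by simp
qed

lemma Hardy_test_function_shift:
  assumes e: "e > 0" and v: "v \<in> test_functions"
  shows "(LINT y|lborel. (v y)\<^sup>2 / reg_norm e (y - x)) \<le> L2norm v * L2norm (grad v)"
    and "integrable lborel (\<lambda>y. (v y)\<^sup>2 / reg_norm e (y - x))"
proof -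
  let ?w = "\<lambda>y. v (1 *\<^sub>R y + x)"
  have w: "?w \<in> test_functions" by (rule test_function_affine[OF v]) simp
  have gw: "grad ?w = (\<lambda>y. grad v (y + x))"
    using grad_affine(2)[of v 1 _ x] smooth_differentiable[OF test_function_smooth[OF v]] by auto
  note H = Hardy_test_function[OF e w]
  have eq: "(LINT y|lborel. (v y)\<^sup>2 / reg_norm e (y - x)) = (LINT y|lborel. (v (y + x))\<^sup>2 / reg_norm e y)"
    using integral_translate(1)[of "\<lambda>y. (v y)\<^sup>2 / reg_norm e (y - x)" x] by simp
  show "(LINT y|lborel. (v y)\<^sup>2 / reg_norm e (y - x)) \<le> L2norm v * L2norm (grad v)"
    using H(1) unfolding eq gw by (simp add: L2norm_translate)
  show "integrable lborel (\<lambda>y. (v y)\<^sup>2 / reg_norm e (y - x))"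
    using H(2) integrable_translate(1)[of "\<lambda>y. (v y)\<^sup>2 / reg_norm e (y - x)" x] by simp
qed

lemma L2norm_tendsto_AE_subseq:
  fixes u :: "R3 \<Rightarrow> 'b::euclidean_space"
  assumes v: "\<And>n. square_integrable (v n)" and u: "square_integrable u"
    and lim: "(\<lambda>n. L2norm (\<lambda>x. v n x - u x)) \<longlonglongrightarrow> 0"
  obtains r where "strict_mono r" "AE x in lborel. (\<lambda>n. v (r n) x) \<longlonglongrightarrow> u x"
proof -
  have "\<exists>r::nat\<Rightarrow>nat. strict_mono r \<and> (AE x in lborel. (\<lambda>n. (norm (v (r n) x - u x))\<^sup>2) \<longlonglongrightarrow> 0)"
  proof (rule tendsto_L1_AE_subseq)
    show "integrable lborel (\<lambda>x. (norm (v n x - u x))\<^sup>2)" for n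
      by (rule square_integrableD[OF square_integrable_diff[OF v u]])
    show "(\<lambda>n. LINT x|lborel. norm ((norm (v n x - u x))\<^sup>2)) \<longlonglongrightarrow> 0"
      using lim[unfolded L2norm_tendsto_0_iff] by simp
  qed
  then obtain r :: "nat \<Rightarrow> nat" where r: "strict_mono r" "AE x in lborel. (\<lambda>n. (norm (v (r n) x - u x))\<^sup>2) \<longlonglongrightarrow> 0"
    by blast
  have "AE x in lborel. (\<lambda>n. v (r n) x) \<longlonglongrightarrow> u x"
    using r(2)
  proof eventually_elim
    case (elim x)
    from tendsto_real_sqrt[OF this] have "(\<lambda>n. norm (v (r n) x - u x)) \<longlonglongrightarrow> 0" by simp
    then show ?case by (simp only: tendsto_norm_zero_iff LIM_zero_iff)
  qed
  with r(1) show ?thesis by (rule that)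
qed

lemma AE_neq: "AE y in lborel. y \<noteq> (x :: R3)"
  by (rule AE_I'[of "{x}"]) auto

lemma L2norm_tendsto:
  fixes u :: "R3 \<Rightarrow> 'b::euclidean_space"
  assumes v: "\<And>n. square_integrable (v n)" and u: "square_integrable u"
    and lim: "(\<lambda>n. L2norm (\<lambda>x. v n x - u x)) \<longlonglongrightarrow> 0"
  shows "(\<lambda>n. L2norm (v n)) \<longlonglongrightarrow> L2norm u"
proof -
  have "\<bar>L2norm (v n) - L2norm u\<bar> \<le> L2norm (\<lambda>x. v n x - u x)" for n
    using L2norm_triangle[OF square_integrable_diff[OF v u] u, of n]
      L2norm_triangle[OF square_integrable_diff[OF u v] v, of n n] L2norm_minus_commute[of u "v n"]
    by simp
  then have "(\<lambda>n. L2norm (v n) - L2norm u) \<longlonglongrightarrow> 0"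
    by (intro Lim_null_comparison[OF always_eventually lim]) auto
  then show ?thesis by (simp add: LIM_zero_iff)
qed

text \<open>Fatou's lemma along a subsequence of test functions converging almost everywhere, with
  the softening removed at the same time; the singular point \<open>y = x\<close> is a null
  set.\<close>

lemma Hardy:
  assumes u: "square_integrable u" and g: "has_L2_weak_gradient u g"
  shows "(\<integral>\<^sup>+y. ennreal ((u y)\<^sup>2 / norm (x - y)) \<partial>lborel) \<le> ennreal (L2norm u * L2norm g)"
proof -
  have gs: "square_integrable g" using g by (simp add: has_L2_weak_gradient_def)
  obtain v where v: "\<And>n. v n \<in> test_functions" "(\<lambda>n. L2norm (\<lambda>x. v n x - u x)) \<longlonglongrightarrow> 0"
    "(\<lambda>n. L2norm (\<lambda>x. grad (v n) x - g x)) \<longlonglongrightarrow> 0"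
    by (rule test_functions_dense[OF u g]) blast
  note vs = test_function_square_integrable[OF v(1)]
  obtain r where r: "strict_mono r" "AE x in lborel. (\<lambda>n. v (r n) x) \<longlonglongrightarrow> u x"
    by (rule L2norm_tendsto_AE_subseq[OF vs(1) u v(2)]) blast
  define e where "e n = 1 / real (Suc n)" for n
  have e: "e n > 0" for n by (auto simp: e_def)
  have e0: "e \<longlonglongrightarrow> 0"
    unfolding e_def[abs_def] using LIMSEQ_inverse_real_of_nat by (simp add: inverse_eq_divide)
  let ?f = "\<lambda>n y. (v (r n) y)\<^sup>2 / reg_norm (e n) (y - x)"
  let ?b = "\<lambda>n. L2norm (v (r n)) * L2norm (grad (v (r n)))"
  have [measurable]: "v n \<in> borel_measurable borel" for n using vs(1)[of n] by auto
  have nn: "(\<integral>\<^sup>+y. ennreal (?f n y) \<partial>lborel) \<le> ennreal (?b n)" for n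
  proof -
    have "(\<integral>\<^sup>+y. ennreal (?f n y) \<partial>lborel) = ennreal (LINT y|lborel. ?f n y)"
      by (rule nn_integral_eq_integral[OF Hardy_test_function_shift(2)[OF e v(1)]])
        (auto simp: less_imp_le reg_norm_pos e)
    also have "\<dots> \<le> ennreal (?b n)"
      by (intro ennreal_leI Hardy_test_function_shift(1) e v(1))
    finally show ?thesis .
  qed
  have "(\<integral>\<^sup>+y. ennreal ((u y)\<^sup>2 / norm (x - y)) \<partial>lborel) = (\<integral>\<^sup>+y. liminf (\<lambda>n. ennreal (?f n y)) \<partial>lborel)"
  proof (rule nn_integral_cong_AE)
    show "AE y in lborel. ennreal ((u y)\<^sup>2 / norm (x - y)) = liminf (\<lambda>n. ennreal (?f n y))"
      using r(2) AE_neq[of x]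
    proof eventually_elim
      case (elim y)
      have "(\<lambda>n. (v (r n) y)\<^sup>2 / sqrt ((y - x) \<bullet> (y - x) + (e n)\<^sup>2)) \<longlonglongrightarrow> (u y)\<^sup>2 / sqrt ((y - x) \<bullet> (y - x) + 0\<^sup>2)"
        by (intro tendsto_intros elim e0) (use elim in auto)
      then have "(\<lambda>n. ?f n y) \<longlonglongrightarrow> (u y)\<^sup>2 / norm (x - y)"
        by (simp add: reg_norm_def norm_eq_sqrt_inner[of "y - x"] norm_minus_commute[of x])
      then have "(\<lambda>n. ennreal (?f n y)) \<longlonglongrightarrow> ennreal ((u y)\<^sup>2 / norm (x - y))"
        by (rule tendsto_ennrealI)
      then show ?case by (simp add: lim_imp_Liminf)
    qed
  qed
  also have "\<dots> \<le> liminf (\<lambda>n. \<integral>\<^sup>+y. ennreal (?f n y) \<partial>lborel)"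
    by (rule nn_integral_liminf) measurable
  also have "\<dots> \<le> liminf (\<lambda>n. ennreal (?b n))"
    by (intro Liminf_mono always_eventually allI nn)
  also have "(\<lambda>n. ennreal (?b n)) \<longlonglongrightarrow> ennreal (L2norm u * L2norm g)"
    using LIMSEQ_subseq_LIMSEQ[OF L2norm_tendsto[OF vs(1) u v(2)] r(1)]
      LIMSEQ_subseq_LIMSEQ[OF L2norm_tendsto[OF vs(2) gs v(3)] r(1)]
    by (intro tendsto_ennrealI tendsto_mult) (auto simp: o_def)
  then have "liminf (\<lambda>n. ennreal (?b n)) = ennreal (L2norm u * L2norm g)"
    by (simp add: lim_imp_Liminf)
  finally show ?thesis .
qed

text \<open>The Hardy bound does not depend on the centre \<open>x\<close>. Hence the integral
  defining the potential converges at every point, so no default value occurs, and the potential is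
  bounded.\<close>

lemma newton_potential_bound:
  assumes u: "square_integrable u" and g: "has_L2_weak_gradient u g"
  shows "integrable lborel (\<lambda>y. (u y)\<^sup>2 / (4 * pi * norm (x - y)))"
    and "0 \<le> newton_potential u x" and "newton_potential u x \<le> L2norm u * L2norm g / (4 * pi)"
proof -
  have [measurable]: "u \<in> borel_measurable borel" using u by auto
  have "(\<integral>\<^sup>+y. ennreal ((u y)\<^sup>2 / (4 * pi * norm (x - y))) \<partial>lborel)
      = (\<integral>\<^sup>+y. ennreal (1 / (4 * pi)) * ennreal ((u y)\<^sup>2 / norm (x - y)) \<partial>lborel)"
    by (simp flip: ennreal_mult')
  also have "\<dots> = ennreal (1 / (4 * pi)) * (\<integral>\<^sup>+y. ennreal ((u y)\<^sup>2 / norm (x - y)) \<partial>lborel)"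
    by (rule nn_integral_cmult) measurable
  also have "\<dots> \<le> ennreal (1 / (4 * pi)) * ennreal (L2norm u * L2norm g)"
    by (intro mult_left_mono Hardy[OF u g]) simp
  also have "\<dots> = ennreal (L2norm u * L2norm g / (4 * pi))"
    by (simp flip: ennreal_mult')
  finally have le: "(\<integral>\<^sup>+y. ennreal ((u y)\<^sup>2 / (4 * pi * norm (x - y))) \<partial>lborel) \<le> ennreal (L2norm u * L2norm g / (4 * pi))" .
  show i: "integrable lborel (\<lambda>y. (u y)\<^sup>2 / (4 * pi * norm (x - y)))"
    by (rule integrableI_bounded) (use le in \<open>auto simp: le_less_trans[OF _ ennreal_less_top]\<close>)
  show "0 \<le> newton_potential u x"
    by (simp add: newton_potential_def)
  have "ennreal (newton_potential u x) \<le> ennreal (L2norm u * L2norm g / (4 * pi))"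
    unfolding newton_potential_def using le by (subst (asm) nn_integral_eq_integral[OF i]) auto
  then show "newton_potential u x \<le> L2norm u * L2norm g / (4 * pi)"
    by (simp add: ennreal_le_iff L2norm_nonneg)
qed

lemma newton_potential_measurable:
  assumes "square_integrable u" shows "newton_potential u \<in> borel_measurable borel"
proof -
  have [measurable]: "u \<in> borel_measurable borel" using assms by auto
  show ?thesis unfolding newton_potential_def[abs_def] by measurable
qed

section \<open>Coulomb energy\<close>

definition potential :: "(R3 \<Rightarrow> real) \<Rightarrow> R3 \<Rightarrow> real" where
  "potential \<rho> x = (LINT y|lborel. \<rho> y / (4 * pi * norm (x - y)))"

definition coulomb :: "(R3 \<Rightarrow> real) \<Rightarrow> (R3 \<Rightarrow> real) \<Rightarrow> real" where
  "coulomb \<rho> \<sigma> = (LINT y|lborel. \<rho> y * potential \<sigma> y)"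

text \<open>The properties of \<open>u\<^sup>2\<close> for \<open>u\<close> in \<open>H1\<close> on
  which the energy arguments rest. A uniform bound on one potential makes its product with another
  charge density integrable, hence all mutual Coulomb energies finite.\<close>

definition charge :: "(R3 \<Rightarrow> real) \<Rightarrow> bool" where
  "charge \<rho> \<longleftrightarrow> integrable lborel \<rho> \<and> (\<forall>x. 0 \<le> \<rho> x) \<and>
     (\<exists>B. \<forall>x. integrable lborel (\<lambda>y. \<rho> y / (4 * pi * norm (x - y))) \<and> potential \<rho> x \<le> B)"

lemma chargeD:
  assumes "charge \<rho>"
  shows "integrable lborel \<rho>" "0 \<le> \<rho> x" "integrable lborel (\<lambda>y. \<rho> y / (4 * pi * norm (x - y)))"
    "0 \<le> potential \<rho> x" "\<rho> \<in> borel_measurable borel" "potential \<rho> \<in> borel_measurable borel"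
proof -
  show 1: "integrable lborel \<rho>" "0 \<le> \<rho> x" for x using assms by (auto simp: charge_def)
  show "integrable lborel (\<lambda>y. \<rho> y / (4 * pi * norm (x - y)))" using assms by (auto simp: charge_def)
  show "0 \<le> potential \<rho> x" unfolding potential_def using 1 by (intro Bochner_Integration.integral_nonneg) auto
  show [measurable]: "\<rho> \<in> borel_measurable borel" using 1 by auto
  show "potential \<rho> \<in> borel_measurable borel" unfolding potential_def[abs_def] by measurable
qed

lemma charge_potential_bound:
  assumes "charge \<rho>" obtains B where "\<And>x. potential \<rho> x \<le> B"
  using assms by (auto simp: charge_def)

lemma charge_mult_potential_integrable:
  assumes \<rho>: "charge \<rho>" and \<sigma>: "charge \<sigma>"
  shows "integrable lborel (\<lambda>y. \<rho> y * potential \<sigma> y)"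
proof -
  obtain B where B: "\<And>x. potential \<sigma> x \<le> B" by (rule charge_potential_bound[OF \<sigma>]) blast
  have [measurable]: "\<rho> \<in> borel_measurable borel" "potential \<sigma> \<in> borel_measurable borel"
    by (rule chargeD[OF \<rho>], rule chargeD[OF \<sigma>])
  show ?thesis
  proof (rule Bochner_Integration.integrable_bound[OF integrable_mult_right[OF chargeD(1)[OF \<rho>], of B]])
    have "\<rho> y * potential \<sigma> y \<le> B * \<rho> y" for y
      using mult_left_mono[OF B[of y] chargeD(2)[OF \<rho>, of y]] by (simp add: mult.commute)
    moreover have "0 \<le> B" using B[of 0] chargeD(4)[OF \<sigma>, of 0] by linarith
    ultimately show "AE y in lborel. norm (\<rho> y * potential \<sigma> y) \<le> norm (B * \<rho> y)"
      using chargeD(2)[OF \<rho>] chargeD(4)[OF \<sigma>] by (auto simp: abs_mult)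
  qed measurable
qed

lemma integrable_pair_mult:
  fixes f g :: "R3 \<Rightarrow> real"
  assumes "integrable lborel f" "integrable lborel g"
  shows "integrable (lborel \<Otimes>\<^sub>M lborel) (\<lambda>(y, z). f y * g z)"
proof (rule lborel_pair.Fubini_integrable)
  have [measurable]: "f \<in> borel_measurable borel" "g \<in> borel_measurable borel" using assms by auto
  show "(\<lambda>(y, z). f y * g z) \<in> borel_measurable (lborel \<Otimes>\<^sub>M lborel)" by measurable
  show "integrable lborel (\<lambda>x. LINT y|lborel. norm (case (x, y) of (y, z) \<Rightarrow> f y * g z))"
    using assms by (simp add: abs_mult)
  show "AE x in lborel. integrable lborel (\<lambda>y. case (x, y) of (y, z) \<Rightarrow> f y * g z)"
    using assms by simp
qed

text \<open>The inner integral is one density times the bounded potential of the other, so Fubini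
  applies. The double integral is the form reached as the limit of field energies.\<close>

lemma charge_pair_integrable:
  assumes \<rho>: "charge \<rho>" and \<sigma>: "charge \<sigma>"
  shows "integrable (lborel \<Otimes>\<^sub>M lborel) (\<lambda>(y, z). \<rho> y * \<sigma> z / (4 * pi * norm (y - z)))"
    and "coulomb \<rho> \<sigma> = (LINT p|(lborel \<Otimes>\<^sub>M lborel). (case p of (y, z) \<Rightarrow> \<rho> y * \<sigma> z / (4 * pi * norm (y - z))))"
proof -
  have [measurable]: "\<rho> \<in> borel_measurable borel" "\<sigma> \<in> borel_measurable borel"
    by (rule chargeD[OF \<rho>], rule chargeD[OF \<sigma>])
  have eq: "(LINT z|lborel. \<rho> y * \<sigma> z / (4 * pi * norm (y - z))) = \<rho> y * potential \<sigma> y" for y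
    unfolding potential_def by (simp flip: integral_mult_right_zero)
  have i: "integrable lborel (\<lambda>z. \<rho> y * \<sigma> z / (4 * pi * norm (y - z)))" for y
    using integrable_mult_right[OF chargeD(3)[OF \<sigma>, of y], of "\<rho> y"] by simp
  show 1: "integrable (lborel \<Otimes>\<^sub>M lborel) (\<lambda>(y, z). \<rho> y * \<sigma> z / (4 * pi * norm (y - z)))"
  proof (rule lborel_pair.Fubini_integrable)
    show "integrable lborel (\<lambda>x. LINT y|lborel. norm (case (x, y) of (y, z) \<Rightarrow> \<rho> y * \<sigma> z / (4 * pi * norm (y - z))))"
      using charge_mult_potential_integrable[OF \<rho> \<sigma>] chargeD(2)[OF \<rho>] chargeD(2)[OF \<sigma>]
      by (simp add: abs_mult eq)
  qed (use i in auto)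
  show "coulomb \<rho> \<sigma> = (LINT p|(lborel \<Otimes>\<^sub>M lborel). (case p of (y, z) \<Rightarrow> \<rho> y * \<sigma> z / (4 * pi * norm (y - z))))"
    unfolding lborel_pair.integral_fst'[OF 1, symmetric] by (simp add: coulomb_def eq)
qed

text \<open>Formally the gradient of the softened potential of \<open>\<rho>\<close>, without the
  minus sign usual in physics; it is defined by superposition, so that no potential has to be
  differentiated.\<close>

definition electric_field :: "real \<Rightarrow> (R3 \<Rightarrow> real) \<Rightarrow> R3 \<Rightarrow> R3" where
  "electric_field e \<rho> x = (LINT y|lborel. \<rho> y *\<^sub>R reg_field e (x - y))"

lemma reg_field_bounded:
  assumes "e > 0" shows "norm (reg_field e x) \<le> 1 / e\<^sup>2"
proof -
  have "1 / reg_norm e x ^ 2 \<le> 1 / e\<^sup>2"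
    using assms reg_norm_ge(2)[of e x] by (intro divide_left_mono power_mono) (auto simp: reg_norm_pos)
  with reg_field_norm_le[OF assms, of x] show ?thesis by linarith
qed

lemma electric_field_integrable:
  assumes e: "e > 0" and \<rho>: "charge \<rho>"
  shows "integrable lborel (\<lambda>y. \<rho> y *\<^sub>R reg_field e (x - y))"
proof (rule Bochner_Integration.integrable_bound[OF integrable_mult_right[OF chargeD(1)[OF \<rho>], of "1 / e\<^sup>2"]])
  have [measurable]: "\<rho> \<in> borel_measurable borel" by (rule chargeD[OF \<rho>])
  show "(\<lambda>y. \<rho> y *\<^sub>R reg_field e (x - y)) \<in> borel_measurable lborel" by measurable
  show "AE y in lborel. norm (\<rho> y *\<^sub>R reg_field e (x - y)) \<le> norm (1 / e\<^sup>2 * \<rho> y)"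
    using mult_left_mono[OF reg_field_bounded[OF e] chargeD(2)[OF \<rho>]] chargeD(2)[OF \<rho>] by auto
qed

definition reg_pair_kernel :: "real \<Rightarrow> R3 \<Rightarrow> real" where
  "reg_pair_kernel e w = (LINT x|lborel. reg_delta 1 x * reg_kernel e (e *\<^sub>R x - w))"

text \<open>Expand both superpositions and integrate over space first: each pair of points
  contributes the interaction energy \<open>reg_pair_kernel\<close>. Cauchy-Schwarz and translation
  invariance bound the spatial integral uniformly over pairs, which justifies Fubini.\<close>

lemma electric_field_energy:
  assumes e: "e > 0" and \<rho>: "charge \<rho>" and \<sigma>: "charge \<sigma>"
  shows "integrable lborel (\<lambda>x. electric_field e \<rho> x \<bullet> electric_field e \<sigma> x)"
    and "(LINT x|lborel. electric_field e \<rho> x \<bullet> electric_field e \<sigma> x) =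
      (LINT p|(lborel \<Otimes>\<^sub>M lborel). (case p of (y, z) \<Rightarrow> \<rho> y * \<sigma> z * reg_pair_kernel e (y - z)))"
proof -
  have [measurable]: "\<rho> \<in> borel_measurable borel" "\<sigma> \<in> borel_measurable borel"
    by (rule chargeD[OF \<rho>], rule chargeD[OF \<sigma>])
  \<comment> \<open>The two charge positions are packed into one variable \<open>p\<close>, so that
    a triple integral is handled by the two-factor Fubini theorem.\<close>
  define P where "P p x = \<rho> (fst p) * \<sigma> (snd p) * (reg_field e (x - fst p) \<bullet> reg_field e (x - snd p))" for p ::
      "R3 \<times> R3" and x
  have "fst \<in> borel_measurable (lborel :: (R3 \<times> R3) measure)" "snd \<in> borel_measurable (lborel :: (R3 \<times> R3) measure)"
    by (simp_all add: borel_measurable_continuous_onI continuous_on_fst continuous_on_snd)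
  note m = this[THEN measurable_compose[OF measurable_fst]]
  have [measurable]: "case_prod P \<in> borel_measurable (lborel \<Otimes>\<^sub>M (lborel :: R3 measure))"
    unfolding P_def split_beta'
    by (intro borel_measurable_times borel_measurable_inner measurable_compose[OF m(1), of \<rho>] measurable_compose[OF
        m(2), of \<sigma>]
      measurable_compose[OF _ reg_measurable(3)] borel_measurable_diff m) measurable
  have sq: "square_integrable (\<lambda>x. reg_field e (x - y))" "L2norm (\<lambda>x. reg_field e (x - y)) = L2norm (reg_field e)" for y
    using square_integrable_translate[OF reg_field_square_integrable[OF e], of "- y"] L2norm_translate[of
        "reg_field e" "- y"] by simp_all
  have ii: "integrable lborel (\<lambda>x. reg_field e (x - y) \<bullet> reg_field e (x - z))" for y z
    by (rule square_integrable_inner_integrable[OF sq(1) sq(1)])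
  have absP: "(LINT x|lborel. \<bar>P p x\<bar>) \<le> \<rho> (fst p) * \<sigma> (snd p) * (L2norm (reg_field e) * L2norm (reg_field e))" for p
  proof -
    have "(LINT x|lborel. \<bar>reg_field e (x - fst p) \<bullet> reg_field e (x - snd p)\<bar>) \<le>
       (LINT x|lborel. norm (reg_field e (x - fst p)) * norm (reg_field e (x - snd p)))"
      by (intro integral_mono integrable_abs ii square_integrable_mult_integrable sq Cauchy_Schwarz_ineq2)
    also have "\<dots> \<le> L2norm (reg_field e) * L2norm (reg_field e)"
      using Cauchy_Schwarz_L2norm[OF sq(1) sq(1), of "fst p" "snd p"] by (simp add: sq(2))
    finally show ?thesis
      unfolding P_def using chargeD(2)[OF \<rho>, of "fst p"] chargeD(2)[OF \<sigma>, of "snd p"]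
      by (simp add: abs_mult mult_left_mono)
  qed
  have \<rho>\<sigma>: "integrable lborel (\<lambda>p. \<rho> (fst p) * \<sigma> (snd p))"
    using integrable_pair_mult[OF chargeD(1)[OF \<rho>] chargeD(1)[OF \<sigma>]] by (simp add: lborel_prod split_beta')
  have Pint: "integrable (lborel \<Otimes>\<^sub>M lborel) (case_prod P)"
  proof (rule lborel_pair.Fubini_integrable)
    show "integrable lborel (\<lambda>p. LINT x|lborel. norm (case_prod P (p, x)))"
    proof (rule Bochner_Integration.integrable_bound[OF integrable_mult_left[OF \<rho>\<sigma>, of
        "L2norm (reg_field e) * L2norm (reg_field e)"]])
      show "AE p in lborel. norm (LINT x|lborel. norm (case_prod P (p, x)))
          \<le> norm (\<rho> (fst p) * \<sigma> (snd p) * (L2norm (reg_field e) * L2norm (reg_field e)))"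
        using absP by (auto intro!: AE_I2 order_trans[OF _ abs_ge_self])
    qed measurable
    show "AE p in lborel. integrable lborel (\<lambda>x. case_prod P (p, x))"
      using ii by (simp add: P_def)
  qed measurable
  have inner: "(LINT p|lborel. P p x) = electric_field e \<rho> x \<bullet> electric_field e \<sigma> x" for x
  proof -
    have pi: "integrable (lborel \<Otimes>\<^sub>M lborel) (\<lambda>(y, z). (\<rho> y *\<^sub>R reg_field e (x - y)) \<bullet> (\<sigma> z *\<^sub>R reg_field e (x - z)))"
    proof (rule Bochner_Integration.integrable_bound)
      show "integrable (lborel \<Otimes>\<^sub>M lborel) (\<lambda>(y, z). norm (\<rho> y *\<^sub>R reg_field e (x - y)) * norm (\<sigma> z *\<^sub>R reg_field e (x
          - z)))"
        by (intro integrable_pair_mult integrable_norm electric_field_integrable e \<rho> \<sigma>)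
      show "AE p in lborel \<Otimes>\<^sub>M lborel. norm (case p of (y, z) \<Rightarrow> (\<rho> y *\<^sub>R reg_field e (x - y)) \<bullet> (\<sigma> z *\<^sub>R reg_field e
          (x - z)))
        \<le> norm (case p of (y, z) \<Rightarrow> norm (\<rho> y *\<^sub>R reg_field e (x - y)) * norm (\<sigma> z *\<^sub>R reg_field e (x - z)))"
        by (rule AE_I2) (auto simp: abs_mult mult_ac intro!: mult_left_mono order_trans[OF Cauchy_Schwarz_ineq2])
    qed measurable
    have "(LINT p|lborel. P p x) = (LINT p|(lborel \<Otimes>\<^sub>M lborel). (case p of (y, z) \<Rightarrow> (\<rho> y *\<^sub>R reg_field e (x - y)) \<bullet> (\<sigma>
        z *\<^sub>R reg_field e (x - z))))"
      unfolding lborel_prod by (rule Bochner_Integration.integral_cong) (auto simp: P_def split_beta')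
    also have "\<dots> = (LINT y|lborel. LINT z|lborel. (\<rho> y *\<^sub>R reg_field e (x - y)) \<bullet> (\<sigma> z *\<^sub>R reg_field e (x - z)))"
      using lborel_pair.integral_fst'[OF pi] by simp
    also have "\<dots> = (LINT y|lborel. (\<rho> y *\<^sub>R reg_field e (x - y)) \<bullet> electric_field e \<sigma> x)"
      using electric_field_integrable[OF e \<sigma>, of x] by (simp only: electric_field_def integral_inner_right)
    also have "\<dots> = electric_field e \<rho> x \<bullet> electric_field e \<sigma> x"
      using electric_field_integrable[OF e \<rho>, of x] by (subst integral_inner_left) (auto simp: electric_field_def)
    finally show ?thesis .
  qed
  show "integrable lborel (\<lambda>x. electric_field e \<rho> x \<bullet> electric_field e \<sigma> x)"
    using lborel_pair.integrable_snd[OF Pint] by (simp add: inner)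
  have "(LINT x|lborel. electric_field e \<rho> x \<bullet> electric_field e \<sigma> x) = (LINT x|lborel. LINT p|lborel. P p x)"
    by (simp add: inner)
  also have "\<dots> = (LINT p|lborel. LINT x|lborel. P p x)"
    by (rule lborel_pair.Fubini_integral[OF Pint])
  also have "\<dots> = (LINT p|lborel. (case p of (y, z) \<Rightarrow> \<rho> y * \<sigma> z * reg_pair_kernel e (y - z)))"
  proof (rule Bochner_Integration.integral_cong[OF refl])
    fix p :: "R3 \<times> R3"
    obtain y z where p: "p = (y, z)" by (cases p)
    have "(LINT x|lborel. reg_field e (x - y) \<bullet> reg_field e (x - z))
        = (LINT x|lborel. reg_field e (x - (y - z)) \<bullet> reg_field e x)"
      using integral_translate(1)[of "\<lambda>x. reg_field e (x - y) \<bullet> reg_field e (x - z)" z] by (simp add: algebra_simps)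
    also have "\<dots> = reg_pair_kernel e (y - z)"
      unfolding reg_pair_kernel_def by (rule integral_reg_field_reg_field[OF e])
    finally show "(LINT x|lborel. P p x) = (case p of (y, z) \<Rightarrow> \<rho> y * \<sigma> z * reg_pair_kernel e (y - z))"
      by (simp add: P_def p)
  qed
  finally show "(LINT x|lborel. electric_field e \<rho> x \<bullet> electric_field e \<sigma> x) =
      (LINT p|(lborel \<Otimes>\<^sub>M lborel). (case p of (y, z) \<Rightarrow> \<rho> y * \<sigma> z * reg_pair_kernel e (y - z)))"
    by (simp add: lborel_prod)
qed

lemma electric_field_square_integrable:
  assumes e: "e > 0" and \<rho>: "charge \<rho>"
  shows "square_integrable (electric_field e \<rho>)"
proof -
  have [measurable]: "\<rho> \<in> borel_measurable borel" by (rule chargeD[OF \<rho>])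
  have "electric_field e \<rho> \<in> borel_measurable borel"
    unfolding electric_field_def[abs_def] by measurable
  with electric_field_energy(1)[OF e \<rho> \<rho>] show ?thesis
    by (simp add: square_integrable_def dot_square_norm)
qed

lemma reg_pair_kernel_bound:
  assumes e: "e > 0" and w: "w \<noteq> 0"
  shows "0 \<le> reg_pair_kernel e w"
    "reg_pair_kernel e w \<le> (LINT x|lborel. reg_delta 1 x * (1 + norm x)) / (4 * pi * norm w)"
    "integrable lborel (\<lambda>x. reg_delta 1 x * reg_kernel e (e *\<^sub>R x - w))"
    "\<bar>reg_delta 1 x * reg_kernel e (e *\<^sub>R x - w)\<bar> \<le> reg_delta 1 x * (1 + norm x) / (4 * pi * norm w)"
proof -
  have pos: "0 \<le> reg_delta 1 x * reg_kernel e (e *\<^sub>R x - w)" for x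
    using reg_delta_nonneg[of 1 x] reg_kernel_le[OF e, of "e *\<^sub>R x - w"] by simp
  then show "0 \<le> reg_pair_kernel e w" by (simp add: reg_pair_kernel_def)
  have le: "reg_delta 1 x * reg_kernel e (e *\<^sub>R x - w) \<le> reg_delta 1 x * (1 + norm x) / (4 * pi * norm w)" for x
  proof -
    have "reg_kernel e (e *\<^sub>R x - w) \<le> (1 + norm x) / (4 * pi) / norm w"
      using norm_mult_reg_kernel_le[OF e, of w x] w by (simp add: pos_le_divide_eq mult_ac)
    then have "reg_delta 1 x * reg_kernel e (e *\<^sub>R x - w) \<le> reg_delta 1 x * ((1 + norm x) / (4 * pi) / norm w)"
      by (intro mult_left_mono) (auto simp: reg_delta_nonneg)
    then show ?thesis by simp
  qed
  then show "\<bar>reg_delta 1 x * reg_kernel e (e *\<^sub>R x - w)\<bar> \<le> reg_delta 1 x * (1 + norm x) / (4 * pi * norm w)"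
    using pos by simp
  have di: "integrable lborel (\<lambda>x. reg_delta 1 x * (1 + norm x) / (4 * pi * norm w))"
    using reg_delta_weight_integrable by simp
  show i: "integrable lborel (\<lambda>x. reg_delta 1 x * reg_kernel e (e *\<^sub>R x - w))"
    by (rule Bochner_Integration.integrable_bound[OF di])
      (use le pos in \<open>auto intro!: AE_I2 intro: order_trans[OF _ abs_ge_self] simp del: abs_mult abs_divide\<close>)
  show "reg_pair_kernel e w \<le> (LINT x|lborel. reg_delta 1 x * (1 + norm x)) / (4 * pi * norm w)"
    unfolding reg_pair_kernel_def using integral_mono[OF i di le] by simp
qed

lemma reg_pair_kernel_tendsto:
  assumes e: "\<And>n. e n > 0" "e \<longlonglongrightarrow> 0" and w: "w \<noteq> 0"
  shows "(\<lambda>n. reg_pair_kernel (e n) w) \<longlonglongrightarrow> 1 / (4 * pi * norm w)"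
proof -
  have "(\<lambda>n. reg_pair_kernel (e n) w) \<longlonglongrightarrow> (LINT x|lborel. reg_delta 1 x * (1 / (4 * pi * norm w)))"
    unfolding reg_pair_kernel_def
  proof (rule integral_dominated_convergence)
    show "integrable lborel (\<lambda>x. reg_delta 1 x * (1 + norm x) / (4 * pi * norm w))"
      using reg_delta_weight_integrable by simp
    show "AE x in lborel. (\<lambda>n. reg_delta 1 x * reg_kernel (e n) (e n *\<^sub>R x - w)) \<longlonglongrightarrow> reg_delta 1 x * (1 / (4 * pi * norm w))"
      by (intro AE_I2 tendsto_mult tendsto_const reg_kernel_tendsto e w)
    show "AE x in lborel. norm (reg_delta 1 x * reg_kernel (e n) (e n *\<^sub>R x - w))
        \<le> reg_delta 1 x * (1 + norm x) / (4 * pi * norm w)" for n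
      using reg_pair_kernel_bound(4)[OF e(1) w] by simp
  qed measurable
  also have "(LINT x|lborel. reg_delta 1 x * (1 / (4 * pi * norm w))) = 1 / (4 * pi * norm w)"
    using reg_delta_integral by simp
  finally show ?thesis .
qed

text \<open>Off the diagonal, a null set, the interaction kernels converge to the Newton kernel and
  stay below a multiple of it that does not depend on \<open>n\<close>; the Coulomb integrand itself
  is thus the dominating function.\<close>

lemma electric_field_energy_tendsto:
  assumes e: "\<And>n. e n > 0" "e \<longlonglongrightarrow> 0" and \<rho>: "charge \<rho>" and \<sigma>: "charge \<sigma>"
  shows "(\<lambda>n. LINT x|lborel. electric_field (e n) \<rho> x \<bullet> electric_field (e n) \<sigma> x) \<longlonglongrightarrow> coulomb \<rho> \<sigma>"
proof -
  have [measurable]: "\<rho> \<in> borel_measurable borel" "\<sigma> \<in> borel_measurable borel"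
    by (rule chargeD[OF \<rho>], rule chargeD[OF \<sigma>])
  have [measurable]: "reg_pair_kernel (e n) \<in> borel_measurable borel" for n
    unfolding reg_pair_kernel_def[abs_def] by measurable
  define C where "C = (LINT x|lborel. reg_delta 1 (x::R3) * (1 + norm x))"
  have ne: "AE p in lborel \<Otimes>\<^sub>M lborel. fst p \<noteq> (snd p :: R3)"
  proof (rule lborel_pair.AE_pair_measure)
    show "{p \<in> space (lborel \<Otimes>\<^sub>M lborel). fst p \<noteq> (snd p :: R3)} \<in> sets (lborel \<Otimes>\<^sub>M lborel)" by measurable
    show "AE x in lborel. AE y in lborel. fst (x, y) \<noteq> (snd (x, y) :: R3)"
      using AE_neq by (auto simp: eq_commute)
  qed
  have nn: "0 \<le> \<rho> y * \<sigma> z" for y z using chargeD(2)[OF \<rho>] chargeD(2)[OF \<sigma>] by simp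
  show ?thesis
    unfolding electric_field_energy(2)[OF e(1) \<rho> \<sigma>] charge_pair_integrable(2)[OF \<rho> \<sigma>]
  proof (rule integral_dominated_convergence)
    show "integrable (lborel \<Otimes>\<^sub>M lborel) (\<lambda>p. C * (case p of (y, z) \<Rightarrow> \<rho> y * \<sigma> z / (4 * pi * norm (y - z))))"
      by (rule integrable_mult_right[OF charge_pair_integrable(1)[OF \<rho> \<sigma>]])
    show "AE p in lborel \<Otimes>\<^sub>M lborel. (\<lambda>n. case p of (y, z) \<Rightarrow> \<rho> y * \<sigma> z * reg_pair_kernel (e n) (y - z))
        \<longlonglongrightarrow> (case p of (y, z) \<Rightarrow> \<rho> y * \<sigma> z / (4 * pi * norm (y - z)))"
      using ne
    proof eventually_elim
      case (elim p)
      then have "(\<lambda>n. reg_pair_kernel (e n) (fst p - snd p)) \<longlonglongrightarrow> 1 / (4 * pi * norm (fst p - snd p))"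
        by (intro reg_pair_kernel_tendsto e) auto
      from tendsto_mult[OF tendsto_const[of "\<rho> (fst p) * \<sigma> (snd p)"] this] show ?case
        by (simp add: split_beta')
    qed
    show "AE p in lborel \<Otimes>\<^sub>M lborel. norm (case p of (y, z) \<Rightarrow> \<rho> y * \<sigma> z * reg_pair_kernel (e n) (y - z))
        \<le> C * (case p of (y, z) \<Rightarrow> \<rho> y * \<sigma> z / (4 * pi * norm (y - z)))" for n
      using ne
    proof eventually_elim
      case (elim p)
      then have w: "fst p - snd p \<noteq> 0" by simp
      have "\<rho> (fst p) * \<sigma> (snd p) * reg_pair_kernel (e n) (fst p - snd p)
          \<le> \<rho> (fst p) * \<sigma> (snd p) * (C / (4 * pi * norm (fst p - snd p)))"
        unfolding C_def by (intro mult_left_mono reg_pair_kernel_bound(2) e w nn)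
      moreover have "0 \<le> \<rho> (fst p) * \<sigma> (snd p) * reg_pair_kernel (e n) (fst p - snd p)"
        using reg_pair_kernel_bound(1)[OF e(1) w, of n] nn[of "fst p" "snd p"] by simp
      ultimately show ?case
        by (simp add: split_beta' abs_of_nonneg) (simp add: mult_ac)
    qed
  qed measurable
qed

text \<open>The Coulomb form is a limit of L2 inner products of fields, so it inherits their
  Cauchy-Schwarz inequality. This replaces a Fourier argument for positivity of the kernel.\<close>

lemma coulomb_Cauchy_Schwarz:
  assumes \<rho>: "charge \<rho>" and \<sigma>: "charge \<sigma>"
  shows "0 \<le> coulomb \<rho> \<rho>" "coulomb \<rho> \<sigma> \<le> sqrt (coulomb \<rho> \<rho>) * sqrt (coulomb \<sigma> \<sigma>)"
proof -
  define e where "e n = 1 / real (Suc n)" for n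
  have e: "e n > 0" for n by (auto simp: e_def)
  have e0: "e \<longlonglongrightarrow> 0"
    unfolding e_def[abs_def] using LIMSEQ_inverse_real_of_nat by (simp add: inverse_eq_divide)
  show "0 \<le> coulomb \<rho> \<rho>"
    unfolding coulomb_def using chargeD(2)[OF \<rho>] chargeD(4)[OF \<rho>] by simp
  have sq: "L2norm (electric_field (e n) \<rho>)
      = sqrt (LINT x|lborel. electric_field (e n) \<rho> x \<bullet> electric_field (e n) \<rho> x)" for n \<rho>
    by (simp add: L2norm_def dot_square_norm)
  show "coulomb \<rho> \<sigma> \<le> sqrt (coulomb \<rho> \<rho>) * sqrt (coulomb \<sigma> \<sigma>)"
  proof (rule LIMSEQ_le[OF electric_field_energy_tendsto[OF e e0 \<rho> \<sigma>]])
    show "(\<lambda>n. L2norm (electric_field (e n) \<rho>) * L2norm (electric_field (e n) \<sigma>)) \<longlonglongrightarrow> sqrt (coulomb \<rho> \<rho>) * sqrt (coulomb \<sigma> \<sigma>)"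
      unfolding sq by (intro tendsto_intros electric_field_energy_tendsto e e0 \<rho> \<sigma>)
    show "\<exists>N. \<forall>n\<ge>N. (LINT x|lborel. electric_field (e n) \<rho> x \<bullet> electric_field (e n) \<sigma> x)
        \<le> L2norm (electric_field (e n) \<rho>) * L2norm (electric_field (e n) \<sigma>)"
      using Cauchy_Schwarz_L2norm_inner[OF electric_field_square_integrable[OF e \<rho>] electric_field_square_integrable[OF e \<sigma>]]
      by (meson abs_le_D1)
  qed
qed

text \<open>Duality between the gradient norm and the Coulomb energy: the integral of
  \<open>\<rho> y * \<psi> y\<close> is the limit of the L2 pairings of \<open>G\<close> with the
  regularised fields.\<close>

lemma integral_charge_mult_le_compact:
  assumes \<rho>: "charge \<rho>"
    and \<psi>: "\<And>x. GDERIV \<psi> x :> G x" "continuous_on UNIV G"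
    and supp: "\<And>x. norm x > r \<Longrightarrow> \<psi> x = 0" "\<And>x. norm x > r \<Longrightarrow> G x = 0"
  shows "(LINT y|lborel. \<rho> y * \<psi> y) \<le> L2norm G * sqrt (coulomb \<rho> \<rho>)"
proof -
  have \<psi>c: "continuous_on UNIV \<psi>"
    using \<psi>(1) by (auto simp: gderiv_def continuous_on_eq_continuous_at intro: has_derivative_continuous)
  have [measurable]: "\<rho> \<in> borel_measurable borel" "\<psi> \<in> borel_measurable borel" "G \<in> borel_measurable borel"
    by (rule chargeD[OF \<rho>], rule borel_measurable_continuous_onI[OF \<psi>c], rule borel_measurable_continuous_onI[OF \<psi>(2)])
  obtain B where B: "B \<ge> 0" "\<And>x. norm (\<psi> x) \<le> B"
    by (rule bounded_continuous_compact_support[of \<psi> r]) (use \<psi>c supp in auto)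
  have Gs: "square_integrable G" by (rule square_integrable_continuous_compact_support[OF \<psi>(2) supp(2)])
  have Gi: "integrable lborel G" by (rule integrable_continuous_compact_support[OF \<psi>(2) supp(2)])
  define e where "e n = 1 / real (Suc n)" for n
  have e: "e n > 0" for n by (auto simp: e_def)
  have e0: "e \<longlonglongrightarrow> 0"
    unfolding e_def[abs_def] using LIMSEQ_inverse_real_of_nat by (simp add: inverse_eq_divide)
  \<comment> \<open>The average of \<open>\<psi>\<close> around \<open>y\<close> at scale
    \<open>e n\<close>; it is what integration by parts against the field yields, and it converges
    to \<open>\<psi> y\<close> as the density has mass 1.\<close>
  define J where "J n y = (LINT x|lborel. reg_delta 1 x * \<psi> (e n *\<^sub>R x + y))" for n y
  have [measurable]: "J n \<in> borel_measurable borel" for n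
    unfolding J_def[abs_def] by measurable
  have Jdom: "norm (reg_delta 1 x * \<psi> (e n *\<^sub>R x + y)) \<le> reg_delta 1 x * B" for n x y
    using B(2)[of "e n *\<^sub>R x + y"] reg_delta_nonneg[of 1 x] by (simp add: abs_mult mult_left_mono)
  have JB: "\<bar>J n y\<bar> \<le> B" for n y
  proof -
    have "norm (J n y) \<le> (LINT x|lborel. norm (reg_delta 1 x * \<psi> (e n *\<^sub>R x + y)))"
      unfolding J_def by (rule integral_norm_bound)
    also have "\<dots> \<le> (LINT x|lborel. reg_delta 1 (x::R3) * B)"
    proof (rule integral_mono[OF _ integrable_mult_left[OF reg_delta_integrable, of B] Jdom])
      show "integrable lborel (\<lambda>x. norm (reg_delta 1 x * \<psi> (e n *\<^sub>R x + y)))"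
      proof (rule Bochner_Integration.integrable_bound[OF integrable_mult_left[OF reg_delta_integrable, of B]])
        show "AE x in lborel. norm (norm (reg_delta 1 x * \<psi> (e n *\<^sub>R x + y))) \<le> norm (reg_delta 1 x * B)"
          using order_trans[OF Jdom abs_ge_self] by (intro AE_I2) simp
      qed measurable
    qed
    finally show ?thesis by (simp add: reg_delta_integral)
  qed
  have Jlim: "(\<lambda>n. J n y) \<longlonglongrightarrow> \<psi> y" for y
  proof -
    have "(\<lambda>n. J n y) \<longlonglongrightarrow> (LINT x|lborel. reg_delta 1 x * \<psi> y)"
      unfolding J_def
    proof (rule integral_dominated_convergence[OF _ _ integrable_mult_left[OF reg_delta_integrable, of B]])
      have "(\<lambda>n. \<psi> (e n *\<^sub>R x + y)) \<longlonglongrightarrow> \<psi> (0 *\<^sub>R x + y)" for x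
        by (intro continuous_on_tendsto_compose[OF \<psi>c] tendsto_intros e0) auto
      then show "AE x in lborel. (\<lambda>n. reg_delta 1 x * \<psi> (e n *\<^sub>R x + y)) \<longlonglongrightarrow> reg_delta 1 x * \<psi> y"
        by (intro AE_I2 tendsto_mult tendsto_const) simp
    qed (use Jdom in auto)
    then show ?thesis by (simp add: reg_delta_integral)
  qed
  have lim: "(\<lambda>n. LINT y|lborel. \<rho> y * J n y) \<longlonglongrightarrow> (LINT y|lborel. \<rho> y * \<psi> y)"
  proof (rule integral_dominated_convergence[OF _ _ integrable_mult_left[OF chargeD(1)[OF \<rho>], of B]])
    show "AE y in lborel. (\<lambda>n. \<rho> y * J n y) \<longlonglongrightarrow> \<rho> y * \<psi> y"
      by (intro AE_I2 tendsto_mult tendsto_const Jlim)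
    show "AE y in lborel. norm (\<rho> y * J n y) \<le> \<rho> y * B" for n
      using JB chargeD(2)[OF \<rho>] by (auto simp: abs_mult intro!: mult_left_mono)
  qed measurable
  have field: "(LINT y|lborel. \<rho> y * J n y) = (LINT x|lborel. G x \<bullet> electric_field (e n) \<rho> x)" for n
  proof -
    have pi: "integrable (lborel \<Otimes>\<^sub>M lborel) (\<lambda>(y, x). \<rho> y * (G x \<bullet> reg_field (e n) (x - y)))"
    proof (rule Bochner_Integration.integrable_bound)
      show "integrable (lborel \<Otimes>\<^sub>M lborel) (\<lambda>(y, x). \<rho> y * (norm (G x) * (1 / (e n)\<^sup>2)))"
        by (intro integrable_pair_mult chargeD(1)[OF \<rho>] integrable_mult_left integrable_norm Gi)
      have "\<rho> y * \<bar>G x \<bullet> reg_field (e n) (x - y)\<bar> \<le> \<rho> y * (norm (G x) * (1 / (e n)\<^sup>2))" for x y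
        by (intro mult_left_mono chargeD(2)[OF \<rho>] order_trans[OF Cauchy_Schwarz_ineq2])
          (rule reg_field_bounded[OF e], rule norm_ge_zero)
      then show "AE p in lborel \<Otimes>\<^sub>M lborel. norm (case p of (y, x) \<Rightarrow> \<rho> y * (G x \<bullet> reg_field (e n) (x - y)))
          \<le> norm (case p of (y, x) \<Rightarrow> \<rho> y * (norm (G x) * (1 / (e n)\<^sup>2)))"
        using chargeD(2)[OF \<rho>]
        by (intro AE_I2) (auto simp: abs_mult)
    qed measurable
    have "(LINT y|lborel. \<rho> y * J n y) = (LINT y|lborel. LINT x|lborel. \<rho> y * (G x \<bullet> reg_field (e n) (x - y)))"
    proof -
      have "J n y = (LINT x|lborel. G x \<bullet> reg_field (e n) (x - y))" for y
        unfolding J_def by (rule integral_inner_reg_field_compact[OF e \<psi> supp, symmetric])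
      then show ?thesis by simp
    qed
    also have "\<dots> = (LINT x|lborel. LINT y|lborel. \<rho> y * (G x \<bullet> reg_field (e n) (x - y)))"
      by (rule lborel_pair.Fubini_integral[OF pi, symmetric])
    also have "\<dots> = (LINT x|lborel. G x \<bullet> electric_field (e n) \<rho> x)"
      using integral_inner_right[OF electric_field_integrable[OF e \<rho>]]
      by (simp add: electric_field_def)
    finally show ?thesis .
  qed
  have sq: "L2norm (electric_field (e n) \<rho>)
      = sqrt (LINT x|lborel. electric_field (e n) \<rho> x \<bullet> electric_field (e n) \<rho> x)" for n
    by (simp add: L2norm_def dot_square_norm)
  show ?thesis
  proof (rule LIMSEQ_le[OF lim])
    show "(\<lambda>n. L2norm G * L2norm (electric_field (e n) \<rho>)) \<longlonglongrightarrow> L2norm G * sqrt (coulomb \<rho> \<rho>)"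
      unfolding sq by (intro tendsto_intros electric_field_energy_tendsto e e0 \<rho>)
    show "\<exists>N. \<forall>n\<ge>N. (LINT y|lborel. \<rho> y * J n y) \<le> L2norm G * L2norm (electric_field (e n) \<rho>)"
      unfolding field using Cauchy_Schwarz_L2norm_inner[OF Gs electric_field_square_integrable[OF e \<rho>]]
      by (meson abs_le_D1)
  qed
qed

section \<open>Coulomb bounds for the charges of \<open>H1\<close> functions\<close>

lemma charge_square:
  assumes u: "square_integrable u" and g: "has_L2_weak_gradient u g"
  shows "charge (\<lambda>y. (u y)\<^sup>2)" "potential (\<lambda>y. (u y)\<^sup>2) = newton_potential u"
proof -
  show 1: "potential (\<lambda>y. (u y)\<^sup>2) = newton_potential u"
    by (simp add: fun_eq_iff potential_def newton_potential_def)
  show "charge (\<lambda>y. (u y)\<^sup>2)"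
    unfolding charge_def 1 using newton_potential_bound[OF u g] square_integrableD[OF u] by auto
qed

text \<open>A differentiable substitute for \<open>\<bar>f x\<bar>\<close>. Subtracting
  \<open>d\<close> preserves the zeros, hence compact support, and the factor in front of
  \<open>D\<close> has modulus at most 1, so the gradient norm does not grow.\<close>

lemma GDERIV_smooth_abs:
  fixes f :: "'a::real_inner \<Rightarrow> real"
  assumes f: "GDERIV f x :> D" and d: "d > 0"
  shows "GDERIV (\<lambda>x. sqrt ((f x)\<^sup>2 + d\<^sup>2) - d) x :> (f x / sqrt ((f x)\<^sup>2 + d\<^sup>2)) *\<^sub>R D"
proof -
  have pos: "(f x)\<^sup>2 + d\<^sup>2 > 0" using d by (simp add: add_nonneg_pos)
  have "DERIV (\<lambda>t. sqrt (t\<^sup>2 + d\<^sup>2) - d) (f x) :> f x / sqrt ((f x)\<^sup>2 + d\<^sup>2)"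
  proof -
    have "DERIV (\<lambda>t. t\<^sup>2 + d\<^sup>2) (f x) :> 2 * f x" by (auto intro!: derivative_eq_intros)
    from DERIV_diff[OF DERIV_chain2[OF DERIV_real_sqrt[OF pos] this] DERIV_const[of d]] show ?thesis
      by (rule DERIV_cong) (simp add: inverse_eq_divide)
  qed
  with f show ?thesis by (rule GDERIV_DERIV_compose)
qed

text \<open>Apply the compactly supported case to the smoothed absolute values of \<open>v\<close>
  and let the smoothing parameter tend to 0.\<close>

lemma integral_charge_test_function_le:
  assumes \<rho>: "charge \<rho>" and v: "v \<in> test_functions"
  shows "integrable lborel (\<lambda>x. \<rho> x * \<bar>v x\<bar>)"
    and "(LINT x|lborel. \<rho> x * \<bar>v x\<bar>) \<le> L2norm (grad v) * sqrt (coulomb \<rho> \<rho>)"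
proof -
  obtain r where r: "r > 0" "\<And>x. norm x > r \<Longrightarrow> v x = 0" "\<And>x. norm x > r \<Longrightarrow> grad v x = 0"
    by (rule test_function_supp[OF v]) blast
  have vc: "continuous_on UNIV v" "continuous_on UNIV (grad v)"
    using v by (auto intro: smooth_continuous_on smooth_grad_continuous_on test_function_smooth)
  obtain B where B: "B \<ge> 0" "\<And>x. norm (v x) \<le> B"
    by (rule bounded_continuous_compact_support[of v r]) (use vc r in auto)
  have [measurable]: "\<rho> \<in> borel_measurable borel" "v \<in> borel_measurable borel" "grad v \<in> borel_measurable borel"
    by (rule chargeD[OF \<rho>], rule borel_measurable_continuous_onI[OF vc(1)], rule borel_measurable_continuous_onI[OF vc(2)])
  have dom: "\<rho> x * \<bar>v x\<bar> \<le> \<rho> x * B" for x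
    using B(2)[of x] chargeD(2)[OF \<rho>, of x] by (simp add: mult_left_mono)
  show "integrable lborel (\<lambda>x. \<rho> x * \<bar>v x\<bar>)"
  proof (rule Bochner_Integration.integrable_bound[OF integrable_mult_left[OF chargeD(1)[OF \<rho>], of B]])
    show "AE x in lborel. norm (\<rho> x * \<bar>v x\<bar>) \<le> norm (\<rho> x * B)"
      using dom B(1) chargeD(2)[OF \<rho>] by (auto simp: abs_mult)
  qed measurable
  define d where "d n = 1 / real (Suc n)" for n
  have d: "d n > 0" for n by (auto simp: d_def)
  have d0: "d \<longlonglongrightarrow> 0"
    unfolding d_def[abs_def] using LIMSEQ_inverse_real_of_nat by (simp add: inverse_eq_divide)
  define \<psi> where "\<psi> n x = sqrt ((v x)\<^sup>2 + (d n)\<^sup>2) - d n" for n x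
  have [measurable]: "\<psi> n \<in> borel_measurable borel" for n
    unfolding \<psi>_def[abs_def] by measurable
  have \<psi>b: "\<bar>\<psi> n x\<bar> \<le> \<bar>v x\<bar>" for n x
  proof -
    have "sqrt ((v x)\<^sup>2 + (d n)\<^sup>2) \<le> sqrt ((v x)\<^sup>2) + sqrt ((d n)\<^sup>2)"
      by (rule sqrt_add_le_add_sqrt) auto
    moreover have "sqrt ((v x)\<^sup>2 + (d n)\<^sup>2) \<ge> d n"
      by (rule real_le_rsqrt) simp
    ultimately show ?thesis using d[of n] by (simp add: \<psi>_def)
  qed
  have le: "(LINT x|lborel. \<rho> x * \<psi> n x) \<le> L2norm (grad v) * sqrt (coulomb \<rho> \<rho>)" for n
  proof -
    let ?G = "\<lambda>x. (v x / sqrt ((v x)\<^sup>2 + (d n)\<^sup>2)) *\<^sub>R grad v x"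
    have pos: "(v x)\<^sup>2 + (d n)\<^sup>2 > 0" for x using d[of n] by (simp add: add_nonneg_pos)
    have "(LINT x|lborel. \<rho> x * \<psi> n x) \<le> L2norm ?G * sqrt (coulomb \<rho> \<rho>)"
    proof (rule integral_charge_mult_le_compact[OF \<rho>, of _ _ r])
      show "GDERIV (\<psi> n) x :> ?G x" for x
        unfolding \<psi>_def[abs_def] by (rule GDERIV_smooth_abs[OF smooth_GDERIV[OF test_function_smooth[OF v]] d])
      show "continuous_on UNIV ?G"
        by (intro continuous_intros vc) (use pos in \<open>auto simp: less_imp_neq[symmetric]\<close>)
    qed (use r d[of n] in \<open>auto simp: \<psi>_def\<close>)
    also have "L2norm ?G \<le> L2norm (grad v)"
    proof (rule L2norm_mono[OF test_function_square_integrable(2)[OF v]])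
      show "AE x in lborel. norm (?G x) \<le> norm (grad v x)"
      proof (rule AE_I2)
        fix x
        have "\<bar>v x\<bar> \<le> sqrt ((v x)\<^sup>2 + (d n)\<^sup>2)" by (rule real_le_rsqrt) simp
        then have "\<bar>v x\<bar> / sqrt ((v x)\<^sup>2 + (d n)\<^sup>2) \<le> 1"
          using pos[of x] by (simp add: divide_le_eq)
        then show "norm (?G x) \<le> norm (grad v x)"
          using mult_right_mono[of "\<bar>v x\<bar> / sqrt ((v x)\<^sup>2 + (d n)\<^sup>2)" 1 "norm (grad v x)"] by simp
      qed
    qed measurable
    finally show ?thesis
      using coulomb_Cauchy_Schwarz(1)[OF \<rho> \<rho>] by (simp add: mult_right_mono)
  qed
  have "(\<lambda>n. LINT x|lborel. \<rho> x * \<psi> n x) \<longlonglongrightarrow> (LINT x|lborel. \<rho> x * \<bar>v x\<bar>)"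
  proof (rule integral_dominated_convergence[OF _ _ integrable_mult_left[OF chargeD(1)[OF \<rho>], of B]])
    have "(\<lambda>n. \<psi> n x) \<longlonglongrightarrow> sqrt ((v x)\<^sup>2 + 0\<^sup>2) - 0" for x
      unfolding \<psi>_def by (intro tendsto_intros d0)
    then have "(\<lambda>n. \<psi> n x) \<longlonglongrightarrow> \<bar>v x\<bar>" for x by simp
    then show "AE x in lborel. (\<lambda>n. \<rho> x * \<psi> n x) \<longlonglongrightarrow> \<rho> x * \<bar>v x\<bar>"
      by (intro AE_I2 tendsto_mult tendsto_const)
    show "AE x in lborel. norm (\<rho> x * \<psi> n x) \<le> \<rho> x * B" for n
    proof (rule AE_I2)
      fix x
      have "\<rho> x * \<bar>\<psi> n x\<bar> \<le> \<rho> x * B"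
        using \<psi>b[of n x] B(2)[of x] chargeD(2)[OF \<rho>, of x] by (intro mult_left_mono) auto
      then show "norm (\<rho> x * \<psi> n x) \<le> \<rho> x * B"
        using chargeD(2)[OF \<rho>, of x] by (simp add: abs_mult)
    qed
  qed measurable
  then show "(LINT x|lborel. \<rho> x * \<bar>v x\<bar>) \<le> L2norm (grad v) * sqrt (coulomb \<rho> \<rho>)"
    by (rule LIMSEQ_le_const2) (use le in auto)
qed

text \<open>\<open>v n - u\<close> need not be a test function, but \<open>v n - v (r m)\<close> is;
  Fatou's lemma in \<open>m\<close> carries its bound over. Smallness in this weighted L1 sense is
  what the quadratic part of the nonlinearity needs.\<close>

lemma charge_approximation:
  assumes \<rho>: "charge \<rho>" and u: "square_integrable u" and g: "square_integrable g"
    and v: "\<And>n. v n \<in> test_functions" "(\<lambda>n. L2norm (\<lambda>x. v n x - u x)) \<longlonglongrightarrow> 0"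
      "(\<lambda>n. L2norm (\<lambda>x. grad (v n) x - g x)) \<longlonglongrightarrow> 0"
  shows "integrable lborel (\<lambda>x. \<rho> x * \<bar>v n x - u x\<bar>)"
    and "(LINT x|lborel. \<rho> x * \<bar>v n x - u x\<bar>) \<le> L2norm (\<lambda>x. grad (v n) x - g x) * sqrt (coulomb \<rho> \<rho>)"
proof -
  note vs = test_function_square_integrable[OF v(1)]
  have [measurable]: "\<rho> \<in> borel_measurable borel" "u \<in> borel_measurable borel" "v n \<in> borel_measurable borel" for n
    using vs(1)[of n] u chargeD(5)[OF \<rho>] by auto
  obtain r where r: "strict_mono r" "AE x in lborel. (\<lambda>n. v (r n) x) \<longlonglongrightarrow> u x"
    by (rule L2norm_tendsto_AE_subseq[OF vs(1) u v(2)]) blast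
  let ?D = "sqrt (coulomb \<rho> \<rho>)"
  have D: "?D \<ge> 0" using coulomb_Cauchy_Schwarz(1)[OF \<rho> \<rho>] by simp
  have nn: "(\<integral>\<^sup>+x. ennreal (\<rho> x * \<bar>v n x - v (r m) x\<bar>) \<partial>lborel) \<le>
     ennreal ((L2norm (\<lambda>x. grad (v n) x - g x) + L2norm (\<lambda>x. grad (v (r m)) x - g x)) * ?D)" for m
  proof -
    let ?w = "\<lambda>x. v n x - v (r m) x"
    have w: "?w \<in> test_functions" by (rule test_function_diff[OF v(1) v(1)])
    have "(\<integral>\<^sup>+x. ennreal (\<rho> x * \<bar>?w x\<bar>) \<partial>lborel) = ennreal (LINT x|lborel. \<rho> x * \<bar>?w x\<bar>)"
      by (rule nn_integral_eq_integral[OF integral_charge_test_function_le(1)[OF \<rho> w]]) (simp add: chargeD(2)[OF \<rho>])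
    also have "\<dots> \<le> ennreal (L2norm (grad ?w) * ?D)"
      by (rule ennreal_leI[OF integral_charge_test_function_le(2)[OF \<rho> w]])
    also have "grad ?w = (\<lambda>x. grad (v n) x - grad (v (r m)) x)"
      by (rule ext) (rule grad_diff; rule smooth_differentiable[OF test_function_smooth[OF v(1)]])
    also have "ennreal (L2norm (\<lambda>x. grad (v n) x - grad (v (r m)) x) * ?D) \<le>
       ennreal ((L2norm (\<lambda>x. grad (v n) x - g x) + L2norm (\<lambda>x. grad (v (r m)) x - g x)) * ?D)"
      using L2norm_triangle_diff[OF vs(2)[of n] g vs(2)[of "r m"]] L2norm_minus_commute[of g "grad (v (r m))"] D
      by (intro ennreal_leI mult_right_mono) auto
    finally show ?thesis .
  qed
  let ?b = "L2norm (\<lambda>x. grad (v n) x - g x) * ?D"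
  have "(\<integral>\<^sup>+x. ennreal (\<rho> x * \<bar>v n x - u x\<bar>) \<partial>lborel) = (\<integral>\<^sup>+x. liminf (\<lambda>m. ennreal (\<rho> x * \<bar>v n x - v (r m) x\<bar>)) \<partial>lborel)"
  proof (rule nn_integral_cong_AE)
    show "AE x in lborel. ennreal (\<rho> x * \<bar>v n x - u x\<bar>) = liminf (\<lambda>m. ennreal (\<rho> x * \<bar>v n x - v (r m) x\<bar>))"
      using r(2)
    proof eventually_elim
      case (elim x)
      then have "(\<lambda>m. ennreal (\<rho> x * \<bar>v n x - v (r m) x\<bar>)) \<longlonglongrightarrow> ennreal (\<rho> x * \<bar>v n x - u x\<bar>)"
        by (intro tendsto_ennrealI tendsto_intros)
      then show ?case by (simp add: lim_imp_Liminf)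
    qed
  qed
  also have "\<dots> \<le> liminf (\<lambda>m. \<integral>\<^sup>+x. ennreal (\<rho> x * \<bar>v n x - v (r m) x\<bar>) \<partial>lborel)"
    by (rule nn_integral_liminf) measurable
  also have "\<dots> \<le> liminf (\<lambda>m. ennreal ((L2norm (\<lambda>x. grad (v n) x - g x) + L2norm (\<lambda>x. grad (v (r m)) x - g x)) * ?D))"
    by (intro Liminf_mono always_eventually allI nn)
  also have "(\<lambda>m. ennreal ((L2norm (\<lambda>x. grad (v n) x - g x) + L2norm (\<lambda>x. grad (v (r m)) x - g x)) * ?D))
     \<longlonglongrightarrow> ennreal ((L2norm (\<lambda>x. grad (v n) x - g x) + 0) * ?D)"
    using LIMSEQ_subseq_LIMSEQ[OF v(3) r(1)] by (intro tendsto_ennrealI tendsto_intros) (simp add: o_def)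
  then have "liminf (\<lambda>m. ennreal ((L2norm (\<lambda>x. grad (v n) x - g x) + L2norm (\<lambda>x. grad (v (r m)) x - g x)) * ?D))
      = ennreal ?b"
    by (simp add: lim_imp_Liminf)
  finally have le: "(\<integral>\<^sup>+x. ennreal (\<rho> x * \<bar>v n x - u x\<bar>) \<partial>lborel) \<le> ennreal ?b" .
  show i: "integrable lborel (\<lambda>x. \<rho> x * \<bar>v n x - u x\<bar>)"
    by (rule integrableI_bounded) (use le chargeD(2)[OF \<rho>] in \<open>auto simp: le_less_trans[OF _ ennreal_less_top]\<close>)
  have "ennreal (LINT x|lborel. \<rho> x * \<bar>v n x - u x\<bar>) \<le> ennreal ?b"
    using le by (subst (asm) nn_integral_eq_integral[OF i]) (auto simp: chargeD(2)[OF \<rho>])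
  then show "(LINT x|lborel. \<rho> x * \<bar>v n x - u x\<bar>) \<le> ?b"
    using D by (simp add: L2norm_nonneg)
qed

text \<open>With \<open>\<rho>\<close> the square of \<open>u\<close> this bounds the integral of
  the cube of \<open>\<bar>u x\<bar>\<close> by the gradient norm and the Coulomb energy, the
  estimate behind the whole theorem. With the square of the other component it makes the cross terms
  integrable.\<close>

lemma integral_charge_mult_abs_le:
  assumes \<rho>: "charge \<rho>" and u: "square_integrable u" and g: "has_L2_weak_gradient u g"
  shows "integrable lborel (\<lambda>x. \<rho> x * \<bar>u x\<bar>)"
    and "(LINT x|lborel. \<rho> x * \<bar>u x\<bar>) \<le> L2norm g * sqrt (coulomb \<rho> \<rho>)"
proof -
  have gs: "square_integrable g" using g by (simp add: has_L2_weak_gradient_def)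
  obtain v where v: "\<And>n. v n \<in> test_functions" "(\<lambda>n. L2norm (\<lambda>x. v n x - u x)) \<longlonglongrightarrow> 0"
    "(\<lambda>n. L2norm (\<lambda>x. grad (v n) x - g x)) \<longlonglongrightarrow> 0"
    by (rule test_functions_dense[OF u g]) blast
  note vs = test_function_square_integrable[OF v(1)]
  note a = charge_approximation[OF \<rho> u gs v]
  note b = integral_charge_test_function_le[OF \<rho> v(1)]
  have [measurable]: "\<rho> \<in> borel_measurable borel" "u \<in> borel_measurable borel"
    using u chargeD(5)[OF \<rho>] by auto
  have le: "\<rho> x * \<bar>u x\<bar> \<le> \<rho> x * \<bar>v n x - u x\<bar> + \<rho> x * \<bar>v n x\<bar>" for n x
    using chargeD(2)[OF \<rho>, of x] by (simp flip: distrib_left) (intro mult_left_mono, auto)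
  show i: "integrable lborel (\<lambda>x. \<rho> x * \<bar>u x\<bar>)"
  proof (rule Bochner_Integration.integrable_bound[OF Bochner_Integration.integrable_add[OF a(1)[of 0] b(1)[of 0]]])
    show "AE x in lborel. norm (\<rho> x * \<bar>u x\<bar>) \<le> norm (\<rho> x * \<bar>v 0 x - u x\<bar> + \<rho> x * \<bar>v 0 x\<bar>)"
      using le[of _ 0] chargeD(2)[OF \<rho>] by (intro AE_I2) (simp add: abs_mult)
  qed measurable
  let ?D = "sqrt (coulomb \<rho> \<rho>)"
  have "(LINT x|lborel. \<rho> x * \<bar>u x\<bar>) \<le> L2norm (\<lambda>x. grad (v n) x - g x) * ?D + L2norm (grad (v n)) * ?D" for n
  proof -
    have "(LINT x|lborel. \<rho> x * \<bar>u x\<bar>) \<le> (LINT x|lborel. \<rho> x * \<bar>v n x - u x\<bar> + \<rho> x * \<bar>v n x\<bar>)"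
      by (intro integral_mono i Bochner_Integration.integrable_add a b le)
    also have "\<dots> = (LINT x|lborel. \<rho> x * \<bar>v n x - u x\<bar>) + (LINT x|lborel. \<rho> x * \<bar>v n x\<bar>)"
      by (rule Bochner_Integration.integral_add[OF a(1) b(1)])
    finally show ?thesis using a(2)[of n] b(2)[of n] by linarith
  qed
  moreover have "(\<lambda>n. L2norm (\<lambda>x. grad (v n) x - g x) * ?D + L2norm (grad (v n)) * ?D) \<longlonglongrightarrow> 0 * ?D + L2norm g * ?D"
    by (intro tendsto_intros v L2norm_tendsto[OF vs(2) gs])
  ultimately show "(LINT x|lborel. \<rho> x * \<bar>u x\<bar>) \<le> L2norm g * ?D"
    using LIMSEQ_le_const[of _ "0 * ?D + L2norm g * ?D" "LINT x|lborel. \<rho> x * \<bar>u x\<bar>"] by auto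
qed

section \<open>The averaged nonlinearity\<close>

text \<open>The range of \<open>p\<close> enters here: it places the growth of the nonlinearity
  between linear and quadratic, the two cases that the L2 norm and the Coulomb energy
  control.\<close>

lemma powr_le_one_plus:
  assumes "1 < p" "p \<le> 2" "0 \<le> r" shows "r powr (p - 1) \<le> 1 + (r::real)"
proof (cases "r \<le> 1")
  case True
  then have "r powr (p - 1) \<le> 1" using assms by (intro powr_le1) auto
  with assms show ?thesis by simp
next
  case False
  then have "r powr (p - 1) \<le> r powr 1" using assms by (intro powr_mono) auto
  with False show ?thesis by simp
qed

definition phase_sum :: "real \<Rightarrow> real \<Rightarrow> real \<Rightarrow> complex" where
  "phase_sum s t \<theta> = of_real s + exp (\<i> * of_real \<theta>) * of_real t"

lemma phase_sum_Re: "Re (phase_sum s t \<theta>) = s + t * cos \<theta>"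
  by (simp add: phase_sum_def cis_conv_exp[symmetric] mult.commute)

lemma phase_sum_norm_square: "(norm (phase_sum s t \<theta>))\<^sup>2 = s\<^sup>2 + t\<^sup>2 + 2 * s * t * cos \<theta>"
proof -
  have "Im (phase_sum s t \<theta>) = t * sin \<theta>"
    by (simp add: phase_sum_def cis_conv_exp[symmetric] mult.commute)
  then have "(norm (phase_sum s t \<theta>))\<^sup>2 = (s + t * cos \<theta>)\<^sup>2 + (t * sin \<theta>)\<^sup>2"
    by (simp add: cmod_power2 phase_sum_Re)
  also have "\<dots> = s\<^sup>2 + 2 * s * t * cos \<theta> + t\<^sup>2 * ((sin \<theta>)\<^sup>2 + (cos \<theta>)\<^sup>2)"
    by (simp only: power2_sum power_mult_distrib distrib_left)
  finally show ?thesis by simp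
qed

text \<open>The squared norm is symmetric in \<open>s\<close> and \<open>t\<close>. Thus both
  equations carry the same weight at each phase and can be added under the integral.\<close>

lemma phase_sum_norm_commute: "norm (phase_sum s t \<theta>) = norm (phase_sum t s \<theta>)"
  by (rule power2_eq_imp_eq) (simp_all add: phase_sum_norm_square mult.commute mult.left_commute)

lemma phase_sum_norm_le: "norm (phase_sum s t \<theta>) \<le> \<bar>s\<bar> + \<bar>t\<bar>"
  unfolding phase_sum_def
  by (rule order_trans[OF norm_triangle_ineq]) (simp add: norm_mult)

definition phase_term :: "real \<Rightarrow> real \<Rightarrow> real \<Rightarrow> real \<Rightarrow> complex" where
  "phase_term p s t \<theta> = of_real (norm (phase_sum s t \<theta>) powr (p - 1)) * phase_sum s t \<theta>"

lemma averaged_nonlinearity_eq: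
  "averaged_nonlinearity p s t = 1 / (2 * pi) * (LINT \<theta>|lborel. indicator {0..2 * pi} \<theta> *\<^sub>R phase_term p s t \<theta>)"
  by (simp add: averaged_nonlinearity_def set_lebesgue_integral_def phase_term_def phase_sum_def)

lemma phase_term_measurable[measurable]:
  assumes [measurable]: "f \<in> borel_measurable M" "h \<in> borel_measurable M" "k \<in> borel_measurable M"
  shows "(\<lambda>x. phase_term p (f x) (h x) (k x)) \<in> borel_measurable M"
  unfolding phase_term_def phase_sum_def by measurable

lemma phase_term_norm_le:
  assumes "1 < p" "p \<le> 2"
  shows "norm (phase_term p s t \<theta>) \<le> (\<bar>s\<bar> + \<bar>t\<bar>) + (\<bar>s\<bar> + \<bar>t\<bar>)\<^sup>2"
proof -
  let ?r = "norm (phase_sum s t \<theta>)"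
  have "norm (phase_term p s t \<theta>) = ?r powr (p - 1) * ?r"
    by (simp add: phase_term_def norm_mult)
  also have "\<dots> \<le> (1 + ?r) * ?r"
    by (intro mult_right_mono powr_le_one_plus assms) auto
  also have "\<dots> \<le> (1 + (\<bar>s\<bar> + \<bar>t\<bar>)) * (\<bar>s\<bar> + \<bar>t\<bar>)"
    using phase_sum_norm_le[of s t \<theta>] by (intro mult_mono) auto
  finally show ?thesis by (simp add: power2_eq_square algebra_simps)
qed

lemma interval_integrable_bounded:
  fixes f :: "real \<Rightarrow> 'b::{banach, second_countable_topology}"
  assumes [measurable]: "f \<in> borel_measurable borel" and "\<And>\<theta>. norm (f \<theta>) \<le> B"
  shows "integrable lborel (\<lambda>\<theta>. indicator {a..b::real} \<theta> *\<^sub>R f \<theta>)"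
proof (rule Bochner_Integration.integrable_bound)
  show "integrable lborel (\<lambda>\<theta>. indicator {a..b::real} \<theta> * B)"
    by (intro integrable_mult_left integrable_real_indicator) (auto simp: emeasure_lborel_Icc_eq)
  show "AE \<theta> in lborel. norm (indicator {a..b} \<theta> *\<^sub>R f \<theta>) \<le> norm (indicator {a..b} \<theta> * B)"
    using assms(2) by (auto simp: indicator_def intro!: AE_I2 order_trans[OF _ abs_ge_self])
qed measurable

lemma phase_term_integrable:
  assumes "1 < p" "p \<le> 2"
  shows "integrable lborel (\<lambda>\<theta>. indicator {0..2 * pi} \<theta> *\<^sub>R phase_term p s t \<theta>)"
  by (rule interval_integrable_bounded[OF _ phase_term_norm_le[OF assms]]) measurable

lemma averaged_nonlinearity_norm_le:
  assumes "1 < p" "p \<le> 2"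
  shows "norm (averaged_nonlinearity p s t) \<le> (\<bar>s\<bar> + \<bar>t\<bar>) + (\<bar>s\<bar> + \<bar>t\<bar>)\<^sup>2"
proof -
  let ?B = "(\<bar>s\<bar> + \<bar>t\<bar>) + (\<bar>s\<bar> + \<bar>t\<bar>)\<^sup>2"
  have "norm (LINT \<theta>|lborel. indicator {0..2 * pi} \<theta> *\<^sub>R phase_term p s t \<theta>) \<le>
     (LINT \<theta>|lborel. norm (indicator {0..2 * pi} \<theta> *\<^sub>R phase_term p s t \<theta>))"
    by (rule integral_norm_bound)
  also have "\<dots> \<le> (LINT \<theta>|lborel. indicator {0..2 * pi} \<theta> * ?B)"
  proof (intro integral_mono integrable_norm phase_term_integrable assms)
    show "norm (indicator {0..2 * pi} \<theta> *\<^sub>R phase_term p s t \<theta>) \<le> indicator {0..2 * pi} \<theta> * ?B" for \<theta>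
      using phase_term_norm_le[OF assms, of s t \<theta>] by (auto simp: indicator_def)
  qed simp
  also have "\<dots> = 2 * pi * ?B" by simp
  finally show ?thesis
    unfolding averaged_nonlinearity_eq by (simp add: norm_mult norm_divide field_simps)
qed

lemma averaged_nonlinearity_measurable[measurable]:
  assumes [measurable]: "f \<in> borel_measurable M" "h \<in> borel_measurable M"
  shows "(\<lambda>x. averaged_nonlinearity p (f x) (h x)) \<in> borel_measurable M"
  unfolding averaged_nonlinearity_eq by measurable

text \<open>Convexity of the cube, with equality at \<open>a = b\<close>. This is the origin of the
  4 in the theorem.\<close>

lemma sum_cubed_le:
  fixes a b :: real assumes "0 \<le> a" "0 \<le> b" shows "(a + b) ^ 3 \<le> 4 * (a ^ 3 + b ^ 3)"
proof -
  have "4 * (a ^ 3 + b ^ 3) - (a + b) ^ 3 = 3 * ((a + b) * (a - b)\<^sup>2)"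
    by (simp add: power3_eq_cube power2_eq_square algebra_simps)
  also have "\<dots> \<ge> 0" using assms by simp
  finally show ?thesis by simp
qed

text \<open>At each phase the two contributions combine to \<open>r powr (p - 1) * r\<^sup>2\<close>
  with \<open>r\<close> the norm of the phase sum, which is at most
  \<open>r\<^sup>2 + r ^ 3\<close>. Averaging removes the mixed term of
  \<open>r\<^sup>2\<close>.\<close>

lemma averaged_nonlinearity_energy:
  assumes p: "1 < p" "p \<le> 2"
  shows "Re (averaged_nonlinearity p s t) * s + Re (averaged_nonlinearity p t s) * t \<le>
    s\<^sup>2 + t\<^sup>2 + 4 * (\<bar>s\<bar> ^ 3 + \<bar>t\<bar> ^ 3)"
proof -
  let ?I = "\<lambda>\<theta>. indicator {0..2 * pi} \<theta> :: real"
  have Re: "Re (averaged_nonlinearity p s t) = 1 / (2 * pi) * (LINT \<theta>|lborel. ?I \<theta> * Re (phase_term p s t \<theta>))" for s t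
    unfolding averaged_nonlinearity_eq
    using integral_Re[OF phase_term_integrable[OF p, of s t]] by (simp add: complex_eq_iff)
  have Ri: "integrable lborel (\<lambda>\<theta>. ?I \<theta> * Re (phase_term p s t \<theta>))" for s t
    using integrable_Re[OF phase_term_integrable[OF p, of s t]] by simp
  define C where "C = s\<^sup>2 + t\<^sup>2 + 4 * (\<bar>s\<bar> ^ 3 + \<bar>t\<bar> ^ 3)"
  have ci: "integrable lborel (\<lambda>\<theta>. ?I \<theta> * cos \<theta>)"
    using interval_integrable_bounded[of "cos :: real \<Rightarrow> real" 1 0 "2 * pi"] by simp
  have c0: "(LINT \<theta>|lborel. ?I \<theta> * cos \<theta>) = 0"
  proof -
    have "(LINT \<theta>|lborel. cos \<theta> * indicator {0..2 * pi} \<theta>) = sin (2 * pi) - sin 0"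
      by (rule integral_FTC_Icc_real) (auto intro!: derivative_eq_intros)
    then show ?thesis by (simp add: mult.commute)
  qed
  \<comment> \<open>The cosine term is kept exactly rather than estimated, since it integrates to 0;
    only the cube is bounded pointwise.\<close>
  have pw: "Re (phase_term p s t \<theta>) * s + Re (phase_term p t s \<theta>) * t \<le> C + 2 * s * t * cos \<theta>" for \<theta>
  proof -
    let ?r = "norm (phase_sum s t \<theta>)"
    \<comment> \<open>With the common weight taken out,
      \<open>s * (s + t * cos \<theta>) + t * (t + s * cos \<theta>)\<close> remains.\<close>
    have "Re (phase_term p s t \<theta>) * s + Re (phase_term p t s \<theta>) * t = ?r powr (p - 1) * (s\<^sup>2 + t\<^sup>2 + 2 * s * t * cos \<theta>)"
      unfolding phase_term_def phase_sum_norm_commute[of t s]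
      by (simp add: phase_sum_Re power2_eq_square algebra_simps)
    also have "\<dots> = ?r powr (p - 1) * ?r\<^sup>2" by (simp only: phase_sum_norm_square)
    also have "\<dots> \<le> (1 + ?r) * ?r\<^sup>2"
      by (intro mult_right_mono powr_le_one_plus p) auto
    also have "\<dots> = ?r\<^sup>2 + ?r ^ 3" by (simp add: power2_eq_square power3_eq_cube algebra_simps)
    also have "?r ^ 3 \<le> (\<bar>s\<bar> + \<bar>t\<bar>) ^ 3" by (intro power_mono phase_sum_norm_le) auto
    also have "\<dots> \<le> 4 * (\<bar>s\<bar> ^ 3 + \<bar>t\<bar> ^ 3)" by (intro sum_cubed_le) auto
    finally show ?thesis unfolding phase_sum_norm_square C_def by simp
  qed
  have "(LINT \<theta>|lborel. ?I \<theta> * Re (phase_term p s t \<theta>)) * s + (LINT \<theta>|lborel. ?I \<theta> * Re (phase_term p t s \<theta>)) * t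
     = (LINT \<theta>|lborel. ?I \<theta> * Re (phase_term p s t \<theta>) * s + ?I \<theta> * Re (phase_term p t s \<theta>) * t)"
    using Ri by simp
  also have "\<dots> \<le> (LINT \<theta>|lborel. ?I \<theta> * C + 2 * s * t * (?I \<theta> * cos \<theta>))"
  proof (rule integral_mono)
    show "?I \<theta> * Re (phase_term p s t \<theta>) * s + ?I \<theta> * Re (phase_term p t s \<theta>) * t
        \<le> ?I \<theta> * C + 2 * s * t * (?I \<theta> * cos \<theta>)" for \<theta>
      using pw[of \<theta>] by (simp add: indicator_def)
  qed (use Ri ci in auto)
  also have "\<dots> = 2 * pi * C"
    using ci c0 by simp
  finally have "1 / (2 * pi) * ((LINT \<theta>|lborel. ?I \<theta> * Re (phase_term p s t \<theta>)) * s + (LINT \<theta>|lborel. ?I \<theta> * Re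
      (phase_term p t s \<theta>)) * t) \<le> C"
    by (simp add: field_simps)
  then show ?thesis unfolding Re C_def by (simp add: algebra_simps)
qed

section \<open>Testing the equation with its solution\<close>

lemma integral_inner_L2_tendsto:
  fixes f :: "R3 \<Rightarrow> 'b::euclidean_space"
  assumes f: "square_integrable f" and v: "\<And>n. square_integrable (v n)" and u: "square_integrable u"
    and lim: "(\<lambda>n. L2norm (\<lambda>x. v n x - u x)) \<longlonglongrightarrow> 0"
  shows "(\<lambda>n. LINT x|lborel. f x \<bullet> v n x) \<longlonglongrightarrow> (LINT x|lborel. f x \<bullet> u x)"
proof -
  have "\<bar>(LINT x|lborel. f x \<bullet> v n x) - (LINT x|lborel. f x \<bullet> u x)\<bar> \<le> L2norm f * L2norm (\<lambda>x. v n x - u x)" for n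
    using Cauchy_Schwarz_L2norm_inner[OF f square_integrable_diff[OF v u], of n]
      square_integrable_inner_integrable[OF f v, of n] square_integrable_inner_integrable[OF f u]
    by (simp add: inner_diff_right)
  then have "(\<lambda>n. (LINT x|lborel. f x \<bullet> v n x) - (LINT x|lborel. f x \<bullet> u x)) \<longlonglongrightarrow> 0"
    by (intro Lim_null_comparison[OF always_eventually tendsto_mult_right_zero[OF lim]]) auto
  then show ?thesis by (simp add: LIM_zero_iff)
qed

lemma weak_gradient_props:
  assumes "u \<in> H1"
  shows "square_integrable u" "has_L2_weak_gradient u (weak_gradient u)" "square_integrable (weak_gradient u)"
proof -
  show "square_integrable u" using assms by (simp add: H1_def)
  show "has_L2_weak_gradient u (weak_gradient u)"
    unfolding weak_gradient_def using assms by (intro someI_ex[of "has_L2_weak_gradient u"]) (simp add: H1_def)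
  then show "square_integrable (weak_gradient u)" by (simp add: has_L2_weak_gradient_def)
qed

lemma potential_term_square_integrable:
  assumes u: "u \<in> H1" and w: "w \<in> H1"
  shows "square_integrable (\<lambda>x. (m * newton_potential u x - k * newton_potential w x) * u x)"
proof -
  note up = weak_gradient_props[OF u] and wp = weak_gradient_props[OF w]
  note ub = newton_potential_bound[OF up(1,2)] and wb = newton_potential_bound[OF wp(1,2)]
  let ?A = "L2norm u * L2norm (weak_gradient u) / (4 * pi)" and ?B = "L2norm w * L2norm (weak_gradient w) / (4 * pi)"
  note [measurable] = newton_potential_measurable[OF up(1)] newton_potential_measurable[OF wp(1)]
  have "\<bar>m * newton_potential u x - k * newton_potential w x\<bar> \<le> \<bar>m\<bar> * ?A + \<bar>k\<bar> * ?B" for x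
  proof -
    have "\<bar>m * newton_potential u x\<bar> \<le> \<bar>m\<bar> * ?A" "\<bar>k * newton_potential w x\<bar> \<le> \<bar>k\<bar> * ?B"
      using mult_left_mono[OF ub(3)[of x], of "\<bar>m\<bar>"] mult_left_mono[OF wb(3)[of x], of "\<bar>k\<bar>"] ub(2)[of x] wb(2)[of x]
      by (simp_all add: abs_mult)
    then show ?thesis by linarith
  qed
  from square_integrable_bounded_mult(1)[OF up(1) _ this] show ?thesis
    by simp
qed

text \<open>The linear part of the growth bound is controlled by the L2 norms. The quadratic part
  leaves the integrals of \<open>\<bar>f x\<bar>\<close> weighted by the squares of \<open>u\<close>
  and \<open>w\<close>, which the Coulomb estimates bound. It is applied to test functions, to the
  solution and to their difference.\<close>

lemma nonlinearity_mult_integrable: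
  assumes p: "1 < p" "p \<le> 2" and u: "square_integrable u" and w: "square_integrable w" and f: "square_integrable f"
    and 1: "integrable lborel (\<lambda>x. (u x)\<^sup>2 * \<bar>f x\<bar>)" and 2: "integrable lborel (\<lambda>x. (w x)\<^sup>2 * \<bar>f x\<bar>)"
  shows "integrable lborel (\<lambda>x. averaged_nonlinearity p (u x) (w x) * of_real (f x))"
    and "\<bar>LINT x|lborel. Re (averaged_nonlinearity p (u x) (w x)) * f x\<bar> \<le>
      (L2norm u + L2norm w) * L2norm f + 2 * (LINT x|lborel. (u x)\<^sup>2 * \<bar>f x\<bar>) + 2 * (LINT x|lborel. (w x)\<^sup>2 * \<bar>f x\<bar>)"
proof -
  have [measurable]: "u \<in> borel_measurable borel" "w \<in> borel_measurable borel" "f \<in> borel_measurable borel"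
    using u w f by auto
  define h where "h x = norm (u x) * norm (f x) + norm (w x) * norm (f x) + 2 * ((u x)\<^sup>2 * \<bar>f x\<bar>) + 2 * ((w x)\<^sup>2 * \<bar>f
      x\<bar>)" for x
  have hi: "integrable lborel h"
    unfolding h_def[abs_def] by (intro Bochner_Integration.integrable_add integrable_mult_right 1 2
        square_integrable_mult_integrable u w f)
  have le: "norm (averaged_nonlinearity p (u x) (w x) * of_real (f x)) \<le> h x" for x
  proof -
    have "(\<bar>u x\<bar> + \<bar>w x\<bar>)\<^sup>2 \<le> 2 * (u x)\<^sup>2 + 2 * (w x)\<^sup>2"
      using sum_squares_bound[of "\<bar>u x\<bar>" "\<bar>w x\<bar>"] by (simp add: power2_sum)
    then have "norm (averaged_nonlinearity p (u x) (w x)) \<le> \<bar>u x\<bar> + \<bar>w x\<bar> + (2 * (u x)\<^sup>2 + 2 * (w x)\<^sup>2)"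
      using averaged_nonlinearity_norm_le[OF p, of "u x" "w x"] by linarith
    then have "norm (averaged_nonlinearity p (u x) (w x)) * \<bar>f x\<bar> \<le> (\<bar>u x\<bar> + \<bar>w x\<bar> + (2 * (u x)\<^sup>2 + 2 * (w x)\<^sup>2)) * \<bar>f x\<bar>"
      by (intro mult_right_mono) auto
    then show ?thesis by (simp add: h_def norm_mult algebra_simps)
  qed
  show i: "integrable lborel (\<lambda>x. averaged_nonlinearity p (u x) (w x) * of_real (f x))"
    by (rule Bochner_Integration.integrable_bound[OF hi])
      (use le in \<open>auto intro!: AE_I2 intro: order_trans[OF _ abs_ge_self] simp del: norm_mult\<close>)
  have Re: "Re (averaged_nonlinearity p (u x) (w x) * of_real (f x)) = Re (averaged_nonlinearity p (u x) (w x)) * f x" for x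
    by simp
  have "\<bar>LINT x|lborel. Re (averaged_nonlinearity p (u x) (w x)) * f x\<bar>
      \<le> (LINT x|lborel. \<bar>Re (averaged_nonlinearity p (u x) (w x)) * f x\<bar>)"
    by (rule integral_abs_bound)
  also have "\<dots> \<le> (LINT x|lborel. h x)"
  proof (rule integral_mono[OF _ hi])
    show "integrable lborel (\<lambda>x. \<bar>Re (averaged_nonlinearity p (u x) (w x)) * f x\<bar>)"
      using integrable_Re[OF i] by simp
    show "\<bar>Re (averaged_nonlinearity p (u x) (w x)) * f x\<bar> \<le> h x" for x
      using order_trans[OF abs_Re_le_cmod le, of x] unfolding Re .
  qed
  also have "\<dots> = (LINT x|lborel. norm (u x) * norm (f x)) + (LINT x|lborel. norm (w x) * norm (f x))
      + 2 * (LINT x|lborel. (u x)\<^sup>2 * \<bar>f x\<bar>) + 2 * (LINT x|lborel. (w x)\<^sup>2 * \<bar>f x\<bar>)"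
    unfolding h_def
    using 1 2 square_integrable_mult_integrable[OF u f] square_integrable_mult_integrable[OF w f] by simp
  finally show "\<bar>LINT x|lborel. Re (averaged_nonlinearity p (u x) (w x)) * f x\<bar> \<le>
      (L2norm u + L2norm w) * L2norm f + 2 * (LINT x|lborel. (u x)\<^sup>2 * \<bar>f x\<bar>) + 2 * (LINT x|lborel. (w x)\<^sup>2 * \<bar>f x\<bar>)"
    using Cauchy_Schwarz_L2norm[OF u f] Cauchy_Schwarz_L2norm[OF w f] by (simp add: distrib_right)
qed

text \<open>The solution is approximated by test functions in the \<open>H1\<close> norm. The
  left-hand side is an L2 pairing since the potential is bounded; the right-hand side converges by
  the growth bound and \<open>charge_approximation\<close>.\<close>

lemma weak_solution_energy:
  assumes p: "1 < p" "p \<le> 2" and u: "u \<in> H1" and w: "w \<in> H1" and sol: "weak_solution p lam m k u w"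
  shows "(L2norm (weak_gradient u))\<^sup>2 + lam * (L2norm u)\<^sup>2
      + m * coulomb (\<lambda>x. (u x)\<^sup>2) (\<lambda>x. (u x)\<^sup>2) - k * coulomb (\<lambda>x. (u x)\<^sup>2) (\<lambda>x. (w x)\<^sup>2)
    = (LINT x|lborel. Re (averaged_nonlinearity p (u x) (w x)) * u x)"
    and "integrable lborel (\<lambda>x. Re (averaged_nonlinearity p (u x) (w x)) * u x)"
proof -
  note up = weak_gradient_props[OF u] and wp = weak_gradient_props[OF w]
  define g where "g = weak_gradient u"
  have gs: "square_integrable g" and g: "has_L2_weak_gradient u g" using up by (auto simp: g_def)
  note uc = charge_square[OF up(1,2)] and wc = charge_square[OF wp(1,2)]
  obtain v where v: "\<And>n. v n \<in> test_functions" "(\<lambda>n. L2norm (\<lambda>x. v n x - u x)) \<longlonglongrightarrow> 0"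
    "(\<lambda>n. L2norm (\<lambda>x. grad (v n) x - g x)) \<longlonglongrightarrow> 0"
    by (rule test_functions_dense[OF up(1) g]) blast
  note vs = test_function_square_integrable[OF v(1)]
  let ?c = "\<lambda>x. m * newton_potential u x - k * newton_potential w x"
  note cs = potential_term_square_integrable[OF u w, of m k]
  let ?N = "\<lambda>x. averaged_nonlinearity p (u x) (w x)"
  have Nu: "integrable lborel (\<lambda>x. ?N x * of_real (u x))"
    by (intro nonlinearity_mult_integrable p up wp integral_charge_mult_abs_le(1)[OF uc(1) up(1,2)]
        integral_charge_mult_abs_le(1)[OF wc(1) up(1,2)])
  have Nv: "integrable lborel (\<lambda>x. ?N x * of_real (v n x))" for n
    by (intro nonlinearity_mult_integrable p up wp vs integral_charge_test_function_le(1)[OF uc(1) v(1)]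
        integral_charge_test_function_le(1)[OF wc(1) v(1)])
  show Ni: "integrable lborel (\<lambda>x. Re (?N x) * u x)"
    using integrable_Re[OF Nu] by simp
  have Nvi: "integrable lborel (\<lambda>x. Re (?N x) * v n x)" for n
    using integrable_Re[OF Nv[of n]] by simp
  have eq: "(LINT x|lborel. g x \<bullet> grad (v n) x) + lam * (LINT x|lborel. u x \<bullet> v n x) + (LINT x|lborel. (?c x * u x) \<bullet> v n x)
     = (LINT x|lborel. Re (?N x) * v n x)" for n
  proof -
    have "complex_of_real (LINT x|lborel. g x \<bullet> grad (v n) x + lam * u x * v n x + ?c x * u x * v n x)
       = (LINT x|lborel. ?N x * of_real (v n x))"
      using sol[unfolded weak_solution_def, rule_format, OF v(1)[of n]] unfolding g_def by simp
    \<comment> \<open>The equation is one between complex numbers; since test functions are real,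
      its real part involves only the real part of the nonlinearity.\<close>
    from arg_cong[OF this, of Re]
    have "(LINT x|lborel. g x \<bullet> grad (v n) x + lam * u x * v n x + ?c x * u x * v n x)
        = Re (LINT x|lborel. ?N x * of_real (v n x))"
      by (simp only: Re_complex_of_real)
    also have "\<dots> = (LINT x|lborel. Re (?N x) * v n x)"
      using integral_Re[OF Nv[of n]] by simp
    also have "(LINT x|lborel. g x \<bullet> grad (v n) x + lam * u x * v n x + ?c x * u x * v n x) =
       (LINT x|lborel. g x \<bullet> grad (v n) x + lam * (u x \<bullet> v n x) + (?c x * u x) \<bullet> v n x)"
      by (simp add: mult.assoc)
    also have "\<dots> = (LINT x|lborel. g x \<bullet> grad (v n) x) + lam * (LINT x|lborel. u x \<bullet> v n x) + (LINT x|lborel. (?c x *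
        u x) \<bullet> v n x)"
      using square_integrable_inner_integrable[OF gs vs(2)[of n]] square_integrable_inner_integrable[OF up(1) vs(1)[of n]]
        square_integrable_inner_integrable[OF cs vs(1)[of n]]
      by (simp del: inner_real_def)
    finally show ?thesis by simp
  qed
  have "(\<lambda>n. (LINT x|lborel. g x \<bullet> grad (v n) x) + lam * (LINT x|lborel. u x \<bullet> v n x) + (LINT x|lborel. (?c x * u x) \<bullet>
      v n x))
     \<longlonglongrightarrow> (LINT x|lborel. g x \<bullet> g x) + lam * (LINT x|lborel. u x \<bullet> u x) + (LINT x|lborel. (?c x * u x) \<bullet> u x)"
    by (intro tendsto_add tendsto_mult tendsto_const integral_inner_L2_tendsto gs vs up(1) cs v)
  moreover have "(\<lambda>n. LINT x|lborel. Re (?N x) * v n x) \<longlonglongrightarrow> (LINT x|lborel. Re (?N x) * u x)"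
  proof -
    \<comment> \<open>In the error bound, the first term comes from the linear growth of the
      nonlinearity, the other two from its quadratic growth in \<open>u\<close> and in
      \<open>w\<close>.\<close>
    let ?Du = "sqrt (coulomb (\<lambda>x. (u x)\<^sup>2) (\<lambda>x. (u x)\<^sup>2))" and ?Dw = "sqrt (coulomb (\<lambda>x. (w x)\<^sup>2) (\<lambda>x. (w x)\<^sup>2))"
    let ?b = "\<lambda>n. (L2norm u + L2norm w) * L2norm (\<lambda>x. v n x - u x) + 2 * (L2norm (\<lambda>x. grad (v n) x - g x) * ?Du) + 2 *
        (L2norm (\<lambda>x. grad (v n) x - g x) * ?Dw)"
    have le: "\<bar>(LINT x|lborel. Re (?N x) * v n x) - (LINT x|lborel. Re (?N x) * u x)\<bar> \<le> ?b n" for n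
    proof -
      note au = charge_approximation[OF uc(1) up(1) gs v, of n] and aw = charge_approximation[OF wc(1) up(1) gs v, of n]
      have "\<bar>LINT x|lborel. Re (?N x) * (v n x - u x)\<bar> \<le> ?b n"
        using nonlinearity_mult_integrable(2)[OF p up(1) wp(1) square_integrable_diff[OF vs(1) up(1)] au(1) aw(1)]
            au(2) aw(2)
        by linarith
      then show ?thesis using Ni Nvi[of n] by (simp add: right_diff_distrib)
    qed
    have "?b \<longlonglongrightarrow> (L2norm u + L2norm w) * 0 + 2 * (0 * ?Du) + 2 * (0 * ?Dw)"
      by (intro tendsto_intros v)
    then have "?b \<longlonglongrightarrow> 0" by simp
    then have "(\<lambda>n. (LINT x|lborel. Re (?N x) * v n x) - (LINT x|lborel. Re (?N x) * u x)) \<longlonglongrightarrow> 0"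
      by (rule Lim_null_comparison[rotated]) (use le in auto)
    then show ?thesis by (simp add: LIM_zero_iff)
  qed
  ultimately have lim: "(LINT x|lborel. g x \<bullet> g x) + lam * (LINT x|lborel. u x \<bullet> u x) + (LINT x|lborel. (?c x * u x) \<bullet>
      u x) = (LINT x|lborel. Re (?N x) * u x)"
    unfolding eq by (rule LIMSEQ_unique)
  have "(LINT x|lborel. (?c x * u x) \<bullet> u x)
      = (LINT x|lborel. m * ((u x)\<^sup>2 * newton_potential u x) - k * ((u x)\<^sup>2 * newton_potential w x))"
    by (rule Bochner_Integration.integral_cong) (simp_all add: power2_eq_square algebra_simps)
  also have "\<dots> = m * coulomb (\<lambda>x. (u x)\<^sup>2) (\<lambda>x. (u x)\<^sup>2) - k * coulomb (\<lambda>x. (u x)\<^sup>2) (\<lambda>x. (w x)\<^sup>2)"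
    unfolding coulomb_def uc(2) wc(2)
    using charge_mult_potential_integrable[OF uc(1) uc(1)] charge_mult_potential_integrable[OF uc(1) wc(1)]
    by (simp add: uc(2) wc(2))
  finally show "(L2norm (weak_gradient u))\<^sup>2 + lam * (L2norm u)\<^sup>2
      + m * coulomb (\<lambda>x. (u x)\<^sup>2) (\<lambda>x. (u x)\<^sup>2) - k * coulomb (\<lambda>x. (u x)\<^sup>2) (\<lambda>x. (w x)\<^sup>2)
    = (LINT x|lborel. Re (?N x) * u x)"
    using lim by (simp add: L2norm_square g_def dot_square_norm power2_eq_square[of "u _"])
qed

section \<open>The trivial pair and the conclusion\<close>

lemma L2norm_eq_0:
  assumes "square_integrable u" "L2norm u = 0"
  shows "AE x in lborel. u x = 0"
proof -
  have "(LINT x|lborel. (norm (u x))\<^sup>2) = 0" using assms(2) L2norm_square[of u] by simp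
  then have "AE x in lborel. (norm (u x))\<^sup>2 = 0"
    by (subst (asm) integral_nonneg_eq_0_iff_AE[OF square_integrableD[OF assms(1)]]) auto
  then show ?thesis by simp
qed

text \<open>\<open>weak_gradient u\<close> is an arbitrary choice, and its vanishing almost
  everywhere is not proved. Only its pairings with gradients of test functions matter, and these
  vanish by its defining identity.\<close>

lemma weak_solution_trivial:
  assumes u: "u \<in> H1" and u0: "AE x in lborel. u x = 0" and w0: "AE x in lborel. w x = 0"
    and wm: "w \<in> borel_measurable borel"
  shows "weak_solution p lam m k u w"
  unfolding weak_solution_def
proof
  fix v assume v: "v \<in> test_functions"
  note up = weak_gradient_props[OF u]
  have [measurable]: "u \<in> borel_measurable borel" "weak_gradient u \<in> borel_measurable borel" "w \<in> borel_measurable borel"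
    using up wm by auto
  have vm[measurable]: "v \<in> borel_measurable borel" "grad v \<in> borel_measurable borel"
    using test_function_square_integrable[OF v] by auto
  have pot[measurable]: "newton_potential u \<in> borel_measurable borel" "newton_potential w \<in> borel_measurable borel"
    unfolding newton_potential_def[abs_def] by measurable
  have comp: "(LINT x|lborel. weak_gradient u x $ i * partial_deriv i v x) = 0" for i
  proof -
    \<comment> \<open>The defining identity is used with the test function
      \<open>partial_deriv i v\<close> in place of \<open>v\<close>.\<close>
    have "(LINT x|lborel. u x * partial_deriv i (partial_deriv i v) x)
        = - (LINT x|lborel. weak_gradient u x $ i * partial_deriv i v x)"
      using up(2) test_function_partial_deriv[OF v] by (simp add: has_L2_weak_gradient_def)
    moreover have "partial_deriv i (partial_deriv i v) \<in> borel_measurable borel"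
      using test_function_square_integrable(1)[OF test_function_partial_deriv[OF test_function_partial_deriv[OF v]]] by auto
    then have "(LINT x|lborel. u x * partial_deriv i (partial_deriv i v) x) = (LINT x|(lborel :: R3 measure). 0)"
      by (intro integral_cong_AE) (use u0 in auto)
    ultimately show ?thesis by simp
  qed
  have int: "integrable lborel (\<lambda>x. weak_gradient u x $ i * partial_deriv i v x)" for i
    using square_integrable_inner_integrable[OF square_integrable_nth[OF up(3)] test_function_square_integrable(1)[OF
        test_function_partial_deriv[OF v]], of i i]
    by simp
  have "(LINT x|lborel. weak_gradient u x \<bullet> grad v x + lam * u x * v x
         + (m * newton_potential u x - k * newton_potential w x) * u x * v x)
    = (LINT x|lborel. (\<Sum>i\<in>UNIV. weak_gradient u x $ i * partial_deriv i v x))"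
  proof (rule integral_cong_AE)
    show "(\<lambda>x. \<Sum>i\<in>UNIV. weak_gradient u x $ i * partial_deriv i v x) \<in> borel_measurable lborel"
      using int by auto
    show "AE x in lborel. weak_gradient u x \<bullet> grad v x + lam * u x * v x
         + (m * newton_potential u x - k * newton_potential w x) * u x * v x
        = (\<Sum>i\<in>UNIV. weak_gradient u x $ i * partial_deriv i v x)"
      using u0 by eventually_elim (simp add: inner_vec_def grad_def)
  qed measurable
  also have "\<dots> = 0" using int by (simp add: comp)
  finally have L: "(LINT x|lborel. weak_gradient u x \<bullet> grad v x + lam * u x * v x
         + (m * newton_potential u x - k * newton_potential w x) * u x * v x) = 0" .
  have "averaged_nonlinearity p 0 0 = 0"
    by (simp add: averaged_nonlinearity_def)
  then have "(LINT x|lborel. averaged_nonlinearity p (u x) (w x) * of_real (v x))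
      = (LINT x|(lborel :: R3 measure). (0 :: complex))"
    by (intro integral_cong_AE) (use u0 w0 in \<open>auto elim!: eventually_elim2\<close>)
  with L show "complex_of_real (LINT x|lborel. weak_gradient u x \<bullet> grad v x + lam * u x * v x
         + (m * newton_potential u x - k * newton_potential w x) * u x * v x)
     = (LINT x|lborel. averaged_nonlinearity p (u x) (w x) * of_real (v x))"
    by simp
qed

lemma quadratic_form_nonneg:
  fixes a b c x y :: real
  assumes "a > 0" "a * c \<ge> b\<^sup>2"
  shows "a * x\<^sup>2 - 2 * b * (x * y) + c * y\<^sup>2 \<ge> 0"
proof -
  have "a * (a * x\<^sup>2 - 2 * b * (x * y) + c * y\<^sup>2) = (a * x - b * y)\<^sup>2 + (a * c - b\<^sup>2) * y\<^sup>2"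
    by (simp add: power2_eq_square algebra_simps)
  also have "\<dots> \<ge> 0" using assms(2) by simp
  finally show ?thesis using assms(1) by (simp add: zero_le_mult_iff)
qed

text \<open>Uniqueness is the direction from left to right; the converse records that every
  representative of zero solves the system, so the solution set is exactly the trivial one.\<close>

theorem theorem1p5:
  fixes p lam \<mu>11 \<mu>12 \<mu>22 :: real and u1 u2 :: "real ^ 3 \<Rightarrow> real"
  assumes "1 < p" and "p \<le> 2"
    and "\<mu>11 > 0" and "\<mu>12 > 0" and "\<mu>22 > 0"
    and "lam \<ge> 2" and "\<mu>11 > 4" and "(\<mu>11 - 4) * (\<mu>22 - 4) > \<mu>12\<^sup>2"
    and "u1 \<in> H1" and "u2 \<in> H1"
  shows "weak_solution p lam \<mu>11 \<mu>12 u1 u2 \<and> weak_solution p lam \<mu>22 \<mu>12 u2 u1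
    \<longleftrightarrow> (AE x in lborel. u1 x = 0) \<and> (AE x in lborel. u2 x = 0)"
proof
  assume "(AE x in lborel. u1 x = 0) \<and> (AE x in lborel. u2 x = 0)"
  then show "weak_solution p lam \<mu>11 \<mu>12 u1 u2 \<and> weak_solution p lam \<mu>22 \<mu>12 u2 u1"
    using assms(9,10) weak_gradient_props(1)[OF assms(9)] weak_gradient_props(1)[OF assms(10)]
    by (auto intro!: weak_solution_trivial)
next
  assume sol: "weak_solution p lam \<mu>11 \<mu>12 u1 u2 \<and> weak_solution p lam \<mu>22 \<mu>12 u2 u1"
  note p = assms(1,2) and h1 = weak_gradient_props[OF assms(9)] and h2 = weak_gradient_props[OF assms(10)]
  note c1 = charge_square(1)[OF h1(1,2)] and c2 = charge_square(1)[OF h2(1,2)]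
  let ?\<rho>1 = "\<lambda>x. (u1 x)\<^sup>2" and ?\<rho>2 = "\<lambda>x. (u2 x)\<^sup>2"
  define A1 A2 U1 U2 where "A1 = L2norm (weak_gradient u1)" "A2 = L2norm (weak_gradient u2)" "U1 = L2norm u1" "U2
      = L2norm u2"
  define X Y where "X = sqrt (coulomb ?\<rho>1 ?\<rho>1)" "Y = sqrt (coulomb ?\<rho>2 ?\<rho>2)"
  have XX: "coulomb ?\<rho>1 ?\<rho>1 = X\<^sup>2" "coulomb ?\<rho>2 ?\<rho>2 = Y\<^sup>2"
    using coulomb_Cauchy_Schwarz(1)[OF c1 c1] coulomb_Cauchy_Schwarz(1)[OF c2 c2] by (simp_all add: X_Y_def)
  have XY: "coulomb ?\<rho>1 ?\<rho>2 \<le> X * Y" "coulomb ?\<rho>2 ?\<rho>1 \<le> X * Y"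
    using coulomb_Cauchy_Schwarz(2)[OF c1 c2] coulomb_Cauchy_Schwarz(2)[OF c2 c1] by (simp_all add: X_Y_def mult.commute)
  let ?N1 = "\<lambda>x. Re (averaged_nonlinearity p (u1 x) (u2 x)) * u1 x" and ?N2 =
      "\<lambda>x. Re (averaged_nonlinearity p (u2 x) (u1 x)) * u2 x"
  note e1 = weak_solution_energy[OF p assms(9,10) conjunct1[OF sol]]
  note e2 = weak_solution_energy[OF p assms(10,9) conjunct2[OF sol]]
  note s1 = integral_charge_mult_abs_le[OF c1 h1(1,2)] and s2 = integral_charge_mult_abs_le[OF c2 h2(1,2)]
  have i1: "integrable lborel ?\<rho>1" "integrable lborel ?\<rho>2" using chargeD(1) c1 c2 by auto
  have "(LINT x|lborel. ?N1 x) + (LINT x|lborel. ?N2 x) = (LINT x|lborel. ?N1 x + ?N2 x)"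
    using e1(2) e2(2) by simp
  also have "\<dots> \<le> (LINT x|lborel. ?\<rho>1 x + ?\<rho>2 x + 4 * (?\<rho>1 x * \<bar>u1 x\<bar> + ?\<rho>2 x * \<bar>u2 x\<bar>))"
  proof (rule integral_mono)
    fix x
    have "?\<rho>1 x * \<bar>u1 x\<bar> = \<bar>u1 x\<bar> ^ 3" "?\<rho>2 x * \<bar>u2 x\<bar> = \<bar>u2 x\<bar> ^ 3"
      by (simp_all add: power3_eq_cube power2_eq_square flip: abs_mult)
    then show "?N1 x + ?N2 x \<le> ?\<rho>1 x + ?\<rho>2 x + 4 * (?\<rho>1 x * \<bar>u1 x\<bar> + ?\<rho>2 x * \<bar>u2 x\<bar>)"
      using averaged_nonlinearity_energy[OF p, of "u1 x" "u2 x"] by simp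
  qed (use e1(2) e2(2) s1(1) s2(1) i1 in auto)
  also have "\<dots> = U1\<^sup>2 + U2\<^sup>2 + 4 * ((LINT x|lborel. ?\<rho>1 x * \<bar>u1 x\<bar>) + (LINT x|lborel. ?\<rho>2 x * \<bar>u2 x\<bar>))"
    using s1(1) s2(1) i1 by (simp add: A1_A2_U1_U2_def L2norm_square)
  also have "\<dots> \<le> U1\<^sup>2 + U2\<^sup>2 + 4 * (A1 * X + A2 * Y)"
    using s1(2) s2(2) by (simp add: A1_A2_U1_U2_def X_Y_def)
  \<comment> \<open>Young's inequality with weights chosen so that the coefficient of each squared
    gradient norm is exactly 1, as on the left-hand side of the energy identities.\<close>
  also have "4 * (A1 * X + A2 * Y) \<le> A1\<^sup>2 + 4 * X\<^sup>2 + (A2\<^sup>2 + 4 * Y\<^sup>2)"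
    using sum_squares_bound[of A1 "2 * X"] sum_squares_bound[of A2 "2 * Y"] by (simp add: power_mult_distrib)
  finally have up: "(LINT x|lborel. ?N1 x) + (LINT x|lborel. ?N2 x) \<le> U1\<^sup>2 + U2\<^sup>2 + (A1\<^sup>2 + 4 * X\<^sup>2 + (A2\<^sup>2 + 4 * Y\<^sup>2))"
    by simp
  \<comment> \<open>The sign of \<open>\<mu>12\<close> turns the Cauchy-Schwarz bound on the mixed
    Coulomb energy into a lower bound for the coupling term.\<close>
  have "A1\<^sup>2 + lam * U1\<^sup>2 + \<mu>11 * X\<^sup>2 - \<mu>12 * (X * Y) \<le> (LINT x|lborel. ?N1 x)"
    using e1(1) mult_left_mono[OF XY(1), of \<mu>12] assms(4) unfolding XX A1_A2_U1_U2_def by linarith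
  moreover have "A2\<^sup>2 + lam * U2\<^sup>2 + \<mu>22 * Y\<^sup>2 - \<mu>12 * (X * Y) \<le> (LINT x|lborel. ?N2 x)"
    using e2(1) mult_left_mono[OF XY(2), of \<mu>12] assms(4) unfolding XX A1_A2_U1_U2_def by linarith
  \<comment> \<open>The gradient norms cancel. What is left is a sum of two terms, the second of
    which is nonnegative by the determinant condition on the shifted coefficients.\<close>
  ultimately have "(lam - 1) * (U1\<^sup>2 + U2\<^sup>2) + ((\<mu>11 - 4) * X\<^sup>2 - 2 * \<mu>12 * (X * Y) + (\<mu>22 - 4) * Y\<^sup>2) \<le> 0"
    using up by (simp add: algebra_simps)
  moreover have "(\<mu>11 - 4) * X\<^sup>2 - 2 * \<mu>12 * (X * Y) + (\<mu>22 - 4) * Y\<^sup>2 \<ge> 0"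
    by (rule quadratic_form_nonneg) (use assms(7,8) in auto)
  ultimately have "(lam - 1) * (U1\<^sup>2 + U2\<^sup>2) \<le> 0" by linarith
  then have "U1\<^sup>2 + U2\<^sup>2 \<le> 0"
    using assms(6) by (simp add: mult_le_0_iff)
  then have "U1 = 0" "U2 = 0"
    using zero_le_power2[of U1] zero_le_power2[of U2] by (simp_all add: sum_power2_le_zero_iff)
  then show "(AE x in lborel. u1 x = 0) \<and> (AE x in lborel. u2 x = 0)"
    using L2norm_eq_0[OF h1(1)] L2norm_eq_0[OF h2(1)] by (simp add: A1_A2_U1_U2_def)
qed

end
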